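(* Let $T$ be a tree with dissociation number $\psi=\psi(T)$, and let $\Phi(T)$ denote the number of maximum dissociation sets of $T$. Then: (1) if $\psi=1$, then $\Phi(T)=1$; (2) if $\psi$ is odd and $\psi\ge 3$, then $\Phi(T)\le 3^{\frac{\psi-1}{2}-1}+1$, with equality if and only if $T$ is isomorphic to a tree in the family $\mathcal{T}_1$; (3) if $\psi$ is even, then $\Phi(T)\le 3^{\frac{\psi}{2}-1}+\frac{\psi}{2}+1$, with equality if and only if $T$ is isomorphic to a tree in the family $\mathcal{T}_2$.
   Context: All graphs are finite, simple, undirected and labeled (so vertex subsets are counted as distinct sets, not up to automorphism). A dissociation set of a graph $G$ is a set of vertices inducing a subgraph of maximum degree at most $1$. A maximum dissociation set is a dissociation set of maximum cardinality; the dissociation number $\psi(G)$ is the cardinality of a maximum dissociation set, and $\Phi(G)$ is the number of maximum dissociation sets of $G$. $P_n$ denotes the path on $n$ vertices, $nG$ denotes the disjoint union of $n$ copies of $G$, and $G\cup H$ denotes the disjoint union of $G$ and $H$. The family $\mathcal{T}_1$ consists of all trees obtained, for some integer $k\ge 0$, from $2P_2\cup kP_3$ by fixing one copy of $P_2$ and a vertex $v_o$ in it, and then, for each of the other copies (the other copy of $P_2$ and the $k$ copies of $P_3$), adding one edge joining $v_o$ to a vertex (arbitrarily chosen) of that copy. The family $\mathcal{T}_2$ consists of all trees obtained, for some integer $j\ge 0$, from $(j+1)P_3$ by fixing one copy of $P_3$ and a leaf $v_e$ of it, and then, for each of the other $j$ copies of $P_3$, adding one edge joining $v_e$ to a leaf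 of that copy. *)

theory Defs
  imports "Graph_Theory.Graph_Theory"
begin

text \<open>
  A finite simple undirected graph is a \<^term>\<open>pair_graph\<close>: a finite vertex set with a
  symmetric irreflexive set of arcs, each edge \<open>{u, v}\<close> being the two arcs \<open>(u, v)\<close> and
  \<open>(v, u)\<close>. The degree of a vertex is therefore its \<^const>\<open>out_degree\<close>, and graph isomorphism
  is \<^const>\<open>digraph_iso\<close>.

  The predicates \<^const>\<open>forest\<close> and \<^const>\<open>tree\<close> of the library do not fit this representation:
  traversing an edge back and forth is a \<open>cycle\<close> of length 2. Undirected cycles
  are the cycles of length at least 3. \<^const>\<open>connected\<close> includes nonemptiness.
\<close>

definition undirected_tree :: "'a pair_pre_digraph \<Rightarrow> bool" where
  "undirected_tree G \<longleftrightarrow>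
     pair_graph G \<and> connected (with_proj G) \<and>
     \<not> (\<exists>p. pre_digraph.cycle (with_proj G) p \<and> 3 \<le> length p)"

definition dissociation_set :: "'a pair_pre_digraph \<Rightarrow> 'a set \<Rightarrow> bool" where
  "dissociation_set G S \<longleftrightarrow>
     S \<subseteq> pverts G \<and> (\<forall>v\<in>S. out_degree (with_proj G \<restriction> S) v \<le> 1)"

definition dissociation_number :: "'a pair_pre_digraph \<Rightarrow> nat" where
  "dissociation_number G = Max {card S | S. dissociation_set G S}"

definition maximum_dissociation_set :: "'a pair_pre_digraph \<Rightarrow> 'a set \<Rightarrow> bool" where
  "maximum_dissociation_set G S \<longleftrightarrow>
     dissociation_set G S \<and> (\<forall>S'. dissociation_set G S' \<longrightarrow> card S' \<le> card S)"

definition num_maximum_dissociation_sets :: "'a pair_pre_digraph \<Rightarrow> nat" where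
  "num_maximum_dissociation_sets G = card {S. maximum_dissociation_set G S}"

definition path_graph :: "nat \<Rightarrow> nat pair_pre_digraph" where
  "path_graph n =
     \<lparr> pverts = {..<n}, parcs = {(i, j). i < n \<and> j < n \<and> (j = Suc i \<or> i = Suc j)} \<rparr>"

definition leaves :: "'a pair_pre_digraph \<Rightarrow> 'a set" where
  "leaves G = {v \<in> pverts G. out_degree (with_proj G) v = 1}"

definition disjoint_union ::
    "'i set \<Rightarrow> ('i \<Rightarrow> 'a pair_pre_digraph) \<Rightarrow> ('i \<times> 'a) pair_pre_digraph" where
  "disjoint_union I G =
     \<lparr> pverts = (SIGMA i:I. pverts (G i)),
       parcs = {((i, u), (i, v)) | i u v. i \<in> I \<and> (u, v) \<in> parcs (G i)} \<rparr>"

definition add_edges :: "'a pair_pre_digraph \<Rightarrow> 'a rel \<Rightarrow> 'a pair_pre_digraph" where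
  "add_edges G R = \<lparr> pverts = pverts G, parcs = parcs G \<union> R \<union> R\<inverse> \<rparr>"

text \<open>
  In the disjoint union of the graphs \<open>G i\<close>, join the vertex \<open>v\<close> of copy \<open>c\<close> by one edge to
  the vertex \<open>a i\<close> of every other copy \<open>i\<close>.
\<close>

definition join_copies ::
    "'i set \<Rightarrow> ('i \<Rightarrow> 'a pair_pre_digraph) \<Rightarrow> 'i \<Rightarrow> 'a \<Rightarrow> ('i \<Rightarrow> 'a) \<Rightarrow> ('i \<times> 'a) pair_pre_digraph"
  where
  "join_copies I G c v a = add_edges (disjoint_union I G) {((c, v), (i, a i)) | i. i \<in> I - {c}}"

text \<open>
  In \<open>family_T1\<close>, the copies 0 and 1 form \<open>2P\<^sub>2\<close> and the copies \<open>2, \<dots>, k + 1\<close> form \<open>kP\<^sub>3\<close>.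
\<close>

definition T1_copy :: "nat \<Rightarrow> nat pair_pre_digraph" where
  "T1_copy i = (if i < 2 then path_graph 2 else path_graph 3)"

definition family_T1 :: "(nat \<times> nat) pair_pre_digraph set" where
  "family_T1 =
     {join_copies {..<k + 2} T1_copy c v\<^sub>o a | k c v\<^sub>o a.
        c < 2 \<and> v\<^sub>o \<in> pverts (T1_copy c) \<and>
        (\<forall>i \<in> {..<k + 2} - {c}. a i \<in> pverts (T1_copy i))}"

definition family_T2 :: "(nat \<times> nat) pair_pre_digraph set" where
  "family_T2 =
     {join_copies {..<j + 1} (\<lambda>_. path_graph 3) c v\<^sub>e a | j c v\<^sub>e a.
        c < j + 1 \<and> v\<^sub>e \<in> leaves (path_graph 3) \<and>
        (\<forall>i \<in> {..<j + 1} - {c}. a i \<in> leaves (path_graph 3))}"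

end

theory Submission
  imports Defs
begin

text \<open>
  In a tree rooted at \<open>r\<close>, every maximum dissociation set avoids \<open>r\<close>, contains it as an isolated
  vertex, or contains it together with one neighbour. Call \<open>r\<close> free if some maximum set avoids
  it. Following how these three counts change when two rooted trees are joined by an edge shows
  that at most \<open>3^(\<psi> div 2 - 1)\<close> maximum sets avoid a given vertex.

  A lowest free vertex \<open>v\<close> of a rooted tree has only single vertices and copies of \<open>P\<^sub>2\<close> below
  it. Cut the subtree \<open>B\<close> at \<open>v\<close> off the rest \<open>R\<close>, and let \<open>h\<close> be the neighbour of \<open>v\<close> in \<open>R\<close>.
  Then \<open>\<psi>\<close> is additive and \<open>\<Phi> = \<Phi>(R) + a (\<Phi>(B) - 1) + b b'\<close>, where \<open>a\<close> counts the maximum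
  sets of \<open>R\<close> avoiding \<open>h\<close>, and \<open>b\<close>, \<open>b'\<close> those of \<open>R\<close>, \<open>B\<close> in which \<open>h\<close>, \<open>v\<close> are isolated.
  Only \<open>P\<^sub>3\<close> and \<open>P\<^sub>4\<close> have \<open>\<Phi>(B) > 1\<close>, so induction on the number of vertices, with the bound
  on \<open>a\<close> and a similar one on \<open>b\<close>, yields the estimate. Equality passes to \<open>R\<close> and determines how
  \<open>B\<close> is attached.
\<close>

section \<open>Powers of three\<close>

text \<open>Why \<open>psi\<close> is additive at the cut: since \<open>v\<close> is free in
  \<open>B\<close>, every maximum set of \<open>R\<close> extends by a maximum set of
  \<open>B\<close> that avoids \<open>v\<close>.

  The obstacle is the precision needed at a \<open>P3\<close>. From \<open>psi = 2 * m + 2\<close>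
  to \<open>psi + 2\<close> the even bound grows by \<open>2 * 3 ^ m + 1\<close>. The term
  \<open>2 * a\<close> with \<open>a <= 3 ^ m\<close> may use up all but one of this, and in the odd
  case all of it, so separate bounds on \<open>a\<close> and \<open>b\<close> are not enough. What
  is needed is a trade-off: \<open>b\<close> may be large only if \<open>a\<close> is well below its
  maximum. Hence the shape of \<open>free_bound\<close>: \<open>b = 0\<close>, or the tree is a
  \<open>P2_P3_star\<close>, where both counts are known exactly, or \<open>a\<close> falls to a
  third or two thirds of its maximum, which pays for \<open>b\<close>.

  Bounding rooted counts also requires \<open>Phi\<close> of the subtrees, which is what is being
  estimated. The circle is broken by size: smaller trees are \<open>optimal\<close>, hence
  \<open>crude\<close>, and \<open>crude\<close> suffices for joining rooted trees.\<close>

text \<open>Estimates such as \<open>x <= (2/3) * 3 ^ m\<close> are kept free of fractions as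
  \<open>3 * x <= 2 * 3 ^ m\<close>. The exponent \<open>i\<close> turns slack in the sum of
  exponents, usually gained from rounding in \<open>div 2\<close>, into extra factors 3.\<close>

lemma mult_power3_le:
  fixes x y :: nat
  assumes "c * x \<le> e * 3 ^ m" "d * y \<le> f * 3 ^ n" "m + n + i \<le> k"
  shows "c * d * 3 ^ i * (x * y) \<le> e * f * 3 ^ k"
proof -
  have "c * d * 3 ^ i * (x * y) = (c * x) * (d * y) * 3 ^ i" by (simp add: ac_simps)
  also have "\<dots> \<le> (e * 3 ^ m) * (f * 3 ^ n) * 3 ^ i"
    by (intro mult_le_mono assms order_refl)
  also have "\<dots> = e * f * 3 ^ (m + n + i)" by (simp add: power_add)
  also have "\<dots> \<le> e * f * 3 ^ k" by (intro mult_le_mono2 power_increasing assms(3)) simp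
  finally show ?thesis .
qed

lemma half_sum: "(a::nat) div 2 + w div 2 \<le> (a + w) div 2"
  by presburger

text \<open>The relation \<open>Suc u = p + w\<close> is the one satisfied by \<open>psi\<close>
  when joining two trees loses one vertex, see \<open>joined_values_deficient\<close>.\<close>

lemma half_sum_pred:
  assumes "0 < (p::nat)" "Suc u = p + w" shows "(p - 1) div 2 + w div 2 \<le> u div 2"
proof -
  have "u = (p - 1) + w" using assms by linarith
  then show ?thesis using half_sum by simp
qed

lemma half_pred_sum: "0 < (p::nat) \<Longrightarrow> (p - 1) div 2 + w div 2 \<le> (p + w - 1) div 2"
  using half_sum_pred[of p "p + w - 1" w] by simp

lemma half_sum_Suc: "Suc u = p + w \<Longrightarrow> p div 2 + w div 2 \<le> u div 2 + 1"
  by presburger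

lemma half_sum_odd: "Suc u = p + w \<Longrightarrow> \<not> (even p \<and> even w) \<Longrightarrow> p div 2 + w div 2 \<le> u div 2"
  by presburger

definition count_bound :: "nat \<Rightarrow> nat" where
  "count_bound p = (if p = 1 then 1 else if odd p then 3 ^ ((p - 1) div 2 - 1) + 1
     else 3 ^ (p div 2 - 1) + p div 2 + 1)"

lemma count_bound_1: "count_bound (Suc 0) = 1"
  and count_bound_odd: "count_bound (2 * m + 3) = 3 ^ m + 1"
  and count_bound_even: "count_bound (2 * m + 2) = 3 ^ m + m + 2"
  by (simp_all add: count_bound_def)

lemma count_bound_even_Suc [simp]: "count_bound (Suc (Suc (2 * m))) = 3 ^ m + m + 2"
  by (simp add: count_bound_def)

lemma count_bound_2 [simp]: "count_bound 2 = 3" and count_bound_3 [simp]: "count_bound 3 = 2"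
  by (simp_all add: count_bound_def)

lemma Suc_le_power3: "Suc m \<le> 3 ^ m"
  by (induction m) auto

text \<open>Equality after attaching a \<open>P4\<close> leads to this equation, see
  \<open>attach_P4_arith\<close>.\<close>

lemma power3_eq_Suc: "(3::nat) ^ m = Suc m \<Longrightarrow> m = 0"
proof (cases m)
  case (Suc k)
  assume "3 ^ m = Suc m"
  then show ?thesis using Suc_le_power3[of k] unfolding Suc power_Suc by linarith
qed

lemma count_bound_cases:
  fixes p :: nat
  assumes "0 < p"
  obtains "p = 1" | m where "p = 2 * m + 3" | m where "p = 2 * m + 2"
proof (cases "even p")
  case True
  then obtain k where "p = 2 * k" by blast
  then have "p = 2 * (k - 1) + 2" using assms by simp
  then show ?thesis using that by blast
next
  case False
  then obtain k where k: "p = 2 * k + 1" by (rule oddE)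
  show ?thesis
  proof (cases k)
    case 0 then show ?thesis using k that by simp
  next
    case (Suc m) then have "p = 2 * m + 3" using k by simp
    then show ?thesis using that by blast
  qed
qed

lemma count_bound_less_2: assumes "0 < p" shows "count_bound p < count_bound (p + 2)"
  using assms
proof (cases rule: count_bound_cases)
  case 1 then show ?thesis by (simp add: count_bound_def)
next
  case (2 m)
  then have "p + 2 = 2 * Suc m + 3" by simp
  then have "count_bound (p + 2) = 3 ^ Suc m + 1" by (simp only: count_bound_odd)
  then show ?thesis using 2 by (simp add: count_bound_odd)
next
  case (3 m)
  then have "p + 2 = 2 * Suc m + 2" by simp
  then have "count_bound (p + 2) = 3 ^ Suc m + Suc m + 2" by (simp only: count_bound_even)
  then show ?thesis using 3 by (simp add: count_bound_even)
qed

lemma count_bound_less_3: assumes "0 < p" shows "count_bound p < count_bound (p + 3)"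
  using assms
proof (cases rule: count_bound_cases)
  case 1 then show ?thesis by (simp add: count_bound_def)
next
  case (2 m)
  then have "p + 3 = 2 * (m + 2) + 2" by simp
  then have "count_bound (p + 3) = 3 ^ (m + 2) + (m + 2) + 2" by (simp only: count_bound_even)
  then show ?thesis using 2 by (simp add: count_bound_odd)
next
  case (3 m)
  then have "p + 3 = 2 * Suc m + 3" by simp
  then have "count_bound (p + 3) = 3 * 3 ^ m + 1" by (simp only: count_bound_odd power_Suc)
  then show ?thesis using 3 Suc_le_power3[of m] unfolding 3 count_bound_even by linarith
qed

text \<open>Steps of length 1 must be excluded: \<open>count_bound 2 = 3\<close> exceeds
  \<open>count_bound 3 = 2\<close>. Every longer step is composed of steps 2 and at most one step
  3.\<close>

lemma count_bound_less: assumes "0 < p" "2 \<le> k" shows "count_bound p < count_bound (p + k)"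
  using assms(2)
proof (induction k rule: less_induct)
  case (less k)
  show ?case
  proof (cases "k = 2 \<or> k = 3")
    case True then show ?thesis using count_bound_less_2 count_bound_less_3 assms(1) by auto
  next
    case False
    define i where "i = k - 2"
    have i: "k = i + 2" "2 \<le> i" using less.prems False unfolding i_def by linarith+
    have "count_bound p < count_bound (p + i)" using less.IH i by simp
    also have "\<dots> < count_bound (p + i + 2)" using count_bound_less_2[of "p + i"] assms(1) by simp
    finally show ?thesis using i by (simp add: add.assoc)
  qed
qed

section \<open>Dissociation sets of graphs joined by an edge\<close>

text \<open>The edge relation stays fixed and only vertex sets vary, so induced subgraphs are plain
  sets and cutting a tree creates no new graph.\<close>

locale sgraph =
  fixes E :: "'a rel"
  assumes sym_E: "(x, y) \<in> E \<Longrightarrow> (y, x) \<in> E"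
    and irrefl_E: "(x, x) \<notin> E"
begin

text \<open>Degree at most one is expressed as uniqueness of the neighbour inside \<open>S\<close>,
  which avoids counting arcs.\<close>

definition diss :: "'a set \<Rightarrow> bool" where
  "diss S \<longleftrightarrow> (\<forall>v\<in>S. \<forall>x\<in>S. \<forall>y\<in>S. (v, x) \<in> E \<and> (v, y) \<in> E \<longrightarrow> x = y)"

definition psi :: "'a set \<Rightarrow> nat" where
  "psi V = Max (card ` {S. S \<subseteq> V \<and> diss S})"

definition max_diss :: "'a set \<Rightarrow> 'a set set" where
  "max_diss V = {S. S \<subseteq> V \<and> diss S \<and> card S = psi V}"

definition Phi :: "'a set \<Rightarrow> nat" where
  "Phi V = card (max_diss V)"

definition alone :: "'a \<Rightarrow> 'a set \<Rightarrow> bool" where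
  "alone r S \<longleftrightarrow> r \<in> S \<and> (\<forall>x\<in>S. (r, x) \<notin> E)"

definition avoiding :: "'a set \<Rightarrow> 'a \<Rightarrow> 'a set set" where
  "avoiding V r = {S \<in> max_diss V. r \<notin> S}"

definition isolating :: "'a set \<Rightarrow> 'a \<Rightarrow> 'a set set" where
  "isolating V r = {S \<in> max_diss V. alone r S}"

definition num_avoiding :: "'a set \<Rightarrow> 'a \<Rightarrow> nat" where
  "num_avoiding V r = card (avoiding V r)"

definition num_isolating :: "'a set \<Rightarrow> 'a \<Rightarrow> nat" where
  "num_isolating V r = card (isolating V r)"

definition joined :: "'a set \<Rightarrow> 'a \<Rightarrow> 'a set \<Rightarrow> 'a \<Rightarrow> bool" where
  "joined V r W q \<longleftrightarrow> V \<inter> W = {} \<and> r \<in> V \<and> q \<in> W \<and>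
     (\<forall>x\<in>V. \<forall>y\<in>W. (x, y) \<in> E \<longleftrightarrow> x = r \<and> y = q)"

lemma joined_sym: "joined V r W q \<Longrightarrow> joined W q V r"
  unfolding joined_def using sym_E by blast

lemma diss_subset: "diss S \<Longrightarrow> T \<subseteq> S \<Longrightarrow> diss T"
  unfolding diss_def by blast

lemma diss_empty [simp]: "diss {}"
  by (simp add: diss_def)

lemma card_le_psi: "finite V \<Longrightarrow> S \<subseteq> V \<Longrightarrow> diss S \<Longrightarrow> card S \<le> psi V"
  unfolding psi_def by (rule Max_ge) auto

lemma max_diss_nonempty: assumes "finite V" shows "max_diss V \<noteq> {}"
proof -
  have "psi V \<in> card ` {S. S \<subseteq> V \<and> diss S}"
    unfolding psi_def by (rule Max_in) (use assms in \<open>auto intro: exI[of _ "{}"]\<close>)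
  then show ?thesis by (auto simp: max_diss_def)
qed

lemma max_dissD: "S \<in> max_diss V \<Longrightarrow> S \<subseteq> V" "S \<in> max_diss V \<Longrightarrow> diss S"
  "S \<in> max_diss V \<Longrightarrow> card S = psi V"
  by (auto simp: max_diss_def)

lemma finite_max_diss [simp]: "finite V \<Longrightarrow> finite (max_diss V)"
  by (rule finite_subset[of _ "Pow V"]) (auto simp: max_diss_def)

lemma finite_avoiding [simp]: "finite V \<Longrightarrow> finite (avoiding V r)"
  and finite_isolating [simp]: "finite V \<Longrightarrow> finite (isolating V r)"
  by (auto simp: avoiding_def isolating_def)

lemma Phi_pos: "finite V \<Longrightarrow> 0 < Phi V"
  using max_diss_nonempty by (simp add: Phi_def card_gt_0_iff)

lemma psi_eqI:
  assumes "finite V" "S \<subseteq> V" "diss S" "card S = n"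
    and "\<And>S. S \<subseteq> V \<Longrightarrow> diss S \<Longrightarrow> card S \<le> n"
  shows "psi V = n"
proof (rule antisym)
  obtain T where T: "T \<in> max_diss V" using max_diss_nonempty[OF assms(1)] by blast
  show "psi V \<le> n" using assms(5)[OF max_dissD(1,2)[OF T]] max_dissD(3)[OF T] by simp
  show "n \<le> psi V" using card_le_psi[OF assms(1-3)] assms(4) by simp
qed

lemma psi_mono: assumes "finite V" "W \<subseteq> V" shows "psi W \<le> psi V"
proof -
  obtain T where T: "T \<in> max_diss W"
    using max_diss_nonempty finite_subset[OF assms(2,1)] by blast
  then show ?thesis using card_le_psi[OF assms(1), of T] max_dissD[OF T] assms(2) by simp
qed

lemma card_split:
  assumes "finite (V \<union> W)" "V \<inter> W = {}" "S \<subseteq> V \<union> W"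
  shows "card S = card (S \<inter> V) + card (S \<inter> W)"
proof -
  have "S = (S \<inter> V) \<union> (S \<inter> W)" using assms(3) by blast
  moreover have "finite (S \<inter> V)" "finite (S \<inter> W)" using assms(1) by auto
  moreover have "(S \<inter> V) \<inter> (S \<inter> W) = {}" using assms(2) by blast
  ultimately show ?thesis by (metis card_Un_disjoint)
qed

section \<open>Unions of two parts without edges between them\<close>

definition glue :: "'a set set \<Rightarrow> 'a set set \<Rightarrow> 'a set set" where
  "glue X Y = (\<lambda>(a, b). a \<union> b) ` (X \<times> Y)"

lemma glue_iff:
  assumes "X \<subseteq> Pow V" "Y \<subseteq> Pow W" "V \<inter> W = {}"
  shows "S \<in> glue X Y \<longleftrightarrow> S \<subseteq> V \<union> W \<and> S \<inter> V \<in> X \<and> S \<inter> W \<in> Y"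
proof
  assume "S \<in> glue X Y"
  then obtain a b where ab: "a \<in> X" "b \<in> Y" "S = a \<union> b" by (auto simp: glue_def)
  then have "S \<inter> V = a" "S \<inter> W = b" using assms by blast+
  then show "S \<subseteq> V \<union> W \<and> S \<inter> V \<in> X \<and> S \<inter> W \<in> Y" using ab assms by blast
next
  assume a: "S \<subseteq> V \<union> W \<and> S \<inter> V \<in> X \<and> S \<inter> W \<in> Y"
  then have "S = (S \<inter> V) \<union> (S \<inter> W)" by blast
  then show "S \<in> glue X Y" using a
      by (auto simp: glue_def intro!: image_eqI[of _ _ "(S \<inter> V, S \<inter> W)"])
qed

text \<open>Gluing is injective because the traces on \<open>V\<close> and \<open>W\<close> recover
  both components.\<close>

lemma card_glue:
  assumes "X \<subseteq> Pow V" "Y \<subseteq> Pow W" "V \<inter> W = {}"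
  shows "card (glue X Y) = card X * card Y"
proof -
  have "inj_on (\<lambda>(a, b). a \<union> b) (X \<times> Y)"
  proof (rule inj_on_inverseI[of _ "\<lambda>S. (S \<inter> V, S \<inter> W)"])
    fix p assume "p \<in> X \<times> Y"
    then obtain a b where p: "p = (a, b)" "a \<in> X" "b \<in> Y" by auto
    then have "a \<subseteq> V" "b \<subseteq> W" using assms(1,2) by auto
    then have "(a \<union> b) \<inter> V = a" "(a \<union> b) \<inter> W = b" using assms(3) by auto
    then show "(\<lambda>S. (S \<inter> V, S \<inter> W)) ((\<lambda>(a, b). a \<union> b) p) = p" using p by simp
  qed
  then show ?thesis by (simp add: glue_def card_image card_cartesian_product)
qed

lemma diss_Un_unrelated:
  assumes "\<forall>x\<in>V. \<forall>y\<in>W. (x, y) \<notin> E" "V \<inter> W = {}" "S \<subseteq> V \<union> W"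
  shows "diss S \<longleftrightarrow> diss (S \<inter> V) \<and> diss (S \<inter> W)"
proof
  assume "diss S" then show "diss (S \<inter> V) \<and> diss (S \<inter> W)" by (blast intro: diss_subset)
next
  assume a: "diss (S \<inter> V) \<and> diss (S \<inter> W)"
  have "x = y" if "v \<in> S" "x \<in> S" "y \<in> S" "(v, x) \<in> E" "(v, y) \<in> E" for v x y
  proof (cases "v \<in> V")
    case True
    then have "x \<in> V" "y \<in> V" using assms that by blast+
    with True a that show ?thesis unfolding diss_def by blast
  next
    case False
    then have "v \<in> W" "x \<in> W" "y \<in> W" using assms that sym_E by blast+
    with a that show ?thesis unfolding diss_def by blast
  qed
  then show "diss S" unfolding diss_def by blast
qed

lemma psi_Phi_Un_unrelated:
  assumes "finite V" "finite W" "\<forall>x\<in>V. \<forall>y\<in>W. (x, y) \<notin> E" "V \<inter> W = {}"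
  shows "psi (V \<union> W) = psi V + psi W" "Phi (V \<union> W) = Phi V * Phi W"
    "max_diss (V \<union> W) = glue (max_diss V) (max_diss W)"
proof -
  let ?U = "V \<union> W"
  have fU: "finite ?U" using assms by simp
  have cs: "card S = card (S \<inter> V) + card (S \<inter> W)" if "S \<subseteq> ?U" for S
    using card_split[OF fU assms(4) that] .
  have sub: "max_diss V \<subseteq> Pow V" "max_diss W \<subseteq> Pow W" by (auto simp: max_diss_def)
  note gl = glue_iff[OF sub assms(4)]
  obtain S1 S2 where S: "S1 \<in> max_diss V" "S2 \<in> max_diss W"
    using max_diss_nonempty[OF assms(1)] max_diss_nonempty[OF assms(2)] by blast
  have d: "diss S \<longleftrightarrow> diss (S \<inter> V) \<and> diss (S \<inter> W)" if "S \<subseteq> ?U" for S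
    using diss_Un_unrelated[OF assms(3,4) that] .
  have m: "S1 \<union> S2 \<subseteq> ?U" "(S1 \<union> S2) \<inter> V = S1" "(S1 \<union> S2) \<inter> W = S2"
    using S assms(4) by (auto simp: max_diss_def)
  show ps: "psi ?U = psi V + psi W"
  proof (rule psi_eqI[OF fU m(1)])
    show "diss (S1 \<union> S2)" using d[OF m(1)] m(2,3) S max_dissD(2) by simp
    show "card (S1 \<union> S2) = psi V + psi W" using cs[OF m(1)] m(2,3) S max_dissD(3) by simp
    fix S assume S: "S \<subseteq> ?U" "diss S"
    then have "card (S \<inter> V) \<le> psi V" "card (S \<inter> W) \<le> psi W"
      using card_le_psi assms(1,2) d by simp_all
    then show "card S \<le> psi V + psi W" using cs[OF S(1)] by simp
  qed
  show eq: "max_diss ?U = glue (max_diss V) (max_diss W)"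
  proof (intro set_eqI)
    fix S
    have "S \<in> max_diss ?U \<longleftrightarrow> S \<subseteq> ?U \<and> S \<inter> V \<in> max_diss V \<and> S \<inter> W \<in> max_diss W" (is "?l = ?r")
    proof
      assume l: ?l
      then have s: "S \<subseteq> ?U" "diss (S \<inter> V)" "diss (S \<inter> W)" using d max_dissD(1,2)[OF l] by simp_all
      then have "card (S \<inter> V) \<le> psi V" "card (S \<inter> W) \<le> psi W"
        using card_le_psi assms(1,2) by simp_all
      moreover have "card (S \<inter> V) + card (S \<inter> W) = psi V + psi W"
        using cs[OF s(1)] ps max_dissD(3)[OF l] by simp
      ultimately show ?r using s by (simp add: max_diss_def)
    next
      assume r: ?r
      then show ?l using cs[of S] d[of S] ps by (auto simp: max_diss_def)
    qed
    then show "S \<in> max_diss ?U \<longleftrightarrow> S \<in> glue (max_diss V) (max_diss W)" using gl by simp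
  qed
  show "Phi ?U = Phi V * Phi W"
    unfolding Phi_def eq by (rule card_glue[OF sub assms(4)])
qed

section \<open>Parts joined by a single edge\<close>

text \<open>The only new edge is the one between \<open>r\<close> and \<open>q\<close>. If both ends
  are chosen, it uses up the degree allowed to each of them.\<close>

lemma diss_joined:
  assumes "joined V r W q" "S \<subseteq> V \<union> W"
  shows "diss S \<longleftrightarrow> diss (S \<inter> V) \<and> diss (S \<inter> W) \<and>
     (r \<notin> S \<or> q \<notin> S \<or> alone r (S \<inter> V) \<and> alone q (S \<inter> W))"
proof
  assume d: "diss S"
  have "alone r (S \<inter> V) \<and> alone q (S \<inter> W)" if "r \<in> S" "q \<in> S"
  proof -
    have "(r, q) \<in> E" "(q, r) \<in> E" "r \<in> V" "q \<in> W" "r \<notin> W" "q \<notin> V"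
      using assms(1) sym_E unfolding joined_def by blast+
    then show ?thesis using d that unfolding diss_def alone_def by blast
  qed
  then show "diss (S \<inter> V) \<and> diss (S \<inter> W) \<and>
     (r \<notin> S \<or> q \<notin> S \<or> alone r (S \<inter> V) \<and> alone q (S \<inter> W))"
    using d by (blast intro: diss_subset)
next
  assume a: "diss (S \<inter> V) \<and> diss (S \<inter> W) \<and>
     (r \<notin> S \<or> q \<notin> S \<or> alone r (S \<inter> V) \<and> alone q (S \<inter> W))"
  have c: "x = r \<and> y = q" if "x \<in> V" "y \<in> W" "(x, y) \<in> E" for x y
    using assms(1) that unfolding joined_def by blast
  have dis: "V \<inter> W = {}" using assms(1) unfolding joined_def by blast
  have "x = y" if vxy: "v \<in> S" "x \<in> S" "y \<in> S" "(v, x) \<in> E" "(v, y) \<in> E" for v x y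
  proof (cases "v \<in> V")
    case True
    consider "x \<in> V" "y \<in> V" | "x \<in> W" "y \<in> W" | "x \<in> W" "y \<in> V" | "x \<in> V" "y \<in> W"
      using vxy assms(2) by blast
    then show ?thesis
    proof cases
      case 1 then show ?thesis using True a vxy unfolding diss_def by blast
    next
      case 2 then show ?thesis using c True vxy by blast
    next
      case 3 then show ?thesis using c[OF True _ vxy(4)] a vxy unfolding alone_def by blast
    next
      case 4 then show ?thesis using c[OF True _ vxy(5)] a vxy unfolding alone_def by blast
    qed
  next
    case False
    then have vW: "v \<in> W" using vxy assms by blast
    note s = vxy(4,5)[THEN sym_E]
    consider "x \<in> W" "y \<in> W" | "x \<in> V" "y \<in> V" | "x \<in> W" "y \<in> V" | "x \<in> V" "y \<in> W"
      using vxy assms(2) by blast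
    then show ?thesis
    proof cases
      case 1 then show ?thesis using vW a vxy unfolding diss_def by blast
    next
      case 2 then show ?thesis using c vW s by blast
    next
      case 3 then show ?thesis using c[OF _ vW s(2)] a vxy unfolding alone_def by blast
    next
      case 4 then show ?thesis using c[OF _ vW s(1)] a vxy unfolding alone_def by blast
    qed
  qed
  then show "diss S" unfolding diss_def by blast
qed

lemma psi_remove_le: "finite V \<Longrightarrow> psi (V - {r}) \<le> psi V"
  by (rule psi_mono) auto

lemma psi_le_Suc_remove: assumes "finite V" shows "psi V \<le> Suc (psi (V - {r}))"
proof -
  obtain S where S: "S \<in> max_diss V" using max_diss_nonempty[OF assms] by blast
  have "finite S" using finite_subset[OF max_dissD(1)[OF S] assms] .
  have "card (S - {r}) \<le> psi (V - {r})"
    using assms max_dissD(1)[OF S] diss_subset[OF max_dissD(2)[OF S]] by (intro card_le_psi) auto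
  moreover have "card S \<le> Suc (card (S - {r}))"
    using \<open>finite S\<close>
        by (metis card_Suc_Diff1 Diff_insert_absorb Diff_empty le_SucI order_refl Diff_insert0)
  ultimately show ?thesis using max_dissD(3)[OF S] by simp
qed

lemma avoiding_eq:
  assumes "finite V" "psi (V - {r}) = psi V"
  shows "avoiding V r = max_diss (V - {r})"
  unfolding avoiding_def max_diss_def using assms by auto

lemma avoiding_empty:
  assumes "finite V" "psi (V - {r}) \<noteq> psi V"
  shows "avoiding V r = {}"
proof (rule ccontr)
  assume "avoiding V r \<noteq> {}"
  then obtain S where S: "S \<in> max_diss V" "r \<notin> S" by (auto simp: avoiding_def)
  then have "card S \<le> psi (V - {r})"
    using assms(1) max_dissD[OF S(1)] by (intro card_le_psi) auto
  then show False using psi_remove_le[OF assms(1), of r] assms(2) max_dissD(3)[OF S(1)] by simp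
qed

text \<open>A vertex is free exactly if deleting it preserves \<open>psi\<close>. For joined trees
  this is the way to compute \<open>num_avoiding\<close>, since deleting the root also deletes the
  joining edge.\<close>

lemma num_avoiding_eq:
  "finite V \<Longrightarrow> num_avoiding V r = (if psi (V - {r}) = psi V then Phi (V - {r}) else 0)"
  by (simp add: num_avoiding_def avoiding_eq avoiding_empty Phi_def)

lemma psi_remove_cases:
  assumes "finite V"
  obtains "psi (V - {r}) = psi V" "num_avoiding V r = Phi (V - {r})" "0 < num_avoiding V r"
  | "psi V = Suc (psi (V - {r}))" "num_avoiding V r = 0"
proof (cases "psi (V - {r}) = psi V")
  case True
  then show ?thesis using that(1) num_avoiding_eq[OF assms, of r] Phi_pos[of "V - {r}"] assms
      by simp
next
  case False
  then have "psi V = Suc (psi (V - {r}))"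
    using psi_remove_le[OF assms, of r] psi_le_Suc_remove[OF assms, of r] by simp
  then show ?thesis using that(2) num_avoiding_eq[OF assms, of r] by simp
qed

lemma num_avoiding_isolating_le:
  assumes "finite V" shows "num_avoiding V r + num_isolating V r \<le> Phi V"
proof -
  have "avoiding V r \<inter> isolating V r = {}"
    by (auto simp: avoiding_def isolating_def alone_def)
  then have "num_avoiding V r + num_isolating V r = card (avoiding V r \<union> isolating V r)"
    using assms by (simp add: num_avoiding_def num_isolating_def card_Un_disjoint)
  also have "\<dots> \<le> Phi V" unfolding Phi_def
    by (rule card_mono) (use assms in \<open>auto simp: avoiding_def isolating_def\<close>)
  finally show ?thesis .
qed

lemma joined_remove:
  assumes "joined V r W q" "finite V" "finite W"
  shows "psi ((V \<union> W) - {r}) = psi (V - {r}) + psi W"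
    "Phi ((V \<union> W) - {r}) = Phi (V - {r}) * Phi W"
proof -
  have eq: "(V \<union> W) - {r} = (V - {r}) \<union> W" using assms(1) unfolding joined_def by blast
  have "\<forall>x\<in>V - {r}. \<forall>y\<in>W. (x, y) \<notin> E" "(V - {r}) \<inter> W = {}"
    using assms(1) unfolding joined_def by blast+
  then show "psi ((V \<union> W) - {r}) = psi (V - {r}) + psi W"
    "Phi ((V \<union> W) - {r}) = Phi (V - {r}) * Phi W"
    using psi_Phi_Un_unrelated[of "V - {r}" W] assms(2,3) unfolding eq by auto
qed

lemma joined_psi_le:
  assumes "joined V r W q" "finite V" "finite W" "S \<subseteq> V \<union> W" "diss S"
  shows "card S = card (S \<inter> V) + card (S \<inter> W)" "card (S \<inter> V) \<le> psi V" "card (S \<inter> W) \<le> psi W"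
proof -
  have "V \<inter> W = {}" using assms(1) unfolding joined_def by blast
  then show "card S = card (S \<inter> V) + card (S \<inter> W)" using card_split[of V W S] assms by simp
  show "card (S \<inter> V) \<le> psi V" "card (S \<inter> W) \<le> psi W"
    using diss_joined[OF assms(1,4)] assms by (auto intro!: card_le_psi)
qed

lemma joined_alone:
  assumes "joined V r W q" "S \<subseteq> V \<union> W"
  shows "alone r S \<longleftrightarrow> alone r (S \<inter> V) \<and> q \<notin> S"
proof -
  have rq: "r \<in> V" "q \<in> W" and e: "(r, y) \<in> E \<longleftrightarrow> y = q" if "y \<in> W" for y
    using assms(1) that by (auto simp: joined_def)
  have "q \<in> W" using assms(1) by (auto simp: joined_def)
  then show ?thesis using rq e assms(2) by (auto simp: alone_def)
qed

definition compat :: "'a \<Rightarrow> 'a \<Rightarrow> 'a set \<Rightarrow> 'a set \<Rightarrow> bool" where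
  "compat r q S T \<longleftrightarrow> r \<notin> S \<or> q \<notin> T \<or> alone r S \<and> alone q T"

text \<open>One compatible pair of maximum sets makes \<open>psi\<close> additive. After that, a
  maximum set of the union can only have traces of maximum size on both sides.\<close>

lemma max_diss_joined:
  assumes j: "joined V r W q" and fin: "finite V" "finite W"
    and ex: "S1 \<in> max_diss V" "S2 \<in> max_diss W" "compat r q S1 S2"
  shows "psi (V \<union> W) = psi V + psi W"
    "max_diss (V \<union> W) = {S. S \<subseteq> V \<union> W \<and> S \<inter> V \<in> max_diss V \<and> S \<inter> W \<in> max_diss W \<and>
        compat r q (S \<inter> V) (S \<inter> W)}"
proof -
  let ?U = "V \<union> W"
  have fU: "finite ?U" and dis: "V \<inter> W = {}" and rq: "r \<in> V" "q \<in> W"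
    using fin j by (auto simp: joined_def)
  have m: "S1 \<union> S2 \<subseteq> ?U" "(S1 \<union> S2) \<inter> V = S1" "(S1 \<union> S2) \<inter> W = S2"
    using max_dissD(1)[OF ex(1)] max_dissD(1)[OF ex(2)] dis by auto
  have d: "diss S \<longleftrightarrow> diss (S \<inter> V) \<and> diss (S \<inter> W) \<and> compat r q (S \<inter> V) (S \<inter> W)"
    if "S \<subseteq> ?U" for S
    using diss_joined[OF j that] rq by (auto simp: compat_def)
  have ds: "diss (S1 \<union> S2)" using d[OF m(1)] m ex max_dissD(2) by simp
  show ps: "psi ?U = psi V + psi W"
  proof (rule psi_eqI[OF fU m(1) ds])
    show "card (S1 \<union> S2) = psi V + psi W"
      using joined_psi_le(1)[OF j fin m(1) ds] m(2,3) max_dissD(3)[OF ex(1)] max_dissD(3)[OF ex(2)]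
      by simp
    show "card S \<le> psi V + psi W" if "S \<subseteq> ?U" "diss S" for S
      using joined_psi_le[OF j fin that] by simp
  qed
  show "max_diss ?U = {S. S \<subseteq> ?U \<and> S \<inter> V \<in> max_diss V \<and> S \<inter> W \<in> max_diss W \<and>
        compat r q (S \<inter> V) (S \<inter> W)}"
  proof (intro set_eqI iffI)
    fix S assume S: "S \<in> max_diss ?U"
    note S' = max_dissD[OF S]
    note c = joined_psi_le[OF j fin S'(1,2)]
    have "card (S \<inter> V) = psi V" "card (S \<inter> W) = psi W" using c S'(3) ps by simp_all
    then show "S \<in> {S. S \<subseteq> ?U \<and> S \<inter> V \<in> max_diss V \<and> S \<inter> W \<in> max_diss W \<and>
        compat r q (S \<inter> V) (S \<inter> W)}"
      using d[OF S'(1)] S' by (simp add: max_diss_def)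
  next
    fix S assume S: "S \<in> {S. S \<subseteq> ?U \<and> S \<inter> V \<in> max_diss V \<and> S \<inter> W \<in> max_diss W \<and>
        compat r q (S \<inter> V) (S \<inter> W)}"
    then have "S \<subseteq> ?U" by simp
    moreover have "diss S" using d[OF \<open>S \<subseteq> ?U\<close>] S by (auto dest: max_dissD(2))
    moreover have "card S = psi ?U"
      using joined_psi_le(1)[OF j fin \<open>S \<subseteq> ?U\<close> \<open>diss S\<close>] S ps
        max_dissD(3)[of "S \<inter> V" V] max_dissD(3)[of "S \<inter> W" W] by simp
    ultimately show "S \<in> max_diss ?U" by (simp add: max_diss_def)
  qed
qed

lemma avoiding_sub: "avoiding V r \<subseteq> Pow V"
  and isolating_sub: "isolating V r \<subseteq> Pow V"
  and max_diss_sub: "max_diss V \<subseteq> Pow V"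
  by (auto simp: avoiding_def isolating_def max_diss_def)

text \<open>The assumption \<open>ex\<close> is what provides a compatible pair. For
  \<open>r\<close> to be isolated in the union, \<open>q\<close> must be absent, which explains the
  last product.\<close>

lemma joined_values:
  assumes j: "joined V r W q" and fin: "finite V" "finite W"
    and ex: "0 < num_avoiding V r \<or> 0 < num_avoiding W q \<or> 0 < num_isolating V r \<and>
        0 < num_isolating W q"
  shows "psi (V \<union> W) = psi V + psi W"
    "Phi (V \<union> W) = num_avoiding V r * Phi W + (Phi V - num_avoiding V r) * num_avoiding W q +
        num_isolating V r * num_isolating W q"
    "num_isolating (V \<union> W) r = num_isolating V r * num_avoiding W q"
proof -
  let ?U = "V \<union> W"
  have dis: "V \<inter> W = {}" and rq: "r \<in> V" "q \<in> W" "r \<notin> W" "q \<notin> V"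
    using j by (auto simp: joined_def)
  have "\<exists>S1 S2. S1 \<in> max_diss V \<and> S2 \<in> max_diss W \<and> compat r q S1 S2"
  proof -
    obtain T1 T2 where T: "T1 \<in> max_diss V" "T2 \<in> max_diss W"
      using max_diss_nonempty[OF fin(1)] max_diss_nonempty[OF fin(2)] by blast
    consider S where "S \<in> avoiding V r" | S where "S \<in> avoiding W q"
      | S S' where "S \<in> isolating V r" "S' \<in> isolating W q"
      using ex unfolding num_avoiding_def num_isolating_def card_gt_0_iff by blast
    then show ?thesis
    proof cases
      case 1
      then have "compat r q S T2" "S \<in> max_diss V" by (auto simp: compat_def avoiding_def)
      then show ?thesis using T by blast
    next
      case 2
      then have "compat r q T1 S" "S \<in> max_diss W" by (auto simp: compat_def avoiding_def)
      then show ?thesis using T by blast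
    next
      case 3
      then have "compat r q S S'" "S \<in> max_diss V" "S' \<in> max_diss W"
        by (auto simp: compat_def isolating_def)
      then show ?thesis by blast
    qed
  qed
  then obtain S1 S2 where s: "S1 \<in> max_diss V" "S2 \<in> max_diss W" "compat r q S1 S2" by blast
  note mx = max_diss_joined[OF j fin s]
  show "psi ?U = psi V + psi W" by (fact mx(1))
  \<comment> \<open>The maximum sets are sorted by the ends of the joining edge: \<open>?X\<close>
    omits \<open>r\<close>, \<open>?Y\<close> contains \<open>r\<close> but not \<open>q\<close>,
    and \<open>?Z\<close> contains both, each isolated on its own side.\<close>
  let ?X = "glue (avoiding V r) (max_diss W)"
  let ?Y = "glue (max_diss V - avoiding V r) (avoiding W q)"
  let ?Z = "glue (isolating V r) (isolating W q)"
  have sub: "max_diss V - avoiding V r \<subseteq> Pow V" using max_diss_sub by auto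
  have X: "S \<in> ?X \<longleftrightarrow> S \<subseteq> ?U \<and> S \<inter> V \<in> avoiding V r \<and> S \<inter> W \<in> max_diss W"
    and Y: "S \<in> ?Y \<longleftrightarrow> S \<subseteq> ?U \<and> S \<inter> V \<in> max_diss V - avoiding V r \<and> S \<inter> W \<in> avoiding W q"
    and Z: "S \<in> ?Z \<longleftrightarrow> S \<subseteq> ?U \<and> S \<inter> V \<in> isolating V r \<and> S \<inter> W \<in> isolating W q" for S
    using glue_iff[OF avoiding_sub max_diss_sub dis] glue_iff[OF sub avoiding_sub dis]
      glue_iff[OF isolating_sub isolating_sub dis] by auto
  have cX: "card ?X = num_avoiding V r * Phi W"
      and cZ: "card ?Z = num_isolating V r * num_isolating W q"
    using card_glue[OF avoiding_sub max_diss_sub dis] card_glue[OF isolating_sub isolating_sub dis]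
    by (simp_all add: num_avoiding_def num_isolating_def Phi_def)
  have "card (max_diss V - avoiding V r) = Phi V - num_avoiding V r"
    unfolding Phi_def num_avoiding_def using fin
        by (intro card_Diff_subset) (auto simp: avoiding_def)
  then have cY: "card ?Y = (Phi V - num_avoiding V r) * num_avoiding W q"
    using card_glue[OF sub avoiding_sub dis] by (simp add: num_avoiding_def)
  have "max_diss ?U = (?X \<union> ?Y) \<union> ?Z"
    unfolding mx(2) set_eq_iff Un_iff X Y Z
    using rq by (auto simp: avoiding_def isolating_def compat_def alone_def)
  moreover have "?X \<inter> ?Y = {}" "(?X \<union> ?Y) \<inter> ?Z = {}"
    unfolding disjoint_iff Un_iff X Y Z using rq
        by (auto simp: avoiding_def isolating_def alone_def)
  moreover have "finite ?X" "finite ?Y" "finite ?Z"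
    using fin by (auto simp: glue_def)
  ultimately show "Phi ?U = num_avoiding V r * Phi W +
      (Phi V - num_avoiding V r) * num_avoiding W q + num_isolating V r * num_isolating W q"
    using cX cY cZ unfolding Phi_def by (simp add: card_Un_disjoint)
  have al: "alone r S \<longleftrightarrow> alone r (S \<inter> V) \<and> q \<notin> S" if "S \<subseteq> ?U" for S
    using joined_alone[OF j that] .
  have "isolating ?U r = glue (isolating V r) (avoiding W q)"
  proof (rule set_eqI)
    fix S
    show "S \<in> isolating ?U r \<longleftrightarrow> S \<in> glue (isolating V r) (avoiding W q)"
      unfolding glue_iff[OF isolating_sub avoiding_sub dis]
      unfolding isolating_def mx(2) using al[of S] rq
      by (auto simp: avoiding_def compat_def)
  qed
  then show "num_isolating ?U r = num_isolating V r * num_avoiding W q"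
    using card_glue[OF isolating_sub avoiding_sub dis]
        by (simp add: num_avoiding_def num_isolating_def)
qed

text \<open>Both roots are forced, and at least one is never isolated, so no pair of maximum sets is
  compatible and exactly one vertex is lost. If \<open>r\<close> is isolated in a maximum set of the
  union, the loss is at \<open>q\<close>, and the trace on \<open>W\<close> is any maximum set of
  \<open>W - {q}\<close>.\<close>

lemma joined_values_deficient:
  assumes j: "joined V r W q" and fin: "finite V" "finite W"
    and F: "num_avoiding V r = 0" "num_avoiding W q = 0"
        and ex: "num_isolating V r = 0 \<or> num_isolating W q = 0"
  shows "Suc (psi (V \<union> W)) = psi V + psi W"
    "num_isolating (V \<union> W) r = num_isolating V r * Phi (W - {q})"
proof -
  let ?U = "V \<union> W"
  have fU: "finite ?U" and dis: "V \<inter> W = {}" and rq: "r \<in> V" "q \<in> W" "r \<notin> W" "q \<notin> V"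
    using j fin by (auto simp: joined_def)
  have pV: "psi V = Suc (psi (V - {r}))" and pW: "psi W = Suc (psi (W - {q}))"
    by (rule psi_remove_cases[OF fin(1), of r]; use F in simp)
       (rule psi_remove_cases[OF fin(2), of q]; use F in simp)
  have in_r: "r \<in> S" if "S \<in> max_diss V" for S
    using F(1) fin that by (auto simp: num_avoiding_def avoiding_def card_eq_0_iff)
  have in_q: "q \<in> S" if "S \<in> max_diss W" for S
    using F(2) fin that by (auto simp: num_avoiding_def avoiding_def card_eq_0_iff)
  have iso: "isolating V r = {} \<or> isolating W q = {}"
    using ex fin by (auto simp: num_isolating_def)
  have lt: "card S < psi V + psi W" if S: "S \<subseteq> ?U" "diss S" for S
  proof (rule ccontr)
    assume n: "\<not> card S < psi V + psi W"
    note c = joined_psi_le[OF j fin S]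
    have "card (S \<inter> V) = psi V" "card (S \<inter> W) = psi W" using c n by simp_all
    then have m: "S \<inter> V \<in> max_diss V" "S \<inter> W \<in> max_diss W"
      using diss_joined[OF j S(1)] S by (auto simp: max_diss_def)
    then have "r \<in> S" "q \<in> S" using in_r in_q by blast+
    then have "S \<inter> V \<in> isolating V r" "S \<inter> W \<in> isolating W q"
      using diss_joined[OF j S(1)] S m by (auto simp: isolating_def)
    then show False using iso by blast
  qed
  show ps: "Suc (psi ?U) = psi V + psi W"
  proof (rule antisym)
    obtain S where "S \<in> max_diss ?U" using max_diss_nonempty[OF fU] by blast
    then show "Suc (psi ?U) \<le> psi V + psi W" using lt[of S] max_dissD[of S] by simp
    \<comment> \<open>Omitting \<open>r\<close> costs one vertex on the side of \<open>V\<close> and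
      nothing on the side of \<open>W\<close>.\<close>
    show "psi V + psi W \<le> Suc (psi ?U)"
      using joined_remove(1)[OF j fin] psi_remove_le[OF fU, of r] pV by simp
  qed
  have al: "alone r S \<longleftrightarrow> alone r (S \<inter> V) \<and> q \<notin> S" if "S \<subseteq> ?U" for S
    using joined_alone[OF j that] .
  have subq: "max_diss (W - {q}) \<subseteq> Pow W" using max_diss_sub by auto
  have "S \<in> isolating ?U r \<longleftrightarrow> S \<subseteq> ?U \<and> S \<inter> V \<in> isolating V r \<and> S \<inter> W \<in> max_diss (W - {q})"
    (is "?l \<longleftrightarrow> ?r") for S
  proof
    assume ?l
    then have S: "S \<subseteq> ?U" "diss S" "card S = psi ?U" "alone r S"
      by (auto simp: isolating_def max_diss_def)
    note c = joined_psi_le[OF j fin S(1,2)]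
    have q: "alone r (S \<inter> V)" "q \<notin> S" using al S by auto
    have d: "diss (S \<inter> V)" "diss (S \<inter> W)" using diss_joined[OF j S(1)] S by auto
    have "card (S \<inter> W) \<le> psi (W - {q})"
      using fin d q by (intro card_le_psi) auto
    then have "card (S \<inter> V) = psi V" "card (S \<inter> W) = psi (W - {q})"
      using c S(3) ps pW by simp_all
    then show ?r using S d q by (auto simp: isolating_def max_diss_def)
  next
    assume r: ?r
    then have S: "S \<subseteq> ?U" by simp
    have q: "q \<notin> S" using r rq by (auto simp: max_diss_def)
    have c: "card (S \<inter> V) = psi V" "card (S \<inter> W) = psi (W - {q})" "diss (S \<inter> V)" "diss (S \<inter> W)"
      "alone r (S \<inter> V)"
      using r by (auto simp: isolating_def max_diss_def)
    then have "diss S" using diss_joined[OF j S] q by simp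
    then show ?l using c S q al[OF S] joined_psi_le(1)[OF j fin S] ps pW
      by (simp add: isolating_def max_diss_def)
  qed
  then have "isolating ?U r = glue (isolating V r) (max_diss (W - {q}))"
    using glue_iff[OF isolating_sub subq dis] by blast
  then show "num_isolating ?U r = num_isolating V r * Phi (W - {q})"
    using card_glue[OF isolating_sub subq dis] by (simp add: num_isolating_def Phi_def)
qed

section \<open>Trees\<close>

text \<open>The ends of the joining edge are arbitrary and no root is recorded, so that the same
  tree can be rooted anywhere and cut at different edges.\<close>

inductive utree :: "'a set \<Rightarrow> bool" where
  single: "utree {r}"
| join: "utree V \<Longrightarrow> utree W \<Longrightarrow> joined V r W q \<Longrightarrow> utree (V \<union> W)"

lemma utree_finite: "utree V \<Longrightarrow> finite V"
  by (induction rule: utree.induct) auto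

lemma utree_nonempty: "utree V \<Longrightarrow> V \<noteq> {}"
  by (induction rule: utree.induct) auto

lemma E_commute: "(x, y) \<in> E \<longleftrightarrow> (y, x) \<in> E"
  using sym_E by blast

text \<open>Exchange of two joins: \<open>W\<close>, hung on the union at a vertex of
  \<open>V1\<close>, can be hung on \<open>V1\<close> before \<open>V2\<close> is added.\<close>

lemma joined_Un_left:
  assumes "joined V1 r V2 s" "joined (V1 \<union> V2) x W y" "x \<in> V1"
  shows "joined V1 x W y" "joined (V1 \<union> W) r V2 s"
proof -
  show "joined V1 x W y" using assms(2,3) by (auto simp: joined_def)
  have "(v, w) \<notin> E" if "v \<in> V2" "w \<in> W" for v w
    using assms that by (auto simp: joined_def)
  then have "(w, v) \<notin> E" if "v \<in> V2" "w \<in> W" for v w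
    using E_commute that by blast
  then show "joined (V1 \<union> W) r V2 s" using assms by (auto simp: joined_def)
qed

lemma joined_Un_right:
  assumes "joined V1 r V2 s" "joined (V1 \<union> V2) x W y" "x \<in> V2"
  shows "joined V2 x W y" "joined V1 r (V2 \<union> W) s"
proof -
  show "joined V2 x W y" using assms(2,3) by (auto simp: joined_def)
  show "joined V1 r (V2 \<union> W) s" using assms by (auto simp: joined_def)
qed

text \<open>The last join in the derivation may lie away from \<open>r\<close>. The side containing
  \<open>r\<close> is then split at \<open>r\<close> by induction, and the other side moves to
  whichever half contains its attachment vertex.\<close>

lemma utree_split_at:
  assumes "utree V" "r \<in> V" "V \<noteq> {r}"
  obtains V1 V2 s where "V = V1 \<union> V2" "joined V1 r V2 s" "utree V1" "utree V2"
proof -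
  have "V \<noteq> {r} \<longrightarrow> (\<exists>V1 V2 s. V = V1 \<union> V2 \<and> joined V1 r V2 s \<and> utree V1 \<and> utree V2)"
    using assms(1,2)
  proof (induction arbitrary: r rule: utree.induct)
    case (single r) then show ?case by simp
  next
    case (join V W x y)
    have key: "\<exists>V1 V2 s. V \<union> W = V1 \<union> V2 \<and> joined V1 r V2 s \<and> utree V1 \<and> utree V2"
      if j: "joined V x W y" and t: "utree V" "utree W" and rV: "r \<in> V"
        and IH: "V \<noteq> {r} \<longrightarrow> (\<exists>V1 V2 s. V = V1 \<union> V2 \<and> joined V1 r V2 s \<and> utree V1 \<and> utree V2)"
      for V W x y
    proof (cases "V = {r}")
      case True
      then have "joined V r W y" using j unfolding joined_def by auto
      then show ?thesis using t by blast
    next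
      case False
      then obtain V1 V2 s where V: "V = V1 \<union> V2" "joined V1 r V2 s" "utree V1" "utree V2"
        using IH by blast
      have "x \<in> V1 \<or> x \<in> V2" using j V(1) unfolding joined_def by blast
      then show ?thesis
      proof
        assume x: "x \<in> V1"
        note k = joined_Un_left[OF V(2) j[unfolded V(1)] x]
        have "V \<union> W = (V1 \<union> W) \<union> V2" using V(1) by blast
        then show ?thesis using k utree.join[OF V(3) t(2) k(1)] V(4) by blast
      next
        assume x: "x \<in> V2"
        note k = joined_Un_right[OF V(2) j[unfolded V(1)] x]
        have "V \<union> W = V1 \<union> (V2 \<union> W)" using V(1) by blast
        then show ?thesis using k utree.join[OF V(4) t(2) k(1)] V(3) by blast
      qed
    qed
    show ?case
    proof (cases "r \<in> V")
      case True
      show ?thesis by (intro impI key[OF join.hyps(3) join.hyps(1,2) True join.IH(1)[OF True]])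
    next
      case False
      then have r: "r \<in> W" using join.prems by simp
      show ?thesis unfolding Un_commute[of V W]
        by (intro impI key[OF joined_sym[OF join.hyps(3)] join.hyps(2,1) r join.IH(2)[OF r]])
    qed
  qed
  then show ?thesis using assms(3) that by blast
qed

section \<open>Small trees and lowest free vertices\<close>

definition P2_at :: "'a set \<Rightarrow> 'a \<Rightarrow> bool" where
  "P2_at V r \<longleftrightarrow> (\<exists>q. (r, q) \<in> E \<and> V = {r, q})"

definition path3 :: "'a \<Rightarrow> 'a \<Rightarrow> 'a \<Rightarrow> bool" where
  "path3 x y z \<longleftrightarrow> x \<noteq> z \<and> (x, y) \<in> E \<and> (y, z) \<in> E \<and> (x, z) \<notin> E"

text \<open>The position of the root in a \<open>P3\<close> matters: every vertex has one avoiding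
  set, but an end is isolated in one maximum set and the middle in none. This is why the second
  family insists on leaves.\<close>

definition P3_end :: "'a set \<Rightarrow> 'a \<Rightarrow> bool" where
  "P3_end V r \<longleftrightarrow> (\<exists>y z. path3 r y z \<and> V = {r, y, z})"

definition P3_mid :: "'a set \<Rightarrow> 'a \<Rightarrow> bool" where
  "P3_mid V r \<longleftrightarrow> (\<exists>x z. path3 x r z \<and> V = {x, r, z})"

definition P3 :: "'a set \<Rightarrow> bool" where
  "P3 V \<longleftrightarrow> (\<exists>r. P3_end V r)"

lemma E_neq: "(x, y) \<in> E \<Longrightarrow> x \<noteq> y"
  using irrefl_E by blast

lemma path3D:
  assumes "path3 x y z"
  shows "x \<noteq> y" "y \<noteq> z" "x \<noteq> z" "(x, y) \<in> E" "(y, x) \<in> E" "(y, z) \<in> E" "(z, y) \<in> E"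
    "(x, z) \<notin> E" "(z, x) \<notin> E"
  using assms E_neq unfolding path3_def by (auto simp: E_commute)

lemma path3_rev: "path3 x y z \<Longrightarrow> path3 z y x"
  by (frule path3D(6), frule path3D(4)) (auto simp: path3_def E_commute)

lemma P3_cases: "P3 V \<Longrightarrow> q \<in> V \<Longrightarrow> P3_end V q \<or> P3_mid V q"
proof -
  assume "P3 V" "q \<in> V"
  then obtain x y z where *: "path3 x y z" "V = {x, y, z}" by (auto simp: P3_def P3_end_def)
  then consider "q = x" | "q = y" | "q = z" using \<open>q \<in> V\<close> by blast
  then show ?thesis
  proof cases
    case 1 then show ?thesis using * unfolding P3_end_def by blast
  next
    case 2 then show ?thesis using * unfolding P3_mid_def by blast
  next
    case 3
    have "V = {z, y, x}" using * by blast
    then show ?thesis using 3 path3_rev[OF *(1)] unfolding P3_end_def by blast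
  qed
qed

lemma P3_endD: "P3_end V r \<Longrightarrow> P3 V" "P3_end V r \<Longrightarrow> r \<in> V"
  by (auto simp: P3_def P3_end_def)

lemma P3_midD: "P3_mid V r \<Longrightarrow> P3 V" "P3_mid V r \<Longrightarrow> r \<in> V"
proof -
  show "P3_mid V r \<Longrightarrow> P3 V" by (auto simp: P3_def P3_end_def P3_mid_def)
  show "P3_mid V r \<Longrightarrow> r \<in> V" by (auto simp: P3_mid_def)
qed

lemma psi_Phi_empty [simp]: "psi {} = 0" "Phi {} = 1"
proof -
  show "psi {} = 0" by (rule psi_eqI[of _ "{}"]) auto
  then have "max_diss {} = {{}}" by (auto simp: max_diss_def)
  then show "Phi {} = 1" by (simp add: Phi_def)
qed

lemma single_values: "psi {r} = 1" "Phi {r} = 1" "num_avoiding {r} r = 0" "num_isolating {r} r = 1"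
proof -
  have d: "diss {r}" using irrefl_E by (auto simp: diss_def)
  show p: "psi {r} = 1"
    by (rule psi_eqI[of _ "{r}"]) (use d in \<open>auto dest: subset_singletonD\<close>)
  have m: "max_diss {r} = {{r}}"
    using d p by (auto simp: max_diss_def dest: subset_singletonD)
  show "Phi {r} = 1" by (simp add: Phi_def m)
  have "avoiding {r} r = {}" "isolating {r} r = {{r}}"
    using m irrefl_E by (auto simp: avoiding_def isolating_def alone_def)
  then show "num_avoiding {r} r = 0" "num_isolating {r} r = 1"
      by (simp_all add: num_avoiding_def num_isolating_def)
qed

lemma joined_single: "(r, q) \<in> E \<Longrightarrow> joined {r} r {q} q"
  using E_neq by (auto simp: joined_def)

lemma P2_values:
  assumes "P2_at V r"
  shows "psi V = 2" "Phi V = 1" "num_avoiding V r = 0" "num_isolating V r = 0" "Phi (V - {r}) = 1"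
      "finite V" "r \<in> V"
proof -
  obtain q where q: "(r, q) \<in> E" "V = {r} \<union> {q}" using assms by (auto simp: P2_at_def)
  note j = joined_single[OF q(1)]
  note v = joined_values[OF j, folded q(2)]
  show p: "psi V = 2" "Phi V = 1" "num_isolating V r = 0" using v by (simp_all add: single_values)
  have rq: "r \<noteq> q" using E_neq q by blast
  have "V - {r} = {q}" using q rq by auto
  then have s: "psi (V - {r}) = 1" "Phi (V - {r}) = 1" by (simp_all add: single_values)
  then show "Phi (V - {r}) = 1" by simp
  show "finite V" "r \<in> V" using q by auto
  then show "num_avoiding V r = 0" using num_avoiding_eq[of V r] s p by simp
qed

lemma path3_max_diss:
  assumes p: "path3 x y z"
  shows "psi {x, y, z} = 2" "max_diss {x, y, z} = {{x, y}, {y, z}, {x, z}}"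
proof -
  note d = path3D[OF p]
  have d1: "diss {x, y}" "diss {y, z}" "diss {x, z}" and nd: "\<not> diss {x, y, z}"
    using d irrefl_E by (auto simp: diss_def)
  have sub3: "S = {x, y, z}" if "S \<subseteq> {x, y, z}" "3 \<le> card S" for S
    using card_seteq[of "{x, y, z}" S] that d by simp
  show ps: "psi {x, y, z} = 2"
  proof (rule psi_eqI[of _ "{x, y}"])
    show "card S \<le> 2" if "S \<subseteq> {x, y, z}" "diss S" for S
      using sub3[OF that(1)] that nd by (cases "3 \<le> card S") auto
  qed (use d d1 in auto)
  show "max_diss {x, y, z} = {{x, y}, {y, z}, {x, z}}"
  proof (intro set_eqI iffI)
    fix S assume S: "S \<in> max_diss {x, y, z}"
    then have c: "S \<subseteq> {x, y, z}" "card S = 2" using ps by (auto simp: max_diss_def)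
    then obtain a b where "S = {a, b}" "a \<noteq> b" by (auto simp: card_2_iff)
    then show "S \<in> {{x, y}, {y, z}, {x, z}}" using c by auto
  next
    fix S assume S: "S \<in> {{x, y}, {y, z}, {x, z}}"
    then show "S \<in> max_diss {x, y, z}" using ps d1 d by (auto simp: max_diss_def)
  qed
qed

lemma path3_values:
  assumes p: "path3 x y z" and V: "V = {x, y, z}"
  shows "psi V = 2" "Phi V = 3" "num_avoiding V x = 1" "num_isolating V x = 1"
      "num_avoiding V y = 1" "num_isolating V y = 0"
proof -
  note d = path3D[OF p] and m = path3_max_diss[OF p, folded V]
  show "psi V = 2" by (fact m(1))
  show "Phi V = 3" unfolding Phi_def m(2) using d by (auto simp: doubleton_eq_iff)
  have "avoiding V x = {{y, z}}" "isolating V x = {{x, z}}"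
    "avoiding V y = {{x, z}}" "isolating V y = {}"
    unfolding avoiding_def isolating_def m(2) alone_def using d irrefl_E by auto
  then show "num_avoiding V x = 1" "num_isolating V x = 1" "num_avoiding V y = 1"
      "num_isolating V y = 0"
    by (simp_all add: num_avoiding_def num_isolating_def)
qed

lemma P3_end_values:
  assumes "P3_end V r"
  shows "psi V = 2" "Phi V = 3" "num_avoiding V r = 1" "num_isolating V r = 1"
proof -
  obtain y z where "path3 r y z" "V = {r, y, z}" using assms unfolding P3_end_def by blast
  from path3_values[OF this]
  show "psi V = 2" "Phi V = 3" "num_avoiding V r = 1" "num_isolating V r = 1" by blast+
qed

lemma P3_mid_values:
  assumes "P3_mid V r"
  shows "psi V = 2" "Phi V = 3" "num_avoiding V r = 1" "num_isolating V r = 0"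
proof -
  obtain x z where "path3 x r z" "V = {x, r, z}" using assms unfolding P3_mid_def by blast
  from path3_values[OF this]
  show "psi V = 2" "Phi V = 3" "num_avoiding V r = 1" "num_isolating V r = 0" by blast+
qed

lemma P3_values:
  assumes "P3 V" shows "psi V = 2" "Phi V = 3" "finite V" "r \<in> V \<Longrightarrow> num_avoiding V r = 1"
      "r \<in> V \<Longrightarrow> num_isolating V r \<le> 1"
proof -
  obtain s where s: "P3_end V s" using assms by (auto simp: P3_def)
  show "psi V = 2" "Phi V = 3" using P3_end_values[OF s] by simp_all
  show "finite V" using s by (auto simp: P3_end_def)
  show "num_avoiding V r = 1" "num_isolating V r \<le> 1" if "r \<in> V"
    using P3_cases[OF assms that] P3_end_values[of V r] P3_mid_values[of V r] by auto
qed

lemma P3_end_joined: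
  assumes "joined {r} r W q" "P2_at W q" shows "P3_end (insert r W) r"
proof -
  obtain s where s: "(q, s) \<in> E" "W = {q, s}" using assms(2) by (auto simp: P2_at_def)
  then have "path3 r q s" using assms(1) E_neq[OF s(1)] by (auto simp: joined_def path3_def)
  then show ?thesis using s unfolding P3_end_def by blast
qed

lemma P3_mid_joined:
  assumes "P2_at V r" "joined V r {s} s" shows "P3_mid (insert s V) r"
proof -
  obtain q where q: "(r, q) \<in> E" "V = {r, q}" using assms(1) by (auto simp: P2_at_def)
  have e: "(r, s) \<in> E" "s \<noteq> q" "(q, s) \<notin> E"
    using assms(2) q E_neq[OF q(1)] by (auto simp: joined_def)
  then have "path3 q r s" using q by (simp add: path3_def E_commute)
  moreover have "insert s V = {q, r, s}" using q by blast
  ultimately show ?thesis unfolding P3_mid_def by blast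
qed

lemma P3_endE:
  assumes "P3_end V r"
  obtains W q where "joined {r} r W q" "P2_at W q" "V = {r} \<union> W"
proof -
  obtain y z where p: "path3 r y z" "V = {r, y, z}" using assms by (auto simp: P3_end_def)
  note d = path3D[OF p(1)]
  have "joined {r} r {y, z} y" using d by (auto simp: joined_def)
  moreover have "P2_at {y, z} y" using d by (auto simp: P2_at_def)
  ultimately show ?thesis using that[of "{y, z}" y] p by auto
qed

text \<open>
  The rooted trees whose root is free while no vertex below it is free in its own subtree.
\<close>

inductive bottom :: "'a set \<Rightarrow> 'a \<Rightarrow> bool" where
  "P3_end V r \<Longrightarrow> bottom V r"
| "P3_mid V r \<Longrightarrow> bottom V r"
| bottom_leaf: "bottom V r \<Longrightarrow> joined V r {q} q \<Longrightarrow> bottom (V \<union> {q}) r"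
| bottom_P2: "bottom V r \<Longrightarrow> P2_at W q \<Longrightarrow> joined V r W q \<Longrightarrow> bottom (V \<union> W) r"

lemma bottom_finite: "bottom V r \<Longrightarrow> finite V"
  by (induction rule: bottom.induct) (auto simp: P3_end_def P3_mid_def P2_at_def)

text \<open>Adding a single vertex or a \<open>P2\<close> keeps \<open>num_avoiding\<close> at 1.
  Its root is forced, so a maximum set containing \<open>r\<close> survives only if both roots are
  isolated. This happens just once, for a leaf added at an end of a \<open>P3\<close>, and the
  result is a \<open>P4\<close> rooted at an inner vertex.\<close>

lemma bottom_values:
  assumes "bottom V r"
  shows "P3_end V r \<or> P3_mid V r \<or>
    (\<exists>W q. V = W \<union> {q} \<and> P3_end W r \<and> joined W r {q} q \<and>
       psi V = 3 \<and> num_avoiding V r = 1 \<and> Phi V = 2 \<and> num_isolating V r = 0) \<or>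
    3 \<le> psi V \<and> num_avoiding V r = 1 \<and> Phi V = 1 \<and> num_isolating V r = 0" (is "?P V r")
  using assms
proof (induction rule: bottom.induct)
  case (bottom_leaf V r q)
  have A: "num_avoiding V r = 1"
    using bottom_leaf.IH P3_end_values(3)[of V r] P3_mid_values(3)[of V r] by auto
  note j = bottom_leaf.hyps(2) and f = bottom_finite[OF bottom_leaf.hyps(1)]
  have v: "psi (V \<union> {q}) = psi V + 1" "Phi (V \<union> {q}) = 1 + num_isolating V r"
      "num_isolating (V \<union> {q}) r = 0"
    using joined_values[OF j f] A by (simp_all add: single_values)
  have "num_avoiding (V \<union> {q}) r = 1"
    using joined_remove[OF j f] v(1) num_avoiding_eq[of "V \<union> {q}" r] num_avoiding_eq[of V r] f A
    by (auto simp: single_values split: if_splits)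
  then show ?case
    using bottom_leaf.IH v j P3_end_values[of V r] P3_mid_values[of V r] by auto
next
  case (bottom_P2 V r W q)
  have A: "num_avoiding V r = 1"
    using bottom_P2.IH P3_end_values(3)[of V r] P3_mid_values(3)[of V r] by auto
  note j = bottom_P2.hyps(3) and f = bottom_finite[OF bottom_P2.hyps(1)]
  note w = P2_values[OF bottom_P2.hyps(2)]
  have v: "psi (V \<union> W) = psi V + 2" "Phi (V \<union> W) = 1" "num_isolating (V \<union> W) r = 0"
    using joined_values[OF j f w(6)] A by (simp_all add: w)
  have "num_avoiding (V \<union> W) r = 1"
    using joined_remove[OF j f] v(1) num_avoiding_eq[of "V \<union> W" r] num_avoiding_eq[of V r] f A w
    by (auto split: if_splits)
  then show ?case
    using bottom_P2.IH v j P3_end_values[of V r] P3_mid_values[of V r] by auto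
qed blast+

lemma joined_in: "joined V r W q \<Longrightarrow> r \<in> V" "joined V r W q \<Longrightarrow> q \<in> W" "joined V r W q \<Longrightarrow> V \<inter> W = {}"
  by (auto simp: joined_def)

lemma joined_subset_right:
  "joined V r W q \<Longrightarrow> q \<in> W' \<Longrightarrow> W' \<subseteq> W \<Longrightarrow> joined V r W' q"
  and joined_subset_left:
  "joined V r W q \<Longrightarrow> r \<in> V' \<Longrightarrow> V' \<subseteq> V \<Longrightarrow> joined V' r W q"
  by (auto simp: joined_def)

text \<open>A search for a lowest free vertex. Keeping \<open>r\<close> in the remainder
  \<open>V'\<close> lets the induction reattach there the half of the tree that was split off at
  \<open>r\<close>.\<close>

lemma utree_bottom:
  assumes "utree V" "r \<in> V"
  shows "V = {r} \<or> P2_at V r \<or> bottom V r \<or>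
    (\<exists>V' B h v. V = V' \<union> B \<and> utree V' \<and> bottom B v \<and> joined V' h B v \<and> r \<in> V')"
  using assms
proof (induction "card V" arbitrary: V r rule: less_induct)
  case less
  show ?case
  proof (cases "V = {r}")
    case True then show ?thesis by simp
  next
    case False
    obtain V1 V2 q where V: "V = V1 \<union> V2" "joined V1 r V2 q" "utree V1" "utree V2"
      using utree_split_at[OF less.prems False] by metis
    note jin = joined_in[OF V(2)]
    have fin: "finite V1" "finite V2" using V utree_finite by auto
    have c: "card V1 < card V" "card V2 < card V"
      unfolding V(1) using fin jin by (auto intro!: psubset_card_mono)
    note I1 = less.hyps[OF c(1) V(3) jin(1)] and I2 = less.hyps[OF c(2) V(4) jin(2)]
    have small: ?thesis if small2: "V2 = {q} \<or> P2_at V2 q"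
    proof -
      consider "V1 = {r}" | "P2_at V1 r" | "bottom V1 r"
        | V' B h v where "V1 = V' \<union> B" "utree V'" "bottom B v" "joined V' h B v" "r \<in> V'"
        using I1 by blast
      then show ?thesis
      proof cases
        case 1
        then show ?thesis
          using small2 V(1,2) P3_end_joined[of r V2 q] bottom.intros(1)
          by (auto simp: P2_at_def joined_def)
      next
        case 2
        show ?thesis using small2
        proof
          assume "V2 = {q}"
          then show ?thesis using P3_mid_joined[OF 2] V(1,2) bottom.intros(2)[of V r] by auto
        next
          assume b: "P2_at V2 q"
          \<comment> \<open>Two copies of \<open>P2\<close> joined by an edge form a
            \<open>P4\<close>. It is regrouped as the \<open>P3\<close> starting at \<open>r\<close>
            and running through \<open>V2\<close>, with \<open>s\<close> as an additional leaf at
            \<open>r\<close>.\<close>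
          obtain s where s: "(r, s) \<in> E" "V1 = {r, s}" using 2 by (auto simp: P2_at_def)
          have rs: "r \<noteq> s" using E_neq s by blast
          have j1: "joined {r} r V2 q" using joined_subset_left[OF V(2)] s by auto
          have "joined ({r} \<union> V2) r {s} s"
            using V(2) s rs by (auto simp: joined_def E_commute[of _ s])
          from bottom_leaf[OF bottom.intros(1) this] P3_end_joined[OF j1 b]
          have "bottom ({r} \<union> V2 \<union> {s}) r" by simp
          moreover have "{r} \<union> V2 \<union> {s} = V" using V(1) s by blast
          ultimately show ?thesis by simp
        qed
      next
        case 3
        then show ?thesis using small2 V(1,2) bottom_leaf bottom_P2 by metis
      next
        case 4
        have j: "joined V' r V2 q" using joined_subset_left[OF V(2)] 4 by auto
        have "utree (V' \<union> V2)" using utree.join[OF 4(2) V(4) j] .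
        moreover have "joined (V' \<union> V2) h B v"
          using 4 V(2) by (intro joined_Un_left(2)[OF 4(4), of r V2 q]) auto
        moreover have "V = (V' \<union> V2) \<union> B" using V(1) 4(1) by blast
        ultimately show ?thesis using 4 by blast
      qed
    qed
    consider "V2 = {q} \<or> P2_at V2 q" | "bottom V2 q"
      | V' B h v where "V2 = V' \<union> B" "utree V'" "bottom B v" "joined V' h B v" "q \<in> V'"
      using I2 by blast
    then show ?thesis
    proof cases
      case 1 then show ?thesis by (rule small)
    next
      case 2 then show ?thesis using V jin by blast
    next
      case 3
      have j: "joined V1 r V' q" using joined_subset_right[OF V(2)] 3 by auto
      have "utree (V1 \<union> V')" using utree.join[OF V(3) 3(2) j] .
      moreover have "joined (V' \<union> V1) h B v"
        using 3 joined_sym[OF V(2)] by (intro joined_Un_left(2)[OF 3(4), of q V1 r]) auto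
      moreover have "V = (V1 \<union> V') \<union> B" using V(1) 3(1) by blast
      ultimately show ?thesis using 3 jin by (metis Un_commute UnI1)
    qed
  qed
qed

section \<open>The extremal trees\<close>

text \<open>Copies of \<open>P3\<close> hung on \<open>r\<close> by arbitrary vertices: the
  exception in \<open>forced_single_bound\<close>, where \<open>Phi (V - {r})\<close> is not held to
  two thirds of the power of three.\<close>

inductive P3_star :: "'a set \<Rightarrow> 'a \<Rightarrow> bool" where
  "P3_star {r} r"
| "P3_star V r \<Longrightarrow> P3 W \<Longrightarrow> joined V r W q \<Longrightarrow> P3_star (V \<union> W) r"

text \<open>The exception in \<open>free_bound\<close>. The base is \<open>r\<close> with a
  \<open>P2\<close> attached, and the copies of \<open>P3\<close> may hang by ends or by middles.
  Those with ends only are the \<open>T2_tree\<close>s.\<close>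

inductive P2_P3_star :: "'a set \<Rightarrow> 'a \<Rightarrow> bool" where
  "P3_end V r \<Longrightarrow> P2_P3_star V r"
| "P2_P3_star V r \<Longrightarrow> P3 W \<Longrightarrow> joined V r W q \<Longrightarrow> P2_P3_star (V \<union> W) r"

text \<open>The base is a \<open>P4\<close> with inner vertex \<open>r\<close>, which plays the part
  of the fixed vertex of the family. The edge between \<open>r\<close> and \<open>s\<close> is the
  fixed copy of \<open>P2\<close>, and the other two vertices form the second copy.\<close>

inductive T1_tree :: "'a set \<Rightarrow> 'a \<Rightarrow> bool" where
  base: "P3_end V r \<Longrightarrow> joined V r {s} s \<Longrightarrow> T1_tree (V \<union> {s}) r"
| step: "T1_tree V r \<Longrightarrow> P3 W \<Longrightarrow> joined V r W q \<Longrightarrow> T1_tree (V \<union> W) r"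

inductive T2_tree :: "'a set \<Rightarrow> 'a \<Rightarrow> bool" where
  base: "P3_end V r \<Longrightarrow> T2_tree V r"
| step: "T2_tree V r \<Longrightarrow> P3_end W q \<Longrightarrow> joined V r W q \<Longrightarrow> T2_tree (V \<union> W) r"

lemma finite_P3_end: "P3_end V r \<Longrightarrow> finite V"
  by (auto simp: P3_end_def)

lemma finite_P2_P3_star: "P2_P3_star V r \<Longrightarrow> finite V"
  by (induction rule: P2_P3_star.induct) (auto simp: P3_values(3) finite_P3_end)

lemma finite_T1_tree: "T1_tree V r \<Longrightarrow> finite V"
  by (induction rule: T1_tree.induct) (auto simp: P3_values(3) finite_P3_end)

lemma finite_T2_tree: "T2_tree V r \<Longrightarrow> finite V"
  by (induction rule: T2_tree.induct) (auto simp: finite_P3_end)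

text \<open>Here \<open>j\<close> counts the attached copies of \<open>P3\<close> and
  \<open>l\<close> those attached by an end. Since \<open>num_isolating V r = 1\<close>, such a copy
  contributes one additional maximum set, and a copy attached by its middle contributes
  none.\<close>

lemma P2_P3_star_values:
  assumes "P2_P3_star V r"
  shows "\<exists>j l. psi V = 2 * j + 2 \<and> num_avoiding V r = 3 ^ j \<and> num_isolating V r = 1 \<and>
      Phi V = 3 ^ j + l + 2 \<and>
    l \<le> j \<and> (l = j \<longrightarrow> T2_tree V r)"
  using assms
proof (induction rule: P2_P3_star.induct)
  case (1 V r)
  then show ?case using P3_end_values[OF 1] T2_tree.base[OF 1] by (intro exI[of _ 0]) simp
next
  case (2 V r W q)
  then obtain j l where j: "psi V = 2 * j + 2" "num_avoiding V r = 3 ^ j" "num_isolating V r = 1"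
      "Phi V = 3 ^ j + l + 2"
    "l \<le> j" "l = j \<longrightarrow> T2_tree V r"
    by blast
  note jo = \<open>joined V r W q\<close> and f = finite_P2_P3_star[OF \<open>P2_P3_star V r\<close>]
  note w = P3_values[OF \<open>P3 W\<close>]
  have q: "q \<in> W" using joined_in[OF jo] by blast
  have A: "num_avoiding W q = 1" using w(4) q by blast
  have v: "psi (V \<union> W) = 2 * Suc j + 2" "num_isolating (V \<union> W) r = 1"
    "Phi (V \<union> W) = 3 ^ Suc j + (l + num_isolating W q) + 2"
    using joined_values[OF jo f w(3)] A j w by simp_all
  have "psi (V - {r}) = psi V" "Phi (V - {r}) = 3 ^ j"
    using num_avoiding_eq[OF f, of r] j(2) by (auto split: if_splits)
  then have at: "num_avoiding (V \<union> W) r = 3 ^ Suc j"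
    using num_avoiding_eq[of "V \<union> W" r] joined_remove[OF jo f w(3)] v(1) f j(1) w by simp
  from P3_cases[OF \<open>P3 W\<close> q] show ?case
  proof
    assume e: "P3_end W q"
    have "l = j \<longrightarrow> T2_tree (V \<union> W) r" using j(6) T2_tree.step[OF _ e jo] by blast
    then show ?thesis using v at j(5) P3_end_values[OF e]
      by (intro exI[of _ "Suc j"] exI[of _ "Suc l"]) simp
  next
    assume e: "P3_mid W q"
    then show ?thesis using v at j(5) P3_mid_values[OF e]
      by (intro exI[of _ "Suc j"] exI[of _ "l"]) simp
  qed
qed

text \<open>The root is never isolated, so the product of isolating counts vanishes at each step and
  the position of attachment in the \<open>P3\<close> does not affect the count. Exactly one maximum
  set contains the root throughout.\<close>

lemma T1_tree_values:
  assumes "T1_tree V r"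
  shows "\<exists>k. psi V = 2 * k + 3 \<and> psi (V - {r}) = psi V \<and> num_avoiding V r = 3 ^ k \<and>
      num_isolating V r = 0 \<and>
    Phi V = 3 ^ k + 1"
  using assms
proof (induction rule: T1_tree.induct)
  case (base V r s)
  note f = finite_P3_end[OF base(1)] and w = P3_end_values[OF base(1)]
  have v: "psi (V \<union> {s}) = 3" "num_isolating (V \<union> {s}) r = 0" "Phi (V \<union> {s}) = 2"
    using joined_values[OF base(2) f] w by (simp_all add: single_values)
  have p: "psi (V - {r}) = psi V" "Phi (V - {r}) = 1"
    using num_avoiding_eq[OF f, of r] w(3) by (auto split: if_splits)
  then have "num_avoiding (V \<union> {s}) r = 1" "psi (V \<union> {s} - {r}) = psi (V \<union> {s})"
    using num_avoiding_eq[of "V \<union> {s}" r] joined_remove[OF base(2) f] v(1) f w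
    by (simp_all add: single_values)
  then show ?case using v by (intro exI[of _ 0]) simp
next
  case (step V r W q)
  then obtain k where k: "psi V = 2 * k + 3" "psi (V - {r}) = psi V" "num_avoiding V r = 3 ^ k"
      "num_isolating V r = 0"
    "Phi V = 3 ^ k + 1" by blast
  note jo = step.hyps(3) and f = finite_T1_tree[OF step.hyps(1)] and w = P3_values[OF step.hyps(2)]
  have A: "num_avoiding W q = 1" using w(4) joined_in[OF jo] by blast
  have v: "psi (V \<union> W) = 2 * Suc k + 3" "num_isolating (V \<union> W) r = 0" "Phi (V \<union> W) = 3 ^ Suc k + 1"
    using joined_values[OF jo f w(3)] A k w by simp_all
  have p: "Phi (V - {r}) = 3 ^ k" using num_avoiding_eq[OF f, of r] k(2,3) by simp
  have "num_avoiding (V \<union> W) r = 3 ^ Suc k" "psi (V \<union> W - {r}) = psi (V \<union> W)"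
    using num_avoiding_eq[of "V \<union> W" r] joined_remove[OF jo f w(3)] v(1) f k p w by simp_all
  then show ?case using v by (intro exI[of _ "Suc k"]) simp
qed

lemma T2_tree_values:
  assumes "T2_tree V r"
  shows "\<exists>j. psi V = 2 * j + 2 \<and> Phi V = 3 ^ j + j + 2"
proof -
  have "\<exists>j. psi V = 2 * j + 2 \<and> num_avoiding V r = 3 ^ j \<and> num_isolating V r = 1 \<and>
      Phi V = 3 ^ j + j + 2"
    using assms
  proof (induction rule: T2_tree.induct)
    case (base V r)
    then show ?case using P3_end_values[OF base] by (intro exI[of _ 0]) simp
  next
    case (step V r W q)
    then obtain j where j: "psi V = 2 * j + 2" "num_avoiding V r = 3 ^ j" "num_isolating V r = 1"
        "Phi V = 3 ^ j + j + 2"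
      by blast
    note jo = step.hyps(3) and f = finite_T2_tree[OF step.hyps(1)]
      and fw = finite_P3_end[OF step.hyps(2)] and w = P3_end_values[OF step.hyps(2)]
    have v: "psi (V \<union> W) = 2 * Suc j + 2" "num_isolating (V \<union> W) r = 1"
        "Phi (V \<union> W) = 3 ^ Suc j + Suc j + 2"
      using joined_values[OF jo f fw] j w by simp_all
    have p: "psi (V - {r}) = psi V" "Phi (V - {r}) = 3 ^ j"
      using num_avoiding_eq[OF f, of r] j(2) by (auto split: if_splits)
    have "num_avoiding (V \<union> W) r = 3 ^ Suc j"
      using num_avoiding_eq[of "V \<union> W" r] joined_remove[OF jo f fw] v(1) f fw j p w by simp
    then show ?case using v by blast
  qed
  then show ?thesis by blast
qed

text \<open>The \<open>P2\<close> arrives last but is moved below all copies of \<open>P3\<close>,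
  where it completes the base of the \<open>P2_P3_star\<close>.\<close>

lemma P3_star_P2:
  assumes "P3_star V r" "P2_at W q" "joined V r W q"
  shows "P2_P3_star (V \<union> W) r"
  using assms
proof (induction rule: P3_star.induct)
  case (1 r)
  then show ?case using P3_end_joined P2_P3_star.intros(1) by simp
next
  case (2 V r Q y)
  have r: "r \<in> V" using joined_in[OF 2(3)] by blast
  note k = joined_Un_left[OF 2(3) 2(6) r]
  have "P2_P3_star ((V \<union> W) \<union> Q) r"
    using P2_P3_star.intros(2)[OF 2(4)[OF 2(5) k(1)] 2(2) k(2)] .
  moreover have "(V \<union> W) \<union> Q = V \<union> Q \<union> W" by blast
  ultimately show ?case by simp
qed

lemma num_avoiding_Un_unrelated:
  assumes "finite V" "finite W" "\<forall>x\<in>V. \<forall>y\<in>W. (x, y) \<notin> E" "V \<inter> W = {}" "h \<in> V"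
  shows "num_avoiding (V \<union> W) h = num_avoiding V h * Phi W"
proof -
  have "avoiding (V \<union> W) h = glue (avoiding V h) (max_diss W)"
    unfolding set_eq_iff glue_iff[OF avoiding_sub max_diss_sub assms(4)]
    unfolding avoiding_def psi_Phi_Un_unrelated(3)[OF assms(1-4)]
      glue_iff[OF max_diss_sub max_diss_sub assms(4)]
    using assms(5) by auto
  then show ?thesis
    using card_glue[OF avoiding_sub max_diss_sub assms(4)] by (simp add: num_avoiding_def Phi_def)
qed

text \<open>Without its centre the tree falls apart into a single vertex, a \<open>P2\<close> and
  \<open>k\<close> copies of \<open>P3\<close>. Vertices of the first two lie in every maximum set,
  and a vertex of a \<open>P3\<close> is avoided by one of the three maximum sets of that
  copy.\<close>

lemma T1_tree_avoid_two:
  assumes "T1_tree V r" "h \<in> V" "h \<noteq> r" "psi V = 2 * k + 3"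
  shows "3 * num_avoiding (V - {r}) h \<le> 3 ^ k"
  using assms
proof (induction arbitrary: k rule: T1_tree.induct)
  case (base V r s)
  obtain y z where p: "path3 r y z" and V: "V = {r, y, z}" using base(1) by (auto simp: P3_end_def)
  note d = path3D[OF p]
  have s: "s \<noteq> r" "s \<noteq> y" "s \<noteq> z" "(y, s) \<notin> E" "(z, s) \<notin> E"
    using base(2) V d by (auto simp: joined_def)
  have eq: "V \<union> {s} - {r} = {y, z} \<union> {s}" using V d s by auto
  have u: "\<forall>x\<in>{y, z}. \<forall>y'\<in>{s}. (x, y') \<notin> E" "{y, z} \<inter> {s} = {}"
    "\<forall>x\<in>{s}. \<forall>y'\<in>{y, z}. (x, y') \<notin> E" "{s} \<inter> {y, z} = {}"
    using s E_commute by auto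
  have P: "P2_at {y, z} y" "P2_at {y, z} z" using d by (auto simp: P2_at_def)
  consider "h = y" | "h = z" | "h = s" using base(3,4) V by auto
  then have "num_avoiding (V \<union> {s} - {r}) h = 0"
  proof cases
    case 1 then show ?thesis unfolding eq
      using num_avoiding_Un_unrelated[OF _ _ u(1,2)] P2_values(3)[OF P(1)] by simp
  next
    case 2 then show ?thesis unfolding eq
      using num_avoiding_Un_unrelated[OF _ _ u(1,2)] P2_values(3)[OF P(2)] by simp
  next
    case 3
    have "V \<union> {s} - {r} = {s} \<union> {y, z}" using eq by blast
    then show ?thesis
      using num_avoiding_Un_unrelated[OF _ _ u(3,4)] single_values(3)[of s] 3 by simp
  qed
  then show ?case by simp
next
  case (step V r W q)
  note jo = step.hyps(3) and f = finite_T1_tree[OF step.hyps(1)] and w = P3_values[OF step.hyps(2)]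
  note jin = joined_in[OF jo]
  obtain j where j: "psi V = 2 * j + 3" "psi (V - {r}) = psi V" "num_avoiding V r = 3 ^ j"
    using T1_tree_values[OF step.hyps(1)] by blast
  have A: "num_avoiding W q = 1" using w(4) jin by blast
  have k: "k = Suc j" using joined_values(1)[OF jo f w(3)] A j(1) w(1) step.prems(3) by simp
  have eq: "V \<union> W - {r} = (V - {r}) \<union> W" using jin by blast
  have u: "\<forall>x\<in>V - {r}. \<forall>y\<in>W. (x, y) \<notin> E" "(V - {r}) \<inter> W = {}"
    "\<forall>x\<in>W. \<forall>y\<in>V - {r}. (x, y) \<notin> E" "W \<inter> (V - {r}) = {}"
    using jo joined_sym[OF jo] by (auto simp: joined_def)
  show ?case
  proof (cases "h \<in> V")
    case True
    have "3 * num_avoiding (V - {r}) h \<le> 3 ^ j" by (rule step.IH) (use True step.prems j in auto)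
    then show ?thesis unfolding eq k
      using num_avoiding_Un_unrelated[OF _ w(3) u(1,2), of h] f True step.prems w(2) by simp
  next
    case False
    then have h: "h \<in> W" using step.prems by simp
    have "Phi (V - {r}) = 3 ^ j" using num_avoiding_eq[OF f, of r] j by simp
    moreover have "V \<union> W - {r} = W \<union> (V - {r})" using eq by blast
    ultimately show ?thesis unfolding k
      using num_avoiding_Un_unrelated[OF w(3) _ u(3,4) h] f w(4)[OF h] by simp
  qed
qed

text \<open>
  One maximum set contains the centre, and at most a third of the others avoid a second vertex.
\<close>

lemma T1_tree_center:
  assumes "T1_tree V r" "h \<in> V" "psi V = 2 * k + 3" "num_avoiding V h = 3 ^ k"
  shows "T1_tree V h"
proof (cases "h = r")
  case True then show ?thesis using assms(1) by simp
next
  case False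
  have f: "finite V" using finite_T1_tree[OF assms(1)] .
  obtain j where j: "psi V = 2 * j + 3" "psi (V - {r}) = psi V" "num_avoiding V r = 3 ^ j"
      "Phi V = 3 ^ j + 1"
    using T1_tree_values[OF assms(1)] by blast
  have jk: "j = k" using j(1) assms(3) by simp
  have "card (max_diss V - avoiding V r) = Phi V - num_avoiding V r"
    unfolding Phi_def num_avoiding_def using f
        by (intro card_Diff_subset) (auto simp: avoiding_def)
  then have c1: "card (max_diss V - avoiding V r) = 1" using j by simp
  have "avoiding V h \<subseteq> avoiding (V - {r}) h \<union> (max_diss V - avoiding V r)"
    using avoiding_eq[OF f j(2)] by (auto simp: avoiding_def)
  then have "num_avoiding V h \<le> card (avoiding (V - {r}) h \<union> (max_diss V - avoiding V r))"
    unfolding num_avoiding_def using f by (intro card_mono) auto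
  also have "\<dots> \<le> num_avoiding (V - {r}) h + 1" using card_Un_le c1 unfolding num_avoiding_def
      by metis
  finally have "3 ^ k \<le> num_avoiding (V - {r}) h + 1" using assms(4) by simp
  moreover have "3 * num_avoiding (V - {r}) h \<le> 3 ^ k"
    using T1_tree_avoid_two[OF assms(1,2) False assms(3)] .
  ultimately have "2 * (3::nat) ^ k \<le> 3" by linarith
  \<comment> \<open>Only the \<open>P4\<close> is left, where the inner vertex different from
    \<open>r\<close> is a second centre.\<close>
  then have k0: "k = 0"
  proof (cases k)
    case (Suc i)
    moreover have "1 \<le> (3::nat) ^ i" by simp
    ultimately show ?thesis using \<open>2 * (3::nat) ^ k \<le> 3\<close> unfolding Suc power_Suc by linarith
  qed simp
  from assms(1) show ?thesis
  proof cases
    case (step V0 W q)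
    obtain i where i: "psi V0 = 2 * i + 3" using T1_tree_values[OF step(2)] by blast
    have "psi V0 + 2 \<le> psi V"
      using joined_values(1)[OF step(4) finite_T1_tree[OF step(2)] P3_values(3)[OF step(3)]]
        P3_values(1,4)[OF step(3)] joined_in[OF step(4)] step(1) by simp
    then show ?thesis using i assms(3) k0 by simp
  next
    case (base V0 s)
    obtain y z where p: "path3 r y z" and V: "V0 = {r, y, z}" using base(2)
        by (auto simp: P3_end_def)
    note d = path3D[OF p]
    have s: "s \<noteq> r" "s \<noteq> y" "s \<noteq> z" "(y, s) \<notin> E" "(z, s) \<notin> E" "(r, s) \<in> E"
      using base(3) V d by (auto simp: joined_def)
    have s': "(s, y) \<notin> E" "(s, z) \<notin> E" "(s, r) \<in> E" using s E_commute by auto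
    have p2: "path3 y r s" using s d by (simp add: path3_def)
    have psi3: "psi V = 3" using assms(3) k0 by simp
    \<comment> \<open>The path is \<open>s\<close>, \<open>r\<close>, \<open>y\<close>,
      \<open>z\<close>. Reading it backwards makes \<open>y\<close> the centre. Deleting an end
      lowers \<open>psi\<close> from 3 to 2, so the ends are not free, contrary to the assumption on
      \<open>num_avoiding\<close>.\<close>
    consider "h = y" | "h = z" | "h = s" using assms(2) False base(1) V by auto
    then show ?thesis
    proof cases
      case 1
      have "P3_end {y, r, s} y" using p2 unfolding P3_end_def by blast
      moreover have "joined {y, r, s} y {z} z" using d s s' by (auto simp: joined_def)
      moreover have "V = {y, r, s} \<union> {z}" using base(1) V by auto
      ultimately show ?thesis using 1 T1_tree.base by metis
    next
      case 2
      have "V - {z} = {y, r, s}" using base(1) V d s by auto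
      then have "psi (V - {z}) = 2" using path3_max_diss(1)[OF p2] by simp
      then have "num_avoiding V z = 0" using num_avoiding_eq[OF f, of z] psi3 by simp
      then show ?thesis using 2 assms(4) by simp
    next
      case 3
      have "V - {s} = {r, y, z}" using base(1) V d s by auto
      then have "psi (V - {s}) = 2" using path3_max_diss(1)[OF p] by simp
      then have "num_avoiding V s = 0" using num_avoiding_eq[OF f, of s] psi3 by simp
      then show ?thesis using 3 assms(4) by simp
    qed
  qed
qed

section \<open>Bounds for rooted trees\<close>

text \<open>The weakening of \<open>optimal\<close> that the joining step consumes. The factor 2/3
  is sharp: it is attained by the \<open>P4\<close> and by the \<open>T2_tree\<close> with
  \<open>psi = 4\<close> and six maximum sets.\<close>

definition crude :: "'a set \<Rightarrow> bool" where
  "crude V \<longleftrightarrow> Phi V \<le> 3 ^ (psi V div 2) \<and>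
     ((\<exists>r. V = {r}) \<or> P3 V \<or> 3 * Phi V \<le> 2 * 3 ^ (psi V div 2))"

text \<open>
  A root that is not free is isolated in some maximum set if and only if no child subtree has a
  forced root. The three predicates below correspond to a free root, to a forced root isolated in
  some maximum set, and to a forced root that is matched in every maximum set.
\<close>

definition free_bound :: "'a set \<Rightarrow> 'a \<Rightarrow> nat \<Rightarrow> bool" where
  "free_bound V r m \<longleftrightarrow> 3 * num_avoiding V r \<le> 3 ^ m \<and>
     (num_isolating V r = 0 \<or> P2_P3_star V r \<or>
      9 * num_avoiding V r \<le> 3 ^ m \<and> 3 * num_isolating V r \<le> 3 ^ m \<or>
      9 * num_avoiding V r \<le> 2 * 3 ^ m \<and> 9 * num_isolating V r \<le> 3 ^ m)"

definition forced_single_bound :: "'a set \<Rightarrow> 'a \<Rightarrow> nat \<Rightarrow> bool" where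
  "forced_single_bound V r p \<longleftrightarrow>
     (V = {r} \<or>
      3 * num_isolating V r \<le> 3 ^ (p div 2) \<and> (even p \<longrightarrow> 9 * num_isolating V r \<le> 3 ^ (p div 2))) \<and>
     (even p \<longrightarrow> 3 * Phi V \<le> 3 ^ (p div 2)) \<and>
     Phi (V - {r}) \<le> 3 ^ ((p - 1) div 2) \<and>
     (P3_star V r \<or> 3 * Phi (V - {r}) \<le> 2 * 3 ^ ((p - 1) div 2))"

definition forced_paired_bound :: "'a set \<Rightarrow> 'a \<Rightarrow> nat \<Rightarrow> bool" where
  "forced_paired_bound V r m \<longleftrightarrow> 3 * Phi (V - {r}) \<le> 3 ^ m \<and> (P2_at V r \<or> 9 * Phi V \<le> 3 ^ m)"

text \<open>Attaching a piece uses the estimates of \<open>num_avoiding\<close> and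
  \<open>num_isolating\<close>. The clauses on \<open>Phi V\<close> and \<open>Phi (V - {r})\<close>
  close the invariant under joining, because these numbers turn into factors of the counts of the
  larger tree when the state of the root changes. The stronger clauses for even \<open>psi\<close>
  repay what rounding in \<open>div 2\<close> loses.\<close>

definition rooted_bound :: "'a set \<Rightarrow> 'a \<Rightarrow> bool" where
  "rooted_bound V r \<longleftrightarrow>
     (0 < num_avoiding V r \<and> free_bound V r (psi V div 2)) \<or>
     (num_avoiding V r = 0 \<and> 0 < num_isolating V r \<and> forced_single_bound V r (psi V)) \<or>
     (num_avoiding V r = 0 \<and> num_isolating V r = 0 \<and> forced_paired_bound V r (psi V div 2))"

lemma free_bound_isolating:
  assumes "finite V" "free_bound V r (psi V div 2)"
  shows "3 * num_isolating V r \<le> 3 ^ (psi V div 2)"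
proof -
  have "3 * num_isolating V r \<le> 3 ^ (psi V div 2)" if star: "P2_P3_star V r"
  proof -
    obtain j where "psi V = 2 * j + 2" "num_isolating V r = 1" using P2_P3_star_values[OF star]
        by blast
    then show ?thesis by simp
  qed
  then show ?thesis using assms(2) unfolding free_bound_def by linarith
qed

lemma forced_paired_Phi:
  assumes "forced_paired_bound V r (psi V div 2)"
  shows "3 * Phi V \<le> 3 ^ (psi V div 2)"
  using assms P2_values(1,2)[of V r] unfolding forced_paired_bound_def by auto

context
  fixes V W :: "'a set" and r q :: 'a
  assumes jo: "joined V r W q" and fV: "finite V" and fW: "finite W"
begin

text \<open>A free root stays free. A \<open>P2_P3_star\<close> joined to a \<open>P3\<close> is
  again one. Any other child for which the new root can still be isolated costs
  \<open>num_avoiding\<close> a factor 2/3 by \<open>crude\<close>, which leads to the last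
  alternative of \<open>free_bound\<close>.\<close>

lemma join_free:
  assumes R: "0 < num_avoiding V r" "free_bound V r (psi V div 2)" and Q: "rooted_bound W q"
      and cW: "crude W"
  shows "rooted_bound (V \<union> W) r"
proof -
  let ?U = "V \<union> W"
  define m n where "m = psi V div 2" and "n = psi W div 2"
  have v: "psi ?U = psi V + psi W" "num_isolating ?U r = num_isolating V r * num_avoiding W q"
    using joined_values[OF jo fV fW] R(1) by auto
  have p: "psi (V - {r}) = psi V" "num_avoiding V r = Phi (V - {r})"
      using num_avoiding_eq[OF fV, of r] R(1) by (auto split: if_splits)
  have a: "num_avoiding ?U r = num_avoiding V r * Phi W"
    using num_avoiding_eq[of ?U r] fV fW joined_remove[OF jo fV fW] v(1) p by simp
  have k: "m + n \<le> psi ?U div 2" unfolding m_def n_def v(1) by presburger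
  have cW': "1 * Phi W \<le> 1 * 3 ^ n" using cW by (simp add: crude_def n_def)
  note R' = R(2)[unfolded free_bound_def, folded m_def]
  have A: "3 * num_avoiding ?U r \<le> 3 ^ (psi ?U div 2)"
    using mult_power3_le[of 3 "num_avoiding V r" 1 m 1 "Phi W" 1 n 0 "psi ?U div 2"] R' cW' k a
        by simp
  have "0 < num_avoiding ?U r" using a R(1) Phi_pos[OF fW] by simp
  moreover have "free_bound ?U r (psi ?U div 2)"
  proof (cases "num_isolating ?U r = 0")
    case True then show ?thesis using A by (simp add: free_bound_def)
  next
    case False
    then have B: "0 < num_isolating V r" "0 < num_avoiding W q" using v(2) by auto
    have nsing: "W \<noteq> {s}" for s
      using B(2) single_values(3)[of q] joined_in(2)[OF jo] by auto
    have QA: "3 * num_avoiding W q \<le> 1 * 3 ^ n"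
      using Q B(2) by (auto simp: rooted_bound_def free_bound_def n_def)
    consider "P2_P3_star V r" "P3 W" | "P2_P3_star V r" "3 * Phi W \<le> 2 * 3 ^ n"
      | "9 * num_avoiding V r \<le> 1 * 3 ^ m" "3 * num_isolating V r \<le> 1 * 3 ^ m"
      | "9 * num_avoiding V r \<le> 2 * 3 ^ m" "9 * num_isolating V r \<le> 1 * 3 ^ m"
      using R' B cW nsing unfolding crude_def n_def by auto
    then show ?thesis
    proof cases
      case 1
      then show ?thesis using A P2_P3_star.intros(2)[OF 1 jo] by (simp add: free_bound_def)
    next
      case 2
      obtain j where j: "psi V = 2 * j + 2" "num_isolating V r = 1"
          using P2_P3_star_values[OF 2(1)] by blast
      have "3 * 3 * 3 ^ 0 * (num_avoiding V r * Phi W) \<le> 1 * 2 * 3 ^ (psi ?U div 2)"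
        by (rule mult_power3_le) (use R' 2 k in auto)
      \<comment> \<open>The star contributes only the factor 1 to \<open>num_isolating\<close> but
        at least 2 to \<open>psi\<close>, which leaves one spare factor 3.\<close>
      moreover have "1 * 3 * 3 ^ 1 * (1 * num_avoiding W q) \<le> 1 * 1 * 3 ^ (psi ?U div 2)"
        by (rule mult_power3_le[of _ _ _ 0 _ _ _ n]) (use QA j k in \<open>auto simp: m_def\<close>)
      ultimately show ?thesis using A a v(2) j(2) by (simp add: free_bound_def)
    next
      case 3
      have "9 * 1 * 3 ^ 0 * (num_avoiding V r * Phi W) \<le> 1 * 1 * 3 ^ (psi ?U div 2)"
        by (rule mult_power3_le) (use 3 cW' k in auto)
      moreover have "3 * 3 * 3 ^ 0 * (num_isolating V r * num_avoiding W q) \<le>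
          1 * 1 * 3 ^ (psi ?U div 2)"
        by (rule mult_power3_le) (use QA 3 k in auto)
      ultimately show ?thesis using A a v(2) by (simp add: free_bound_def)
    next
      case 4
      have "9 * 1 * 3 ^ 0 * (num_avoiding V r * Phi W) \<le> 2 * 1 * 3 ^ (psi ?U div 2)"
        by (rule mult_power3_le) (use 4 cW' k in auto)
      moreover have "9 * 3 * 3 ^ 0 * (num_isolating V r * num_avoiding W q) \<le>
          1 * 1 * 3 ^ (psi ?U div 2)"
        by (rule mult_power3_le) (use QA 4 k in auto)
      ultimately show ?thesis using A a v(2) by (simp add: free_bound_def)
    qed
  qed
  ultimately show ?thesis by (simp add: rooted_bound_def)
qed

lemma join_forced_remove:
  assumes "num_avoiding V r = 0"
  shows "Suc (psi (V \<union> W - {r})) = psi V + psi W" "Phi (V \<union> W - {r}) = Phi (V - {r}) * Phi W"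
    "psi V = Suc (psi (V - {r}))"
proof -
  show p: "psi V = Suc (psi (V - {r}))" by (rule psi_remove_cases[OF fV, of r]) (use assms in auto)
  show "Suc (psi (V \<union> W - {r})) = psi V + psi W" "Phi (V \<union> W - {r}) = Phi (V - {r}) * Phi W"
    using joined_remove[OF jo fV fW] p by auto
qed

text \<open>A free child leaves \<open>r\<close> forced, and isolated in the sets that avoid
  \<open>q\<close>. The exception \<open>P3_star\<close> persists only if \<open>W\<close> is a
  \<open>P3\<close>; otherwise one of the two factors brings in 2/3.\<close>

lemma join_forced_single_free:
  assumes R: "num_avoiding V r = 0" "0 < num_isolating V r" "forced_single_bound V r (psi V)"
      and cV: "crude V"
    and Q: "0 < num_avoiding W q" "free_bound W q (psi W div 2)" and cW: "crude W"
  shows "rooted_bound (V \<union> W) r"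
proof -
  let ?U = "V \<union> W"
  define p m n k where "p = psi V" and "m = psi V div 2" and "n = psi W div 2"
      and "k = psi ?U div 2"
  have v: "psi ?U = p + psi W"
      "Phi ?U = Phi V * num_avoiding W q + num_isolating V r * num_isolating W q"
    "num_isolating ?U r = num_isolating V r * num_avoiding W q"
    using joined_values[OF jo fV fW] R(1) Q(1) by (auto simp: p_def)
  note rem = join_forced_remove[OF R(1)]
  have a: "num_avoiding ?U r = 0" using num_avoiding_eq[of ?U r] fV fW rem v(1)
      by (simp add: p_def)
  note R' = R(3)[unfolded forced_single_bound_def, folded p_def]
  have QA: "3 * num_avoiding W q \<le> 1 * 3 ^ n" using Q(2) by (simp add: free_bound_def n_def)
  have QB: "3 * num_isolating W q \<le> 3 ^ n" using free_bound_isolating[OF fW Q(2)]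
      by (simp add: n_def)
  have cW': "1 * Phi W \<le> 1 * 3 ^ n" using cW by (simp add: crude_def n_def)
  have cV': "Phi V \<le> 3 ^ m" using cV by (simp add: crude_def m_def)
  have neq: "?U \<noteq> {r}" using joined_in[OF jo] by blast
  have nsing: "W \<noteq> {s}" for s
    using Q(1) single_values(3)[of q] joined_in(2)[OF jo] by auto
  have B: "3 * num_isolating ?U r \<le> 3 ^ k \<and> (even (psi ?U) \<longrightarrow> 9 * num_isolating ?U r \<le> 3 ^ k)"
  proof (cases "V = {r}")
    case True
    then have p1: "p = 1" "num_isolating V r = 1" by (simp_all add: p_def single_values)
    have 1: "1 * 3 * 3 ^ 0 * (1 * num_avoiding W q) \<le> 1 * 1 * 3 ^ k"
      by (rule mult_power3_le[of _ _ _ 0 _ _ _ n]) (use QA in \<open>auto simp: k_def n_def v(1) p1\<close>)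
    \<comment> \<open>If \<open>1 + psi W\<close> is even, then \<open>psi W\<close> is odd and
      \<open>k = n + 1\<close>.\<close>
    have 2: "1 * 3 * 3 ^ 1 * (1 * num_avoiding W q) \<le> 1 * 1 * 3 ^ k" if e: "even (psi ?U)"
      by (rule mult_power3_le[of _ _ _ 0 _ _ _ n])
        (use QA e in \<open>auto simp: k_def n_def v(1) p1 elim!: oddE\<close>)
    show ?thesis using 1 2 v(3) p1 by simp
  next
    case False
    have "3 * 3 * 3 ^ 0 * (num_isolating V r * num_avoiding W q) \<le> 1 * 1 * 3 ^ k"
      by (rule mult_power3_le)
        (use QA R' False in \<open>auto simp: k_def n_def m_def v(1) p_def\<close>)
    then show ?thesis using v(3) by simp
  qed
  \<comment> \<open>Each summand of \<open>Phi ?U\<close> is at most a third of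
    \<open>Phi V * 3 ^ n\<close>. A further factor 3 comes from the clause for even
    \<open>p\<close>, or, for odd \<open>p\<close>, from the two halves that combine because
    \<open>psi W\<close> is odd too.\<close>
  have P: "3 * Phi ?U \<le> 3 ^ k" if e: "even (psi ?U)"
  proof -
    have "num_isolating V r \<le> Phi V" using num_avoiding_isolating_le[OF fV, of r] by simp
    then have "num_isolating V r * (3 * num_isolating W q) \<le> Phi V * 3 ^ n" using QB
        by (rule mult_le_mono)
    moreover have "Phi V * (3 * num_avoiding W q) \<le> Phi V * 3 ^ n" using QA by simp
    moreover have "3 * Phi ?U = Phi V * (3 * num_avoiding W q) +
        num_isolating V r * (3 * num_isolating W q)"
      unfolding v(2) by (simp add: algebra_simps)
    ultimately have u: "3 * Phi ?U \<le> 2 * (Phi V * 3 ^ n)" by linarith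
    show ?thesis
    proof (cases "even p")
      case True
      then have "3 * Phi V \<le> 1 * 3 ^ m" using R' by (simp add: m_def p_def)
      then have "3 * 1 * 3 ^ 0 * (Phi V * 3 ^ n) \<le> 1 * 1 * 3 ^ k"
        by (rule mult_power3_le[where n = n]) (auto simp: k_def v(1) m_def n_def p_def)
      then have "3 * (Phi V * 3 ^ n) \<le> 3 ^ k" by simp
      then show ?thesis using u by linarith
    next
      case False
      then have "odd (psi W)" using e v(1) by simp
      then have "m + n + 1 \<le> k" using False unfolding k_def v(1) m_def n_def p_def by presburger
      then have "1 * 1 * 3 ^ 1 * (Phi V * 3 ^ n) \<le> 1 * 1 * 3 ^ k"
        by (intro mult_power3_le[where n = n and m = m]) (use cV' in auto)
      then have "3 * (Phi V * 3 ^ n) \<le> 3 ^ k" by simp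
      then show ?thesis using u by linarith
    qed
  qed
  have kk: "(p - 1) div 2 + n \<le> (psi ?U - 1) div 2"
    using rem(3) unfolding v(1) n_def p_def by (intro half_pred_sum) simp
  have al: "Phi (?U - {r}) \<le> 3 ^ ((psi ?U - 1) div 2)"
    using mult_power3_le[of 1 "Phi (V - {r})" 1 "(p - 1) div 2" 1 "Phi W" 1 n
        0 "(psi ?U - 1) div 2"]
      R' cW' kk rem(2) by simp
  have st: "P3_star ?U r \<or> 3 * Phi (?U - {r}) \<le> 2 * 3 ^ ((psi ?U - 1) div 2)"
  proof (cases "P3_star V r \<and> P3 W")
    case True then show ?thesis using P3_star.intros(2)[OF _ _ jo] by blast
  next
    case False
    then consider "3 * Phi (V - {r}) \<le> 2 * 3 ^ ((p - 1) div 2)" | "3 * Phi W \<le> 2 * 3 ^ n"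
      using R' cW nsing unfolding crude_def n_def by blast
    then show ?thesis
    proof cases
      case 1
      have "3 * 1 * 3 ^ 0 * (Phi (V - {r}) * Phi W) \<le> 2 * 1 * 3 ^ ((psi ?U - 1) div 2)"
        by (rule mult_power3_le) (use 1 cW' kk in auto)
      then show ?thesis using rem(2) by simp
    next
      case 2
      have "1 * 3 * 3 ^ 0 * (Phi (V - {r}) * Phi W) \<le> 1 * 2 * 3 ^ ((psi ?U - 1) div 2)"
        by (rule mult_power3_le) (use 2 R' kk in auto)
      then show ?thesis using rem(2) by simp
    qed
  qed
  have "forced_single_bound ?U r (psi ?U)"
    using B P al st unfolding forced_single_bound_def k_def by blast
  moreover have "0 < num_isolating ?U r" using v(3) R(2) Q(1) by simp
  ultimately show ?thesis using a by (simp add: rooted_bound_def)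
qed

text \<open>Both roots lie in every maximum set of their parts and both can be isolated, so in the
  union they are always matched to each other. The new root is therefore forced and paired.\<close>

lemma join_forced_single_single:
  assumes R: "num_avoiding V r = 0" "0 < num_isolating V r" "forced_single_bound V r (psi V)"
    and Q: "num_avoiding W q = 0" "0 < num_isolating W q" "forced_single_bound W q (psi W)"
        and cW: "crude W"
  shows "rooted_bound (V \<union> W) r"
proof -
  let ?U = "V \<union> W"
  define p m n k where "p = psi V" and "m = psi V div 2" and "n = psi W div 2"
      and "k = psi ?U div 2"
  have v: "psi ?U = p + psi W" "Phi ?U = num_isolating V r * num_isolating W q"
      "num_isolating ?U r = 0"
    using joined_values[OF jo fV fW] R(1,2) Q(1,2) by (auto simp: p_def)
  note rem = join_forced_remove[OF R(1)]
  have a: "num_avoiding ?U r = 0" using num_avoiding_eq[of ?U r] fV fW rem v(1)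
      by (simp add: p_def)
  note R' = R(3)[unfolded forced_single_bound_def, folded p_def]
    and Q' = Q(3)[unfolded forced_single_bound_def, folded n_def]
  have cW': "1 * Phi W \<le> 1 * 3 ^ n" using cW by (simp add: crude_def n_def)
  have p0: "0 < p" using rem(3) by (simp add: p_def)
  have al: "3 * Phi (?U - {r}) \<le> 3 ^ k"
  proof (cases "even (psi W)")
    case True
    have "1 * 3 * 3 ^ 0 * (Phi (V - {r}) * Phi W) \<le> 1 * 1 * 3 ^ k"
      by (rule mult_power3_le[of _ _ _ "(p - 1) div 2" _ _ _ n])
        (use True R' Q' p0 in \<open>auto simp: k_def v(1) n_def\<close>)
    then show ?thesis using rem(2) by simp
  next
    case False
    have "(p - 1) div 2 + n + 1 \<le> k" using False p0 unfolding k_def v(1) n_def by presburger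
    then have "1 * 1 * 3 ^ 1 * (Phi (V - {r}) * Phi W) \<le> 1 * 1 * 3 ^ k"
      by (intro mult_power3_le[of _ _ _ "(p - 1) div 2" _ _ _ n]) (use R' cW' in auto)
    then show ?thesis using rem(2) by simp
  qed
  have ph: "P2_at ?U r \<or> 9 * Phi ?U \<le> 3 ^ k"
  proof -
    \<comment> \<open>Adding a single vertex raises \<open>psi\<close> by one. For odd
      \<open>psi\<close> this raises the exponent, and for even \<open>psi\<close> the stronger
      clause already contains the missing factor 3.\<close>
    have half: "9 * num_isolating X x \<le> 3 ^ ((psi X + 1) div 2)"
      if "3 * num_isolating X x \<le> 3 ^ (psi X div 2)"
          "even (psi X) \<longrightarrow> 9 * num_isolating X x \<le> 3 ^ (psi X div 2)" for X x
      using that by (cases "even (psi X)") (auto elim!: oddE)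
    consider "V = {r}" "W = {q}" | "V = {r}" "3 * num_isolating W q \<le> 3 ^ n"
        "even (psi W) \<longrightarrow> 9 * num_isolating W q \<le> 3 ^ n"
      | "W = {q}" "3 * num_isolating V r \<le> 3 ^ m" "even p \<longrightarrow> 9 * num_isolating V r \<le> 3 ^ m"
      | "3 * num_isolating V r \<le> 1 * 3 ^ m" "3 * num_isolating W q \<le> 1 * 3 ^ n"
      using R' Q' unfolding m_def p_def by auto
    then show ?thesis
    proof cases
      case 1
      then show ?thesis using jo by (auto simp: P2_at_def joined_def)
    next
      case 2
      then have "p = 1" "num_isolating V r = 1" by (simp_all add: p_def single_values)
      then show ?thesis using half[OF 2(2,3)[unfolded n_def]] unfolding v k_def by simp
    next
      case 3
      then have "psi W = 1" "num_isolating W q = 1" by (simp_all add: single_values)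
      then show ?thesis using half[of V r] 3(2,3) unfolding v k_def p_def m_def by simp
    next
      case 4
      have "3 * 3 * 3 ^ 0 * (num_isolating V r * num_isolating W q) \<le> 1 * 1 * 3 ^ k"
        by (rule mult_power3_le) (use 4 in \<open>auto simp: k_def v(1) m_def n_def p_def\<close>)
      then show ?thesis using v(2) by simp
    qed
  qed
  show ?thesis using a v(3) al ph by (simp add: rooted_bound_def forced_paired_bound_def k_def)
qed

text \<open>The child cannot be isolated, so one vertex is lost and \<open>r\<close> becomes free.
  All the nonzero alternatives of \<open>free_bound\<close> occur here: a \<open>P3_star\<close>
  with a \<open>P2\<close> is a \<open>P2_P3_star\<close>, another \<open>V\<close> with a
  \<open>P2\<close> loses the factor 2/3, and a paired \<open>W\<close> other than a
  \<open>P2\<close> has \<open>9 * Phi W <= 3 ^ n\<close>.\<close>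

lemma join_forced_single_paired:
  assumes R: "num_avoiding V r = 0" "0 < num_isolating V r" "forced_single_bound V r (psi V)"
    and Q: "num_avoiding W q = 0" "num_isolating W q = 0" "forced_paired_bound W q (psi W div 2)"
  shows "rooted_bound (V \<union> W) r"
proof -
  let ?U = "V \<union> W"
  define p m n k where "p = psi V" and "m = psi V div 2" and "n = psi W div 2"
      and "k = psi ?U div 2"
  have v: "Suc (psi ?U) = p + psi W" "num_isolating ?U r = num_isolating V r * Phi (W - {q})"
    using joined_values_deficient[OF jo fV fW R(1) Q(1)] Q(2) by (auto simp: p_def)
  note rem = join_forced_remove[OF R(1)]
  have a: "num_avoiding ?U r = Phi (V - {r}) * Phi W"
    using num_avoiding_eq[of ?U r] fV fW rem v(1) by (simp add: p_def)
  have a0: "0 < num_avoiding ?U r" using a Phi_pos fV fW by simp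
  note R' = R(3)[unfolded forced_single_bound_def, folded p_def]
    and Q' = Q(3)[unfolded forced_paired_bound_def, folded n_def]
  have QP: "3 * Phi W \<le> 1 * 3 ^ n" using forced_paired_Phi[OF Q(3)] by (simp add: n_def)
  have p0: "0 < p" using rem(3) by (simp add: p_def)
  have kk: "(p - 1) div 2 + n \<le> k"
    using p0 v(1) unfolding k_def n_def by (rule half_sum_pred)
  have A: "3 * num_avoiding ?U r \<le> 3 ^ k"
    using mult_power3_le[of 1 "Phi (V - {r})" 1 "(p - 1) div 2" 3 "Phi W" 1 n 0 k] R' QP kk a
        by simp
  have "num_isolating ?U r = 0 \<or> P2_P3_star ?U r \<or> 9 * num_avoiding ?U r \<le> 3 ^ k \<and>
      3 * num_isolating ?U r \<le> 3 ^ k \<or>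
      9 * num_avoiding ?U r \<le> 2 * 3 ^ k \<and> 9 * num_isolating ?U r \<le> 3 ^ k"
  proof (cases "P2_at W q")
    case False
    then have "9 * Phi W \<le> 1 * 3 ^ n" using Q' by simp
    then have "1 * 9 * 3 ^ 0 * (Phi (V - {r}) * Phi W) \<le> 1 * 1 * 3 ^ k"
      by (intro mult_power3_le[of _ _ _ "(p - 1) div 2" _ _ _ n]) (use R' kk in auto)
    then have 1: "9 * num_avoiding ?U r \<le> 3 ^ k" using a by simp
    have al: "3 * Phi (W - {q}) \<le> 1 * 3 ^ n" using Q' by simp
    have "3 * num_isolating ?U r \<le> 3 ^ k"
    proof (cases "V = {r}")
      case True
      then have "p = 1" "num_isolating V r = 1" by (simp_all add: p_def single_values)
      then show ?thesis using al v unfolding k_def n_def by simp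
    next
      case False
      then have B: "3 * num_isolating V r \<le> 1 * 3 ^ m" "even p \<longrightarrow> 9 * num_isolating V r \<le> 1 * 3 ^ m"
        using R' by (auto simp: m_def p_def)
      show ?thesis
      proof (cases "even p")
        \<comment> \<open>For even \<open>p\<close> the lost vertex can reduce the exponent by one;
          the stronger clause on \<open>num_isolating\<close> makes up for it.\<close>
        case True
        have "m + n \<le> k + 1" using v(1) unfolding m_def n_def k_def p_def by (rule half_sum_Suc)
        then have "9 * 3 * 3 ^ 0 * (num_isolating V r * Phi (W - {q})) \<le> 1 * 1 * 3 ^ (k + 1)"
          by (intro mult_power3_le[of _ _ _ m _ _ _ n]) (use B True al in auto)
        then show ?thesis using v(2) by simp
      next
        case False
        have "m + n \<le> k" using v(1) False unfolding m_def n_def k_def p_def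
            by (intro half_sum_odd) auto
        then have "3 * 3 * 3 ^ 0 * (num_isolating V r * Phi (W - {q})) \<le> 1 * 1 * 3 ^ k"
          by (intro mult_power3_le[of _ _ _ m _ _ _ n]) (use B al in auto)
        then show ?thesis using v(2) by simp
      qed
    qed
    then show ?thesis using 1 by simp
  next
    case True
    note w = P2_values[OF True]
    have aU: "num_avoiding ?U r = Phi (V - {r})" "num_isolating ?U r = num_isolating V r"
        using a v(2) w by simp_all
    have k: "k = (p - 1) div 2 + 1" "psi ?U = p + 1" using v(1) w(1) p0 unfolding k_def by auto
    show ?thesis
    proof (cases "P3_star V r")
      case star: True
      then show ?thesis using P3_star_P2[OF star True jo] by simp
    next
      case False
      then have "3 * Phi (V - {r}) \<le> 2 * 3 ^ ((p - 1) div 2)" "V \<noteq> {r}"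
        using R' P3_star.intros(1) by auto
      then have "9 * num_avoiding ?U r \<le> 2 * 3 ^ k" using aU k by simp
      moreover have "9 * num_isolating ?U r \<le> 3 ^ k"
      proof (cases "even p")
        case True
        then have "k = m" using k(2) unfolding k_def m_def p_def by presburger
        then show ?thesis using R' True \<open>V \<noteq> {r}\<close> aU by (simp add: m_def p_def)
      next
        case False
        then have "k = Suc m" using k(2) unfolding k_def m_def p_def by presburger
        then show ?thesis using R' \<open>V \<noteq> {r}\<close> aU by (simp add: m_def p_def)
      qed
      ultimately show ?thesis by simp
    qed
  qed
  then show ?thesis using a0 A by (simp add: rooted_bound_def free_bound_def k_def)
qed

text \<open>With a free child the root stays paired. With a forced child one vertex is lost and the
  root becomes free, but it is never isolated, so only \<open>num_avoiding\<close> needs a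
  bound.\<close>

lemma join_forced_paired:
  assumes R: "num_avoiding V r = 0" "num_isolating V r = 0" "forced_paired_bound V r (psi V div 2)"
    and Q: "rooted_bound W q" and cW: "crude W"
  shows "rooted_bound (V \<union> W) r"
proof -
  let ?U = "V \<union> W"
  define p m n k where "p = psi V" and "m = psi V div 2" and "n = psi W div 2"
      and "k = psi ?U div 2"
  note rem = join_forced_remove[OF R(1)]
  note R' = R(3)[unfolded forced_paired_bound_def, folded m_def]
  have cW': "1 * Phi W \<le> 1 * 3 ^ n" using cW by (simp add: crude_def n_def)
  have RP: "3 * Phi V \<le> 1 * 3 ^ m" using forced_paired_Phi[OF R(3)] by (simp add: m_def)
  show ?thesis
  proof (cases "0 < num_avoiding W q")
    case True
    have v: "psi ?U = p + psi W" "Phi ?U = Phi V * num_avoiding W q" "num_isolating ?U r = 0"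
      using joined_values[OF jo fV fW] R(1,2) True by (auto simp: p_def)
    have a: "num_avoiding ?U r = 0" using num_avoiding_eq[of ?U r] fV fW rem v(1)
        by (simp add: p_def)
    have QA: "3 * num_avoiding W q \<le> 1 * 3 ^ n"
      using Q True by (auto simp: rooted_bound_def free_bound_def n_def)
    have kk: "m + n \<le> k" unfolding m_def n_def k_def v(1) p_def by presburger
    have "3 * 1 * 3 ^ 0 * (Phi (V - {r}) * Phi W) \<le> 1 * 1 * 3 ^ k"
      by (rule mult_power3_le) (use R' cW' kk in auto)
    moreover have "3 * 3 * 3 ^ 0 * (Phi V * num_avoiding W q) \<le> 1 * 1 * 3 ^ k"
      by (rule mult_power3_le) (use RP QA kk in auto)
    ultimately show ?thesis
      using a v rem(2) by (simp add: rooted_bound_def forced_paired_bound_def k_def)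
  next
    case False
    then have v: "Suc (psi ?U) = p + psi W" "num_isolating ?U r = 0"
      using joined_values_deficient[OF jo fV fW R(1)] R(2) by (auto simp: p_def)
    have a: "num_avoiding ?U r = Phi (V - {r}) * Phi W"
      using num_avoiding_eq[of ?U r] fV fW rem v(1) by (simp add: p_def)
    have a0: "0 < num_avoiding ?U r" using a Phi_pos fV fW by simp
    have "3 * num_avoiding ?U r \<le> 3 ^ k"
    proof (cases "even p \<and> even (psi W)")
      \<comment> \<open>Two even values lose a whole unit of the exponent. Forced roots with even
        \<open>psi\<close> satisfy \<open>3 * Phi W <= 3 ^ n\<close>, which recovers it.\<close>
      case True
      have QP: "3 * Phi W \<le> 1 * 3 ^ n"
        using Q False True forced_paired_Phi[of W q]
        by (auto simp: rooted_bound_def forced_single_bound_def n_def)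
      have "m + n \<le> k + 1" using v(1) unfolding m_def n_def k_def p_def by (rule half_sum_Suc)
      then have "3 * 3 * 3 ^ 0 * (Phi (V - {r}) * Phi W) \<le> 1 * 1 * 3 ^ (k + 1)"
        by (intro mult_power3_le[of _ _ _ m _ _ _ n]) (use R' QP in auto)
      then show ?thesis using a by (simp add: mult.commute)
    next
      case False
      then have "m + n \<le> k"
        using v(1) unfolding m_def n_def k_def p_def by (intro half_sum_odd) auto
      then have "3 * 1 * 3 ^ 0 * (Phi (V - {r}) * Phi W) \<le> 1 * 1 * 3 ^ k"
        by (intro mult_power3_le[of _ _ _ m _ _ _ n]) (use R' cW' in auto)
      then show ?thesis using a by simp
    qed
    then show ?thesis using a0 v(2) by (simp add: rooted_bound_def free_bound_def k_def)
  qed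
qed

end

lemma rooted_bound_join:
  assumes "joined V r W q" "finite V" "finite W" "rooted_bound V r" "rooted_bound W q" "crude V"
      "crude W"
  shows "rooted_bound (V \<union> W) r"
proof -
  consider "0 < num_avoiding V r" "free_bound V r (psi V div 2)"
    | "num_avoiding V r = 0" "num_isolating V r = 0" "forced_paired_bound V r (psi V div 2)"
    | "num_avoiding V r = 0" "0 < num_isolating V r" "forced_single_bound V r (psi V)"
    using assms(4) unfolding rooted_bound_def by auto
  then show ?thesis
  proof cases
    case 1 then show ?thesis using join_free assms by simp
  next
    case 2 then show ?thesis using join_forced_paired assms by simp
  next
    case 3
    consider "0 < num_avoiding W q" "free_bound W q (psi W div 2)"
      | "num_avoiding W q = 0" "num_isolating W q = 0" "forced_paired_bound W q (psi W div 2)"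
      | "num_avoiding W q = 0" "0 < num_isolating W q" "forced_single_bound W q (psi W)"
      using assms(5) unfolding rooted_bound_def by auto
    then show ?thesis
      by cases (use 3 assms join_forced_single_free join_forced_single_paired
          join_forced_single_single in simp_all)
  qed
qed

text \<open>The assumption of \<open>crude\<close> below size \<open>n\<close> is supplied by the
  outer induction in \<open>utree_optimal\<close>; the induction here runs over the halves at the
  root.\<close>

lemma rooted_bound_utree:
  assumes "utree V" "r \<in> V" "\<And>W. utree W \<Longrightarrow> card W < n \<Longrightarrow> crude W" "card V < n"
  shows "rooted_bound V r"
  using assms(1,2,4)
proof (induction "card V" arbitrary: V r rule: less_induct)
  case less
  show ?case
  proof (cases "V = {r}")
    case True
    then show ?thesis
      using P3_star.intros(1)[of r]
      by (simp add: rooted_bound_def forced_single_bound_def single_values)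
  next
    case False
    obtain V1 V2 q where V: "V = V1 \<union> V2" "joined V1 r V2 q" "utree V1" "utree V2"
      using utree_split_at[OF less.prems(1,2) False] by metis
    note jin = joined_in[OF V(2)]
    have fin: "finite V1" "finite V2" using V utree_finite by auto
    have c: "card V1 < card V" "card V2 < card V"
      unfolding V(1) using fin jin by (auto intro!: psubset_card_mono)
    have n: "card V1 < n" "card V2 < n" using c less.prems(3) by simp_all
    show ?thesis unfolding V(1)
      using rooted_bound_join[OF V(2) fin less.hyps[OF c(1) V(3) jin(1) n(1)]
          less.hyps[OF c(2) V(4) jin(2) n(2)] assms(3)[OF V(3) n(1)] assms(3)[OF V(4) n(2)]] .
  qed
qed

section \<open>The extremal bound\<close>

text \<open>The first clause accounts for the single vertex, which attains
  \<open>count_bound\<close> outside both families.\<close>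

definition extremal :: "'a set \<Rightarrow> bool" where
  "extremal V \<longleftrightarrow> psi V = 1 \<or> odd (psi V) \<and> (\<exists>w. T1_tree V w) \<or> even (psi V) \<and> (\<exists>w. T2_tree V w)"

definition optimal :: "'a set \<Rightarrow> bool" where
  "optimal V \<longleftrightarrow> Phi V \<le> count_bound (psi V) \<and> (Phi V = count_bound (psi V) \<longrightarrow> extremal V)"

lemma utree_psi_cases:
  assumes "utree V"
  obtains r where "V = {r}" "psi V = 1" | "2 \<le> psi V"
proof -
  obtain r where r: "r \<in> V" using utree_nonempty[OF assms] by blast
  show ?thesis
  proof (cases "V = {r}")
    case True then show ?thesis using that(1) single_values(1) by blast
  next
    case False
    obtain V1 V2 q where V: "V = V1 \<union> V2" "joined V1 r V2 q"
      using utree_split_at[OF assms r False] by metis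
    then have e: "(r, q) \<in> E" "r \<in> V" "q \<in> V" by (auto simp: joined_def)
    have "diss {r, q}" using irrefl_E by (auto simp: diss_def)
    then have "card {r, q} \<le> psi V" using card_le_psi[OF utree_finite[OF assms]] e by simp
    then show ?thesis using that(2) E_neq[OF e(1)] by simp
  qed
qed

lemma T2_tree_P3: assumes "T2_tree V r" "psi V = 2" shows "P3 V"
  using assms(1)
proof cases
  case base then show ?thesis by (rule P3_endD)
next
  case (step V0 W q)
  obtain i where "psi V0 = 2 * i + 2" using T2_tree_values[OF step(2)] by blast
  moreover have "psi V = psi V0 + 2"
    using joined_values(1)[OF step(4) finite_T2_tree[OF step(2)] finite_P3_end[OF step(3)]]
      P3_end_values[OF step(3)] step(1) by simp
  ultimately show ?thesis using assms(2) by simp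
qed

text \<open>The numerical bound suffices except at \<open>psi = 2\<close>, where the
  characterization of equality is needed to recognize the \<open>P3\<close>.\<close>

lemma optimal_imp_crude:
  assumes "utree V" "optimal V" shows "crude V"
  using assms(1)
proof (cases rule: utree_psi_cases)
  case (1 r)
  then show ?thesis by (simp add: crude_def single_values)
next
  case 2
  then have "0 < psi V" by simp
  then show ?thesis
  proof (cases rule: count_bound_cases)
    case 1 then show ?thesis using 2 by simp
  next
    case (2 m)
    then have h: "psi V div 2 = Suc m" by simp
    have "Phi V \<le> 3 ^ m + 1" using assms(2) 2 by (simp add: optimal_def count_bound_odd)
    moreover have "1 \<le> (3::nat) ^ m" by simp
    ultimately have "Phi V \<le> 3 * 3 ^ m" "3 * Phi V \<le> 2 * (3 * 3 ^ m)" by linarith+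
    then show ?thesis unfolding crude_def h power_Suc by blast
  next
    case (3 m)
    then have h: "psi V div 2 = Suc m" by simp
    have p: "Phi V \<le> 3 ^ m + m + 2" and x: "Phi V = 3 ^ m + m + 2 \<Longrightarrow> extremal V"
      using assms(2) 3 by (auto simp: optimal_def count_bound_even)
    have le: "Phi V \<le> 3 * 3 ^ m"
      using p Suc_le_power3[of m] one_le_power[of "3::nat" m] by linarith
    have "P3 V \<or> 3 * Phi V \<le> 2 * (3 * 3 ^ m)"
    proof (cases m)
      \<comment> \<open>Here \<open>psi V = 2\<close> and \<open>Phi V <= 3\<close>: three sets
        force a \<open>P3\<close>, and two or fewer satisfy the 2/3 bound.\<close>
      case 0
      then show ?thesis using p x T2_tree_P3 3 by (auto simp: extremal_def)
    next
      case (Suc k)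
      have "m + 2 \<le> 3 ^ m" unfolding Suc power_Suc using Suc_le_power3[of k] by linarith
      then show ?thesis using p by linarith
    qed
    then show ?thesis using le unfolding crude_def h power_Suc by blast
  qed
qed

section \<open>Attaching a \<open>P3\<close> or a \<open>P4\<close> to an optimal tree\<close>

text \<open>Here \<open>b\<close> stands for the isolating count of the \<open>P3\<close> at its
  attachment vertex, and \<open>X\<close> for the resulting \<open>Phi\<close>. Apart from
  \<open>V = {h}\<close>, equality needs \<open>num_avoiding V h\<close> at its maximum: then the
  isolating product must vanish for odd \<open>psi\<close> and be exactly 1 for even
  \<open>psi\<close>.\<close>

lemma attach_P3_arith:
  assumes "utree V" "h \<in> V" "optimal V" "rooted_bound V h" "b \<le> 1"
    and X: "X = Phi V + 2 * num_avoiding V h + num_isolating V h * b"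
  shows "X \<le> count_bound (psi V + 2)"
    "X = count_bound (psi V + 2) \<Longrightarrow> V = {h} \<and> b = 1 \<or> odd (psi V) \<and> T1_tree V h \<or>
       even (psi V) \<and> T2_tree V h \<and> b = 1"
proof -
  have "X \<le> count_bound (psi V + 2) \<and> (X = count_bound (psi V + 2) \<longrightarrow>
    V = {h} \<and> b = 1 \<or> odd (psi V) \<and> T1_tree V h \<or> even (psi V) \<and> T2_tree V h \<and> b = 1)"
    using assms(1)
  proof (cases rule: utree_psi_cases)
    case (1 r)
    then have "V = {h}" using assms(2) by simp
    then have "X = 1 + b" unfolding X by (simp add: single_values)
    moreover have "count_bound (psi V + 2) = 2" using 1 count_bound_odd[of 0]
        by (simp add: numeral_eq_Suc)
    ultimately show ?thesis using \<open>V = {h}\<close> assms(5) by auto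
  next
    case 2
    then have p0: "0 < psi V" by simp
    have nsing: "V \<noteq> {h}" using 2 single_values(1)[of h] by auto
    have Xb: "X \<le> Phi V + 2 * num_avoiding V h + num_isolating V h" unfolding X using assms(5)
        by (cases b) auto
    consider (free) "0 < num_avoiding V h" "free_bound V h (psi V div 2)"
      | (paired) "num_avoiding V h = 0" "num_isolating V h = 0"
      | (single) "num_avoiding V h = 0" "0 < num_isolating V h" "forced_single_bound V h (psi V)"
      using assms(4) unfolding rooted_bound_def by auto
    note state = this
    show ?thesis using p0
    proof (cases rule: count_bound_cases)
      case 1 then show ?thesis using 2 by simp
    next
      case (2 m)
      define t where "t = (3::nat) ^ m"
      have t: "1 \<le> t" by (simp add: t_def)
      have h: "psi V div 2 = Suc m" using 2 by simp
      have b2: "count_bound (psi V + 2) = 3 * t + 1"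
        using count_bound_odd[of "Suc m"] 2 by (simp add: t_def numeral_eq_Suc)
      have ph: "Phi V \<le> t + 1" and ex: "Phi V = t + 1 \<Longrightarrow> extremal V"
        using assms(3) 2 by (auto simp: optimal_def count_bound_odd t_def)
      from state show ?thesis
      proof cases
        case free
        then have A: "num_avoiding V h \<le> t"
          and B: "num_isolating V h = 0 \<or> P2_P3_star V h \<or> 3 * num_avoiding V h \<le> t \<and>
              num_isolating V h \<le> t \<or>
             3 * num_avoiding V h \<le> 2 * t \<and> 3 * num_isolating V h \<le> t"
          by (auto simp: free_bound_def h t_def)
        have "\<not> P2_P3_star V h"
        proof
          assume "P2_P3_star V h"
          then obtain j where "psi V = 2 * j + 2" using P2_P3_star_values by blast
          then show False using 2 by presburger
        qed
        with B consider "num_isolating V h = 0" | "X < 3 * t + 1"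
          using Xb ph t A by linarith
        then show ?thesis
        proof cases
          case 1
          have le: "X \<le> 3 * t + 1" using X 1 ph A by simp
          \<comment> \<open>Equality in \<open>Phi V\<close> gives some centre \<open>w\<close>
            because \<open>V\<close> is optimal; equality in \<open>num_avoiding V h\<close> then
            makes \<open>h\<close> itself a centre by \<open>T1_tree_center\<close>.\<close>
          have "T1_tree V h" if "X = 3 * t + 1"
          proof -
            have e: "Phi V = t + 1" "num_avoiding V h = t" using that X 1 ph A by auto
            then obtain w where w: "T1_tree V w"
              using ex 2 by (auto simp: extremal_def)
            show ?thesis using T1_tree_center[OF w assms(2)] 2 e by (simp add: t_def)
          qed
          then show ?thesis using le b2 2 by simp
        next
          case 2 then show ?thesis using b2 by simp
        qed
      next
        case paired
        then show ?thesis using Xb ph t b2 by simp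
      next
        case single
        then have "num_isolating V h \<le> t" using nsing
            by (auto simp: forced_single_bound_def h t_def)
        then show ?thesis using Xb ph t b2 single by simp
      qed
    next
      case (3 m)
      define t where "t = (3::nat) ^ m"
      have t: "1 \<le> t" by (simp add: t_def)
      have h: "psi V div 2 = Suc m" and ev: "even (psi V)" using 3 by simp_all
      have b2: "count_bound (psi V + 2) = 3 * t + m + 3"
        using count_bound_even[of "Suc m"] 3 by (simp add: t_def numeral_eq_Suc)
      have ph: "Phi V \<le> t + m + 2"
        using assms(3) 3 by (auto simp: optimal_def count_bound_even t_def)
      from state show ?thesis
      proof cases
        case free
        then have A: "num_avoiding V h \<le> t"
          and B: "num_isolating V h = 0 \<or> P2_P3_star V h \<or> 3 * num_avoiding V h \<le> t \<and>
              num_isolating V h \<le> t \<or>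
             3 * num_avoiding V h \<le> 2 * t \<and> 3 * num_isolating V h \<le> t"
          by (auto simp: free_bound_def h t_def)
        from B consider "P2_P3_star V h" | "X < 3 * t + m + 3"
          using Xb ph t A by linarith
        then show ?thesis
        proof cases
          case 1
          obtain j l where j: "psi V = 2 * j + 2" "num_avoiding V h = 3 ^ j"
              "num_isolating V h = 1" "Phi V = 3 ^ j + l + 2"
            "l \<le> j" "l = j \<longrightarrow> T2_tree V h"
            using P2_P3_star_values[OF 1] by blast
          have jm: "j = m" using j(1) 3 by simp
          \<comment> \<open>The bound \<open>3 * t + m + 3\<close> is met only if all
            \<open>m\<close> old copies of \<open>P3\<close> hang by ends, so \<open>l = m\<close>,
            and the new one does too, so \<open>b = 1\<close>.\<close>
          have "X = 3 * t + l + 2 + b" using X j by (simp add: jm t_def)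
          then show ?thesis using j(5,6) jm b2 assms(5) ev by auto
        next
          case 2 then show ?thesis using b2 by simp
        qed
      next
        case paired
        then show ?thesis using Xb ph t b2 by simp
      next
        case single
        then have "3 * num_isolating V h \<le> t" using nsing ev
            by (auto simp: forced_single_bound_def h t_def)
        then show ?thesis using Xb ph t b2 single by simp
      qed
    qed
  qed
  then show "X \<le> count_bound (psi V + 2)"
    "X = count_bound (psi V + 2) \<Longrightarrow> V = {h} \<and> b = 1 \<or> odd (psi V) \<and> T1_tree V h \<or>
       even (psi V) \<and> T2_tree V h \<and> b = 1" by blast+
qed

lemma rooted_bound_avoiding:
  assumes "rooted_bound V h" shows "3 * num_avoiding V h \<le> 3 ^ (psi V div 2)"
  using assms by (auto simp: rooted_bound_def free_bound_def)

text \<open>The root of the \<open>P4\<close> is never isolated, so only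
  \<open>num_avoiding V h\<close> is added. With \<open>psi V = 2 * m + 2\<close> the estimate
  misses the bound by \<open>3 ^ m - Suc m\<close>, which vanishes only for \<open>m = 0\<close>;
  for odd \<open>psi V\<close> equality is impossible.\<close>

lemma attach_P4_arith:
  assumes "utree V" "h \<in> V" "optimal V" "rooted_bound V h"
  shows "Phi V + num_avoiding V h \<le> count_bound (psi V + 3)"
    "Phi V + num_avoiding V h = count_bound (psi V + 3) \<Longrightarrow> P3 V"
proof -
  note A = rooted_bound_avoiding[OF assms(4)]
  have "Phi V + num_avoiding V h \<le> count_bound (psi V + 3) \<and>
      (Phi V + num_avoiding V h = count_bound (psi V + 3) \<longrightarrow> P3 V)"
    using assms(1)
  proof (cases rule: utree_psi_cases)
    case (1 r)
    then have "V = {h}" using assms(2) by simp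
    then have "Phi V + num_avoiding V h = 1" by (simp add: single_values)
    moreover have "count_bound (psi V + 3) = 6" using 1 count_bound_even[of 1]
        by (simp add: numeral_eq_Suc)
    ultimately show ?thesis by simp
  next
    case 2
    then have p0: "0 < psi V" by simp
    show ?thesis using p0
    proof (cases rule: count_bound_cases)
      case 1 then show ?thesis using 2 by simp
    next
      case (2 m)
      have "psi V + 3 = 2 * (m + 2) + 2" using 2 by simp
      then have b3: "count_bound (psi V + 3) = 9 * 3 ^ m + m + 4"
          by (simp only: count_bound_even) simp
      have h: "psi V div 2 = Suc m" using 2 by simp
      have "Phi V \<le> 3 ^ m + 1" using assms(3) 2 by (simp add: optimal_def count_bound_odd)
      moreover have "num_avoiding V h \<le> 3 ^ m" using A by (simp add: h)
      ultimately show ?thesis using b3 by simp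
    next
      case (3 m)
      have "psi V + 3 = 2 * Suc m + 3" using 3 by simp
      then have b3: "count_bound (psi V + 3) = 3 * 3 ^ m + 1"
          by (simp only: count_bound_odd power_Suc)
      have h: "psi V div 2 = Suc m" using 3 by simp
      have ph: "Phi V \<le> 3 ^ m + m + 2" and ex: "Phi V = 3 ^ m + m + 2 \<Longrightarrow> extremal V"
        using assms(3) 3 by (auto simp: optimal_def count_bound_even)
      have le: "num_avoiding V h \<le> 3 ^ m" using A by (simp add: h)
      note S = Suc_le_power3[of m]
      have "P3 V" if eq: "Phi V + num_avoiding V h = 3 * 3 ^ m + 1"
      proof -
        have "3 ^ m = Suc m" "Phi V = 3 ^ m + m + 2" using eq ph le S by linarith+
        then have "m = 0" "extremal V" using power3_eq_Suc ex by blast+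
        then show ?thesis using 3 T2_tree_P3 by (auto simp: extremal_def)
      qed
      then show ?thesis using ph le S b3 by auto
    qed
  qed
  then show "Phi V + num_avoiding V h \<le> count_bound (psi V + 3)"
      "Phi V + num_avoiding V h = count_bound (psi V + 3) \<Longrightarrow> P3 V"
    by blast+
qed

lemma count_bound_gt_1: "2 \<le> p \<Longrightarrow> 1 < count_bound p"
  using count_bound_less[of 1 "p - 1"] by (cases "p = 2") (auto simp: count_bound_1)

theorem utree_optimal: "utree V \<Longrightarrow> optimal V"
proof (induction "card V" arbitrary: V rule: less_induct)
  case less
  obtain r where r: "r \<in> V" using utree_nonempty[OF less.prems] by blast
  consider (single) "V = {r}" | (P2) "P2_at V r" | (bottom) "bottom V r"
    | (split) V' B h v where "V = V' \<union> B" "utree V'" "bottom B v" "joined V' h B v"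
    using utree_bottom[OF less.prems r] by blast
  then show ?case
  proof cases
    case single
    then show ?thesis by (simp add: optimal_def extremal_def single_values count_bound_1)
  next
    case P2
    then show ?thesis using P2_values[OF P2] count_bound_gt_1[of 2] by (simp add: optimal_def)
  next
    case bottom
    consider "P3 V"
      | W q where "V = W \<union> {q}" "P3_end W r" "joined W r {q} q" "psi V = 3" "Phi V = 2"
      | "3 \<le> psi V" "Phi V = 1"
      using bottom_values[OF bottom] P3_endD(1) P3_midD(1) by metis
    then show ?thesis
    proof cases
      case 1
      then obtain x where "P3_end V x" by (auto simp: P3_def)
      then have "T2_tree V x" by (rule T2_tree.base)
      then show ?thesis using P3_values(1,2)[OF 1] count_bound_even[of 0]
        by (auto simp: optimal_def extremal_def)
    next
      case 2
      have "T1_tree V r" unfolding 2(1) using 2(2,3) by (rule T1_tree.base)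
      then show ?thesis using 2(4,5) count_bound_odd[of 0] by (auto simp: optimal_def extremal_def)
    next
      case 3
      then show ?thesis using count_bound_gt_1[of "psi V"] by (simp add: optimal_def)
    qed
  next
    case split
    note jin = joined_in[OF split(4)]
    have fin: "finite V'" "finite B" using utree_finite[OF split(2)] bottom_finite[OF split(3)]
        by auto
    have c: "card V' < card V"
      unfolding split(1) using fin jin by (auto intro!: psubset_card_mono)
    note opt = less.hyps[OF c split(2)]
    \<comment> \<open>All trees smaller than \<open>V\<close> are optimal by induction, hence
      \<open>crude\<close>.\<close>
    have rb: "rooted_bound V' h"
      using rooted_bound_utree[OF split(2) jin(1) _ c] less.hyps optimal_imp_crude by blast
    have free: "num_avoiding B v = 1"
      using bottom_values[OF split(3)] P3_end_values(3)[of B v] P3_mid_values(3)[of B v] by auto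
    have v: "psi V = psi V' + psi B"
      "Phi V = num_avoiding V' h * Phi B + (Phi V' - num_avoiding V' h) +
          num_isolating V' h * num_isolating B v"
      using joined_values[OF split(4) fin] free unfolding split(1) by simp_all
    have le: "num_avoiding V' h \<le> Phi V'" using num_avoiding_isolating_le[OF fin(1), of h] by simp
    have p0: "0 < psi V'" using split(2) by (cases rule: utree_psi_cases) auto
    consider "P3 B" "psi B = 2" "Phi B = 3" "num_isolating B v \<le> 1"
        "num_isolating B v = 1 \<longrightarrow> P3_end B v"
      | W q where "B = W \<union> {q}" "P3_end W v" "joined W v {q} q" "psi B = 3" "Phi B = 2"
          "num_isolating B v = 0"
      | "3 \<le> psi B" "Phi B = 1" "num_isolating B v = 0"
    proof -
      note cases = that
      from bottom_values[OF split(3)] show thesis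
      proof (elim disjE exE conjE)
        assume e: "P3_end B v"
        show thesis using P3_end_values[OF e] P3_endD(1)[OF e] e by (intro cases(1)) simp_all
      next
        assume e: "P3_mid B v"
        show thesis using P3_mid_values[OF e] P3_midD(1)[OF e] by (intro cases(1)) simp_all
      qed (rule cases(2,3); assumption)+
    qed
    then show ?thesis
    proof cases
      case 1
      have X: "Phi V = Phi V' + 2 * num_avoiding V' h + num_isolating V' h * num_isolating B v"
          using v(2) 1(3) le by simp
      note ar = attach_P3_arith[OF split(2) jin(1) opt rb 1(4) X]
      have pV: "psi V = psi V' + 2" using v(1) 1 by simp
      have "extremal V" if eq: "Phi V = count_bound (psi V)"
      proof -
        consider "V' = {h}" "num_isolating B v = 1" | "odd (psi V')" "T1_tree V' h"
          | "even (psi V')" "T2_tree V' h" "num_isolating B v = 1"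
          using ar(2)[OF eq[unfolded pV]] by blast
        then show ?thesis
        proof cases
          \<comment> \<open>A single vertex \<open>h\<close> hung on an end of a \<open>P3\<close>
            gives a \<open>P4\<close>, whose centre is \<open>v\<close> rather than
            \<open>h\<close>.\<close>
          case a: 1
          have "joined B v {h} h" using joined_sym[OF split(4)] a by simp
          then have "T1_tree (B \<union> {h}) v" using 1(5) a(2) T1_tree.base by blast
          moreover have "V = B \<union> {h}" using split(1) a by blast
          moreover have "odd (psi V)" using pV a single_values(1)[of h] by simp
          ultimately show ?thesis by (auto simp: extremal_def)
        next
          case 2
          have "T1_tree V h" unfolding split(1) using 2(2) 1(1) split(4) by (rule T1_tree.step)
          then show ?thesis using 2 pV by (auto simp: extremal_def)
        next
          case 3
          have "T2_tree V h" unfolding split(1) using 3(2) _ split(4)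
            by (rule T2_tree.step) (use 1(5) 3(3) in blast)
          then show ?thesis using 3 pV by (auto simp: extremal_def)
        qed
      qed
      then show ?thesis using ar(1) pV by (simp add: optimal_def)
    next
      case 2
      have X: "Phi V = Phi V' + num_avoiding V' h" using v(2) 2(5,6) le by simp
      note ar = attach_P4_arith[OF split(2) jin(1) opt rb, folded X]
      have pV: "psi V = psi V' + 3" using v(1) 2 by simp
      have "extremal V" if "Phi V = count_bound (psi V)"
      proof -
        \<comment> \<open>The roles are exchanged: the \<open>P4\<close> that was cut off is the
          base, and the remainder is the \<open>P3\<close> hung on its centre
          \<open>v\<close>.\<close>
        have P: "P3 V'" using ar(2) that pV by simp
        have "T1_tree (B \<union> V') v" unfolding 2(1)
          by (rule T1_tree.step[OF T1_tree.base[OF 2(2,3)] P joined_sym[OF split(4), unfolded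
              2(1)]])
        then have "T1_tree V v" using split(1) by (simp add: Un_commute)
        moreover have "odd (psi V)" using pV P3_values(1)[OF P] by simp
        ultimately show ?thesis by (auto simp: extremal_def)
      qed
      then show ?thesis using ar(1) pV by (simp add: optimal_def)
    next
      case 3
      \<comment> \<open>Such a piece raises \<open>psi\<close> by at least 3 without creating new
        maximum sets, so the bound is missed strictly.\<close>
      have "Phi V = Phi V'" using v(2) 3 le by simp
      moreover have "Phi V' \<le> count_bound (psi V')" using opt by (simp add: optimal_def)
      moreover have "count_bound (psi V') < count_bound (psi V)"
          using count_bound_less[OF p0, of "psi B"] 3 v(1) by simp
      ultimately show ?thesis by (simp add: optimal_def)
    qed
  qed
qed

lemma T1_tree_attains: "T1_tree V w \<Longrightarrow> odd (psi V) \<and> 3 \<le> psi V \<and> Phi V = count_bound (psi V)"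
  using T1_tree_values[of V w] count_bound_odd by auto

lemma T2_tree_attains: "T2_tree V w \<Longrightarrow> even (psi V) \<and> Phi V = count_bound (psi V)"
  using T2_tree_values[of V w] count_bound_even by auto

end

section \<open>Undirected trees\<close>

lemma sgraph_pair_graph: "pair_graph G \<Longrightarrow> sgraph (parcs G)"
proof -
  assume "pair_graph G"
  then interpret pair_graph G .
  show ?thesis
    by unfold_locales (auto simp: arcs_symmetric dest: no_loops')
qed

lemma dissociation_set_iff:
  assumes "pair_graph G"
  shows "dissociation_set G S \<longleftrightarrow> S \<subseteq> pverts G \<and> sgraph.diss (parcs G) S"
proof -
  interpret pair_graph G by (rule assms)
  interpret E: sgraph "parcs G" by (rule sgraph_pair_graph[OF assms])
  have "out_degree (with_proj G \<restriction> S) v \<le> 1 \<longleftrightarrow>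
      (\<forall>x\<in>S. \<forall>y\<in>S. (v, x) \<in> parcs G \<and> (v, y) \<in> parcs G \<longrightarrow> x = y)"
    if "v \<in> S" for v
  proof -
    have out: "out_arcs (with_proj G \<restriction> S) v = {e \<in> parcs G. fst e = v \<and> snd e \<in> S}"
      using that by (auto simp: out_arcs_def induce_subgraph_def)
    have "finite {e \<in> parcs G. fst e = v \<and> snd e \<in> S}"
      using pair_finite_arcs by simp
    from card_le_Suc0_iff_eq[OF this] have "out_degree (with_proj G \<restriction> S) v \<le> 1 \<longleftrightarrow>
        (\<forall>d\<in>{e \<in> parcs G. fst e = v \<and> snd e \<in> S}. \<forall>e\<in>{e \<in> parcs G. fst e = v \<and> snd e \<in> S}. d = e)"
      unfolding out_degree_def out by (simp only: One_nat_def)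
    also have "\<dots> \<longleftrightarrow> (\<forall>x\<in>S. \<forall>y\<in>S. (v, x) \<in> parcs G \<and> (v, y) \<in> parcs G \<longrightarrow> x = y)"
      by auto
    finally show ?thesis .
  qed
  then show ?thesis unfolding dissociation_set_def E.diss_def by auto
qed

lemma dissociation_number_eq:
  assumes "pair_graph G" shows "dissociation_number G = sgraph.psi (parcs G) (pverts G)"
proof -
  interpret E: sgraph "parcs G" by (rule sgraph_pair_graph[OF assms])
  have "{card S |S. dissociation_set G S} = card ` {S. S \<subseteq> pverts G \<and> E.diss S}"
    by (auto simp: dissociation_set_iff[OF assms])
  then show ?thesis by (simp add: dissociation_number_def E.psi_def)
qed

lemma num_maximum_dissociation_sets_eq:
  assumes "pair_graph G"
  shows "num_maximum_dissociation_sets G = sgraph.Phi (parcs G) (pverts G)"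
proof -
  interpret pair_graph G by (rule assms)
  interpret E: sgraph "parcs G" by (rule sgraph_pair_graph[OF assms])
  obtain S0 where S0: "S0 \<in> E.max_diss (pverts G)"
    using E.max_diss_nonempty[OF pair_finite_verts] by blast
  have "maximum_dissociation_set G S \<longleftrightarrow> S \<in> E.max_diss (pverts G)" (is "?l \<longleftrightarrow> ?r") for S
  proof
    assume ?l
    then have S: "S \<subseteq> pverts G" "E.diss S" and max: "S0 \<subseteq> pverts G \<Longrightarrow> E.diss S0 \<Longrightarrow> card S0 \<le> card S"
      unfolding maximum_dissociation_set_def dissociation_set_iff[OF assms] by blast+
    then have "card S = E.psi (pverts G)"
      using E.card_le_psi[OF pair_finite_verts S] E.max_dissD[OF S0] by simp
    then show ?r using S by (simp add: E.max_diss_def)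
  next
    assume ?r
    then show ?l
      unfolding maximum_dissociation_set_def dissociation_set_iff[OF assms] E.max_diss_def
      using E.card_le_psi[OF pair_finite_verts] by simp
  qed
  then show ?thesis by (simp add: num_maximum_dissociation_sets_def E.Phi_def)
qed

text \<open>Cycles are lists of arcs, while the paths constructed below are lists of
  vertices.\<close>

lemma walk_of_vertices:
  assumes "successively (\<lambda>u v. (u, v) \<in> E) vs" "vs \<noteq> []"
  shows "pcas (hd vs) (zip vs (tl vs)) (last vs)" "pawalk_verts (hd vs) (zip vs (tl vs)) = vs"
    "set (zip vs (tl vs)) \<subseteq> E"
  using assms by (induction vs rule: induct_list012) auto

context sgraph begin

lemma utree_path:
  assumes "utree V" "x \<in> V" "y \<in> V"
  shows "\<exists>p. p \<noteq> [] \<and> hd p = x \<and> last p = y \<and> distinct p \<and> set p \<subseteq> V \<and>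
    successively (\<lambda>u v. (u, v) \<in> E) p"
  using assms
proof (induction arbitrary: x y rule: utree.induct)
  case (single r)
  then show ?case by (intro exI[of _ "[r]"]) simp
next
  case (join V W r q)
  have rq: "r \<in> V" "q \<in> W" "V \<inter> W = {}" "(r, q) \<in> E" "(q, r) \<in> E"
    using join.hyps(3) joined_sym[OF join.hyps(3)] by (auto simp: joined_def)
  note IH1 = join.IH(1) and IH2 = join.IH(2)
  consider "x \<in> V" "y \<in> V" | "x \<in> W" "y \<in> W" | "x \<in> V" "y \<in> W" | "x \<in> W" "y \<in> V"
    using join.prems by blast
  then show ?case
  proof cases
    case 1 then show ?thesis using IH1[OF 1] by blast
  next
    case 2 then show ?thesis using IH2[OF 2] by blast
  next
    case 3
    obtain p where p: "p \<noteq> []" "hd p = x" "last p = r" "distinct p" "set p \<subseteq> V"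
      "successively (\<lambda>u v. (u, v) \<in> E) p" using IH1[OF 3(1) rq(1)] by blast
    obtain p' where p': "p' \<noteq> []" "hd p' = q" "last p' = y" "distinct p'" "set p' \<subseteq> W"
      "successively (\<lambda>u v. (u, v) \<in> E) p'" using IH2[OF rq(2) 3(2)] by blast
    have "set p \<inter> set p' = {}" using p(5) p'(5) rq(3) by blast
    then show ?thesis using p p' rq(4)
      by (intro exI[of _ "p @ p'"]) (auto simp: successively_append_iff)
  next
    case 4
    obtain p where p: "p \<noteq> []" "hd p = x" "last p = q" "distinct p" "set p \<subseteq> W"
      "successively (\<lambda>u v. (u, v) \<in> E) p" using IH2[OF 4(1) rq(2)] by blast
    obtain p' where p': "p' \<noteq> []" "hd p' = r" "last p' = y" "distinct p'" "set p' \<subseteq> V"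
      "successively (\<lambda>u v. (u, v) \<in> E) p'" using IH1[OF rq(1) 4(2)] by blast
    have "set p \<inter> set p' = {}" using p(5) p'(5) rq(3) by blast
    then show ?thesis using p p' rq(5)
      by (intro exI[of _ "p @ p'"]) (auto simp: successively_append_iff)
  qed
qed

end

lemma connected_leaving_arc:
  assumes "pair_graph G" "connected (with_proj G)" "U \<subset> pverts G" "U \<noteq> {}"
  obtains x y where "x \<in> U" "y \<in> pverts G - U" "(x, y) \<in> parcs G"
proof -
  interpret pair_graph G by (rule assms)
  obtain u w where uw: "u \<in> U" "u \<in> pverts G" "w \<in> pverts G" "w \<notin> U" using assms(3,4) by blast
  \<comment> \<open>Connectedness refers to the symmetric closure, which adds no arcs here.\<close>
  have eq: "parcs (mk_symmetric (with_proj G)) = parcs G"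
    using arcs_symmetric by (auto simp: parcs_mk_symmetric)
  have "(u, w) \<in> rtrancl_on (pverts G) (parcs G)"
    using assms(2) uw unfolding connected_def strongly_connected_def reachable_def
        by (simp add: eq)
  then have "u \<in> U \<longrightarrow> (\<exists>x y. x \<in> U \<and> y \<in> pverts G - U \<and> (x, y) \<in> parcs G)"
    by (induction rule: converse_rtrancl_on_induct) (use uw in auto)
  then show ?thesis using uw that by blast
qed

text \<open>A largest vertex set that is a \<open>utree\<close> must be everything. Otherwise an arc
  leads from it to a new vertex \<open>y\<close>, and \<open>y\<close> has no second neighbour in
  the set, since a path between the two neighbours would close a cycle. So \<open>y\<close> could be
  joined.\<close>

lemma undirected_tree_utree:
  assumes "undirected_tree G" shows "sgraph.utree (parcs G) (pverts G)"
proof -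
  have pg: "pair_graph G" and con: "connected (with_proj G)"
    and acyc: "\<And>p. pre_digraph.cycle (with_proj G) p \<Longrightarrow> length p < 3"
    using assms by (auto simp: undirected_tree_def not_le)
  interpret pair_graph G by (rule pg)
  interpret E: sgraph "parcs G" by (rule sgraph_pair_graph[OF pg])
  let ?P = "\<lambda>U. U \<subseteq> pverts G \<and> E.utree U"
  obtain r where r: "r \<in> pverts G"
    using con by (auto simp: connected_def strongly_connected_def)
  have ex: "?P {r}" using r E.utree.single by simp
  have bound: "card U \<le> card (pverts G)" if "?P U" for U
    using that pair_finite_verts by (simp add: card_mono)
  obtain U where U: "?P U" and max: "\<And>U'. ?P U' \<Longrightarrow> card U' \<le> card U"
    using ex_has_greatest_nat[of ?P "{r}" card "Suc (card (pverts G))"] ex bound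
    by (metis less_Suc_eq_le)
  have "U = pverts G"
  proof (rule ccontr)
    assume "U \<noteq> pverts G"
    then obtain x y where xy: "x \<in> U" "y \<in> pverts G - U" "(x, y) \<in> parcs G"
      using connected_leaving_arc[OF pg con] U E.utree_nonempty by (metis psubsetI)
    have uniq: "x' = x" if x': "x' \<in> U" "(x', y) \<in> parcs G" for x'
    proof (rule ccontr)
      assume ne: "x' \<noteq> x"
      obtain p where p: "p \<noteq> []" "hd p = x" "last p = x'" "distinct p" "set p \<subseteq> U"
        "successively (\<lambda>u v. (u, v) \<in> parcs G) p"
        using E.utree_path[of U x x'] U xy(1) x'(1) by blast
      let ?vs = "y # p @ [y]"
      let ?c = "zip ?vs (tl ?vs)"
      have suc: "successively (\<lambda>u v. (u, v) \<in> parcs G) ?vs"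
        using p xy(3) x'(2) E.sym_E by (auto simp: successively_Cons successively_append_iff)
      note w = walk_of_vertices[OF suc]
      \<comment> \<open>The two neighbours differ, so the path has at least two vertices and the
        closed walk through \<open>y\<close> at least three arcs, which excludes back-and-forth
        cycles.\<close>
      have "2 \<le> length p"
      proof -
        obtain a l where "p = a # l" using p(1) by (cases p) auto
        then show ?thesis using p(2,3) ne by (cases l) auto
      qed
      then have len: "3 \<le> length ?c" by simp
      have "awalk y ?c y" using w xy(2) by (simp add: awalk_def)
      moreover have "distinct (tl (pawalk_verts y ?c))" using w(2) p(4,5) xy(2) by auto
      moreover have "?c \<noteq> []" using len by auto
      ultimately have "cycle ?c" unfolding cycle_def by blast
      then show False using acyc len by fastforce
    qed
    have "E.joined U x {y} y" unfolding E.joined_def using xy uniq by blast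
    then have "E.utree (U \<union> {y})" using U E.utree.join E.utree.single by blast
    then have "card (U \<union> {y}) \<le> card U" using max[of "U \<union> {y}"] U xy(2) by simp
    moreover have "finite U" using U E.utree_finite by blast
    ultimately show False using xy(2) by simp
  qed
  then show ?thesis using U by simp
qed

section \<open>The families as joined copies\<close>

text \<open>An isomorphism reduced to its vertex map. It runs from the model \<open>H\<close> into
  the ambient graph, so each copy in the model has an image that is a vertex set of the
  tree.\<close>

definition graph_embeds ::
    "'b rel \<Rightarrow> 'b set \<Rightarrow> 'c pair_pre_digraph \<Rightarrow> ('c \<Rightarrow> 'b) \<Rightarrow> bool" where
  "graph_embeds E V H f \<longleftrightarrow> bij_betw f (pverts H) V \<and>
     (\<forall>x\<in>pverts H. \<forall>y\<in>pverts H. (x, y) \<in> parcs H \<longleftrightarrow> (f x, f y) \<in> E)"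

lemma graph_embedsD:
  assumes "graph_embeds E V H f"
  shows "inj_on f (pverts H)" "f ` pverts H = V"
    "x \<in> pverts H \<Longrightarrow> y \<in> pverts H \<Longrightarrow> (f x, f y) \<in> E \<longleftrightarrow> (x, y) \<in> parcs H"
    "x \<in> pverts H \<Longrightarrow> y \<in> pverts H \<Longrightarrow> f x = f y \<longleftrightarrow> x = y"
  using assms by (auto simp: graph_embeds_def bij_betw_def inj_on_def)

lemma digraph_iso_imp_embeds:
  assumes "digraph_iso (with_proj G) (with_proj H)"
  shows "\<exists>f. graph_embeds (parcs G) (pverts G) H f"
proof -
  obtain k where k: "pre_digraph.digraph_isomorphism (with_proj G) k"
      "with_proj H = app_iso k (with_proj G)"
    using assms by (auto simp: digraph_iso_def)
  define g where "g = iso_verts k"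
  have inj: "inj_on g (pverts G)" and wf: "wf_digraph (with_proj G)"
    and hd: "\<And>e. e \<in> parcs G \<Longrightarrow> g (fst e) = iso_tail k (iso_arcs k e)"
       "\<And>e. e \<in> parcs G \<Longrightarrow> g (snd e) = iso_head k (iso_arcs k e)"
    using k(1) by (auto simp: pre_digraph.digraph_isomorphism_def g_def)
  interpret wf_digraph "with_proj G" by (rule wf)
  have V: "pverts H = g ` pverts G" and A: "parcs H = iso_arcs k ` parcs G"
    and t: "iso_tail k = fst" and h: "iso_head k = snd"
    using k(2) verts_app_iso[of k "with_proj G"] arcs_app_iso[of k "with_proj G"]
      tail_app_iso[of k "with_proj G"] head_app_iso[of k "with_proj G"]
    by (metis g_def with_proj_simps)+
  \<comment> \<open>Tail and head in \<open>H\<close> are the projections, which forces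
    \<open>iso_arcs k\<close> to act as \<open>g\<close> on both coordinates.\<close>
  have arc: "iso_arcs k (x, y) = (g x, g y)" if "(x, y) \<in> parcs G" for x y
    using hd[OF that] unfolding t h by (simp add: prod_eq_iff)
  have in_V: "x \<in> pverts G" "y \<in> pverts G" if "(x, y) \<in> parcs G" for x y
    using tail_in_verts[of "(x, y)"] head_in_verts[of "(x, y)"] that by simp_all
  have edge: "(g x, g y) \<in> parcs H \<longleftrightarrow> (x, y) \<in> parcs G" if xy: "x \<in> pverts G" "y \<in> pverts G" for x y
  proof
    assume "(g x, g y) \<in> parcs H"
    then obtain x' y' where e: "(x', y') \<in> parcs G" "(g x, g y) = iso_arcs k (x', y')"
      unfolding A by auto
    then have "g x = g x'" "g y = g y'" using arc by auto
    then have "x = x'" "y = y'" using inj_onD[OF inj] xy in_V[OF e(1)] by blast+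
    then show "(x, y) \<in> parcs G" using e by simp
  next
    assume "(x, y) \<in> parcs G"
    then show "(g x, g y) \<in> parcs H" unfolding A using arc by (metis image_eqI)
  qed
  have "graph_embeds (parcs G) (pverts G) H (the_inv_into (pverts G) g)"
    unfolding graph_embeds_def
  proof (intro conjI ballI)
    show "bij_betw (the_inv_into (pverts G) g) (pverts H) (pverts G)"
      unfolding V using inj by (simp add: bij_betw_the_inv_into inj_on_imp_bij_betw)
    fix x y assume "x \<in> pverts H" "y \<in> pverts H"
    then obtain x' y' where "x = g x'" "y = g y'" "x' \<in> pverts G" "y' \<in> pverts G" unfolding V
        by blast
    then show "(x, y) \<in> parcs H \<longleftrightarrow>
        (the_inv_into (pverts G) g x, the_inv_into (pverts G) g y) \<in> parcs G"
      using edge the_inv_into_f_f[OF inj] by simp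
  qed
  then show ?thesis by blast
qed

lemma embeds_imp_digraph_iso:
  assumes "pair_graph G" "graph_embeds (parcs G) (pverts G) H f" "parcs H \<subseteq> pverts H \<times> pverts H"
  shows "digraph_iso (with_proj G) (with_proj H)"
proof -
  interpret pair_graph G by (rule assms)
  note f = graph_embedsD[OF assms(2)]
  define g where "g = the_inv_into (pverts H) f"
  have bij: "bij_betw g (pverts G) (pverts H)"
    unfolding g_def using assms(2) by (simp add: graph_embeds_def bij_betw_the_inv_into)
  have gf: "g (f x) = x" if "x \<in> pverts H" for x
    unfolding g_def by (rule the_inv_into_f_f[OF f(1) that])
  have fg: "f (g x) = x" "g x \<in> pverts H" if "x \<in> pverts G" for x
    unfolding g_def using f_the_inv_into_f[OF f(1)] the_inv_into_into[OF f(1)] that f(2) by auto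
  let ?k = "\<lparr>iso_verts = g, iso_arcs = map_prod g g, iso_head = snd, iso_tail = fst\<rparr>"
  have inj: "inj_on g (pverts G)" using bij by (simp add: bij_betw_def)
  have inj2: "inj_on (map_prod g g) (parcs G)"
    using map_prod_inj_on[OF inj inj] by (rule inj_on_subset) (auto dest: in_arcsD1 in_arcsD2)
  have "pre_digraph.digraph_isomorphism (with_proj G) ?k"
    unfolding pre_digraph.digraph_isomorphism_def using inj inj2 wf_digraph_axioms by simp
  moreover have "with_proj H = app_iso ?k (with_proj G)"
  proof -
    have V: "pverts H = g ` pverts G" using bij by (simp add: bij_betw_def)
    have "parcs H = map_prod g g ` parcs G"
    proof (intro set_eqI iffI)
      fix e assume e: "e \<in> parcs H"
      then obtain x y where xy: "e = (x, y)" "x \<in> pverts H" "y \<in> pverts H" using assms(3) by auto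
      then have "(f x, f y) \<in> parcs G" using f(3) e by simp
      moreover have "e = map_prod g g (f x, f y)" using gf xy by simp
      ultimately show "e \<in> map_prod g g ` parcs G" by blast
    next
      fix e assume "e \<in> map_prod g g ` parcs G"
      then obtain x y where xy: "(x, y) \<in> parcs G" "e = (g x, g y)" by auto
      then have "x \<in> pverts G" "y \<in> pverts G" by (auto dest: in_arcsD1 in_arcsD2)
      then show "e \<in> parcs H" using xy fg f(3)[of "g x" "g y"] by simp
    qed
    then show ?thesis using V by (simp add: app_iso_def with_proj_def)
  qed
  ultimately show ?thesis unfolding digraph_iso_def by blast
qed

lemma pverts_join_copies: "pverts (join_copies I G c v a) = (SIGMA i:I. pverts (G i))"
  by (simp add: join_copies_def add_edges_def disjoint_union_def)

lemma parcs_join_copies: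
  "((i, x), (j, y)) \<in> parcs (join_copies I G c v a) \<longleftrightarrow>
     i = j \<and> i \<in> I \<and> (x, y) \<in> parcs (G i) \<or>
     i = c \<and> x = v \<and> j \<in> I - {c} \<and> y = a j \<or> j = c \<and> y = v \<and> i \<in> I - {c} \<and> x = a i"
  by (auto simp: join_copies_def add_edges_def disjoint_union_def)

lemma path_graph_simps:
  "pverts (path_graph n) = {..<n}"
  "(i, j) \<in> parcs (path_graph n) \<longleftrightarrow> i < n \<and> j < n \<and> (j = Suc i \<or> i = Suc j)"
  by (simp_all add: path_graph_def)

lemma lessThan_2_3: "{..<2} = {0, 1::nat}" "{..<3} = {0, 1, 2::nat}"
  by auto

lemma leaves_path_graph_3: "leaves (path_graph 3) = {0, 2}"
proof -
  have arcs: "out_arcs (with_proj (path_graph 3)) 0 = {(0, 1)}"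
    "out_arcs (with_proj (path_graph 3)) 1 = {(1, 0), (1, 2)}"
    "out_arcs (with_proj (path_graph 3)) 2 = {(2, 1)}"
    by (auto simp: out_arcs_def path_graph_def)
  then have "out_degree (with_proj (path_graph 3)) 0 = 1"
      "out_degree (with_proj (path_graph 3)) 1 = 2"
    "out_degree (with_proj (path_graph 3)) 2 = 1"
    by (simp_all add: out_degree_def)
  then show ?thesis by (auto simp: leaves_def path_graph_simps lessThan_2_3)
qed

text \<open>\<open>graph_embeds\<close> compares arcs between vertices of \<open>H\<close> only;
  that \<open>H\<close> has no other arcs is supplied here for the isomorphism.\<close>

lemma parcs_join_copies_subset:
  assumes "\<And>i. i \<in> I \<Longrightarrow> parcs (G i) \<subseteq> pverts (G i) \<times> pverts (G i)" "c \<in> I" "v \<in> pverts (G c)"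
    "\<And>i. i \<in> I - {c} \<Longrightarrow> a i \<in> pverts (G i)"
  shows "parcs (join_copies I G c v a) \<subseteq> pverts (join_copies I G c v a) \<times>
      pverts (join_copies I G c v a)"
proof
  fix e assume e: "e \<in> parcs (join_copies I G c v a)"
  obtain i x j y where ij: "e = ((i, x), (j, y))" by (metis surj_pair)
  show "e \<in> pverts (join_copies I G c v a) \<times> pverts (join_copies I G c v a)"
    using e assms unfolding ij parcs_join_copies pverts_join_copies by auto
qed

lemma path_graph_arcs_subset: "parcs (path_graph n) \<subseteq> pverts (path_graph n) \<times>
    pverts (path_graph n)"
  by (auto simp: path_graph_def)

section \<open>Joined copies are trees of the inductive families\<close>

context sgraph begin

lemma joined_embedded_copy:
  assumes em: "graph_embeds E V (join_copies I G c v a) f"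
    and "c \<in> J" "J \<subseteq> I" "i \<in> I - J" "v \<in> pverts (G c)" "a i \<in> pverts (G i)"
  shows "joined (f ` (SIGMA i:J. pverts (G i))) (f (c, v)) (f ` ({i} \<times> pverts (G i))) (f (i, a i))"
proof -
  note e = graph_embedsD(3,4)[OF em, unfolded pverts_join_copies]
  have "f p \<noteq> f p'" if "p \<in> (SIGMA i:J. pverts (G i))" "p' \<in> {i} \<times> pverts (G i)" for p p'
    using e(2)[of p p'] that assms(3,4) by auto
  moreover have "(f p, f p') \<in> E \<longleftrightarrow> f p = f (c, v) \<and> f p' = f (i, a i)"
    if p: "p \<in> (SIGMA i:J. pverts (G i))" "p' \<in> {i} \<times> pverts (G i)" for p p'
  proof -
    obtain j x y where jx: "p = (j, x)" "p' = (i, y)" "j \<in> J" "x \<in> pverts (G j)" "y \<in> pverts (G i)"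
      using p by auto
    have mem: "(j, x) \<in> (SIGMA i:I. pverts (G i))" "(i, y) \<in> (SIGMA i:I. pverts (G i))"
      "(c, v) \<in> (SIGMA i:I. pverts (G i))" "(i, a i) \<in> (SIGMA i:I. pverts (G i))"
      using jx assms by auto
    have ne: "j \<noteq> i" "i \<noteq> c" using jx assms(2,4) by auto
    show ?thesis
        unfolding jx e(1)[OF mem(1,2)] e(2)[OF mem(1,3)] e(2)[OF mem(2,4)] parcs_join_copies
      using ne assms(4) by auto
  qed
  ultimately show ?thesis unfolding joined_def using assms by auto
qed

lemma embedded_arc:
  assumes "graph_embeds E V (join_copies I G c v a) f" "i \<in> I" "x \<in> pverts (G i)"
      "y \<in> pverts (G i)"
    "\<And>j. (j, j) \<notin> parcs (G c)"
  shows "(f (i, x), f (i, y)) \<in> E \<longleftrightarrow> (x, y) \<in> parcs (G i)" "f (i, x) = f (i, y) \<longleftrightarrow> x = y"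
  using graph_embedsD(3,4)[OF assms(1), of "(i, x)" "(i, y)"] assms(2-4)
  unfolding pverts_join_copies parcs_join_copies by auto

lemma P3_embedded_copy:
  assumes "graph_embeds E V (join_copies I G c v a) f" "i \<in> I" "G i = path_graph 3"
    "\<And>j. (j, j) \<notin> parcs (G c)"
  shows "P3_end (f ` ({i} \<times> pverts (G i))) (f (i, 0))"
      "P3_end (f ` ({i} \<times> pverts (G i))) (f (i, 2))"
proof -
  note e = embedded_arc[OF assms(1,2) _ _ assms(4)]
  have "path3 (f (i, 0)) (f (i, 1)) (f (i, 2))"
    unfolding path3_def using e assms(3) by (simp add: path_graph_simps)
  moreover have "f ` ({i} \<times> pverts (G i)) = {f (i, 0), f (i, 1), f (i, 2)}"
    "f ` ({i} \<times> pverts (G i)) = {f (i, 2), f (i, 1), f (i, 0)}"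
    using assms(3) by (auto simp: path_graph_simps lessThan_2_3)
  ultimately show "P3_end (f ` ({i} \<times> pverts (G i))) (f (i, 0))"
    "P3_end (f ` ({i} \<times> pverts (G i))) (f (i, 2))"
    using path3_rev unfolding P3_end_def by blast+
qed

lemma P2_embedded_copy:
  assumes "graph_embeds E V (join_copies I G c v a) f" "i \<in> I" "G i = path_graph 2"
    "\<And>j. (j, j) \<notin> parcs (G c)" "x \<in> pverts (G i)"
  shows "P2_at (f ` ({i} \<times> pverts (G i))) (f (i, x))"
proof -
  note e = embedded_arc[OF assms(1,2) _ _ assms(4)]
  have x: "x = 0 \<or> x = 1" using assms(3,5) by (auto simp: path_graph_simps)
  have "(f (i, x), f (i, 1 - x)) \<in> E" using e(1)[of x "1 - x"] x assms(3)
      by (auto simp: path_graph_simps)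
  moreover have "f ` ({i} \<times> pverts (G i)) = {f (i, x), f (i, 1 - x)}"
    using x assms(3) by (auto simp: path_graph_simps lessThan_2_3)
  ultimately show ?thesis unfolding P2_at_def by blast
qed

text \<open>The fixed \<open>P2\<close> is torn apart: \<open>r\<close> together with
  \<open>W\<close> forms the \<open>P3\<close>, and the partner of \<open>r\<close> becomes the
  extra leaf.\<close>

lemma T1_tree_of_P2s:
  assumes "P2_at V r" "P2_at W q" "joined V r W q" shows "T1_tree (V \<union> W) r"
proof -
  obtain s where s: "(r, s) \<in> E" "V = {r, s}" using assms(1) by (auto simp: P2_at_def)
  have rs: "r \<noteq> s" using E_neq s by blast
  have j1: "joined {r} r W q" using joined_subset_left[OF assms(3)] s by auto
  have "joined ({r} \<union> W) r {s} s"
    using assms(3) s rs by (auto simp: joined_def E_commute[of _ s])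
  from T1_tree.base[OF _ this] P3_end_joined[OF j1 assms(2)]
  have "T1_tree ({r} \<union> W \<union> {s}) r" by simp
  moreover have "{r} \<union> W \<union> {s} = V \<union> W" using s by blast
  ultimately show ?thesis by simp
qed

lemma T1_tree_embedded:
  assumes em: "graph_embeds E V (join_copies {..<k + 2} T1_copy c v a) f"
    and c: "c < 2" and v: "v \<in> pverts (T1_copy c)"
    and a: "\<And>i. i \<in> {..<k + 2} - {c} \<Longrightarrow> a i \<in> pverts (T1_copy i)"
  shows "T1_tree V (f (c, v))"
proof -
  let ?I = "{..<k + 2}"
  have irr: "(j, j) \<notin> parcs (T1_copy c)" for j by (simp add: T1_copy_def path_graph_simps)
  have "T1_tree (f ` (SIGMA i:K \<union> {0, 1}. pverts (T1_copy i))) (f (c, v))"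
    if "finite K" "K \<subseteq> ?I - {0, 1}" for K
    using that
  proof (induction K)
    case empty
    \<comment> \<open>The fixed copy \<open>c\<close> is 0 or 1, and \<open>d\<close> is the other
      copy of \<open>P2\<close>.\<close>
    define d where "d = 1 - c"
    have d: "d \<in> ?I" "c \<in> ?I" "d \<noteq> c" "{0, 1} = {c} \<union> {d}" "d \<in> ?I - {c}" "d < 2"
      using less_2_cases[OF c] by (auto simp: d_def)
    have j: "joined (f ` (SIGMA i:{c}. pverts (T1_copy i))) (f (c, v))
        (f ` ({d} \<times> pverts (T1_copy d))) (f (d, a d))"
      by (rule joined_embedded_copy[OF em]) (use d v a in auto)
    have "P2_at (f ` ({c} \<times> pverts (T1_copy c))) (f (c, v))"
      by (rule P2_embedded_copy[OF em d(2) _ irr v]) (simp add: T1_copy_def c)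
    moreover have "P2_at (f ` ({d} \<times> pverts (T1_copy d))) (f (d, a d))"
      by (rule P2_embedded_copy[OF em d(1) _ irr a[OF d(5)]]) (simp add: T1_copy_def d(6))
    moreover have "(SIGMA i:{c}. pverts (T1_copy i)) = {c} \<times> pverts (T1_copy c)" by auto
    ultimately have "T1_tree (f ` ({c} \<times> pverts (T1_copy c)) \<union> f ` ({d} \<times>
        pverts (T1_copy d))) (f (c, v))"
      using T1_tree_of_P2s j by metis
    moreover have "(SIGMA i:{} \<union> {0, 1}. pverts (T1_copy i)) =
        {c} \<times> pverts (T1_copy c) \<union> {d} \<times> pverts (T1_copy d)"
      unfolding d(4) by auto
    ultimately show ?case by (simp only: image_Un)
  next
    case (insert i K)
    then have i: "i \<in> ?I" "i \<in> ?I - (K \<union> {0, 1})" "K \<subseteq> ?I - {0, 1}" "i \<noteq> c" "\<not> i < 2"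
      using c by auto
    have j: "joined (f ` (SIGMA i:K \<union> {0, 1}. pverts (T1_copy i))) (f (c, v))
        (f ` ({i} \<times> pverts (T1_copy i))) (f (i, a i))"
      by (rule joined_embedded_copy[OF em]) (use i c v a in auto)
    have "P3 (f ` ({i} \<times> pverts (T1_copy i)))"
      by (rule P3_endD(1), rule P3_embedded_copy(1)[OF em i(1) _ irr]) (simp add: T1_copy_def i)
    from T1_tree.step[OF insert.IH[OF i(3)] this j]
    have "T1_tree (f ` ((SIGMA i:K \<union> {0, 1}. pverts (T1_copy i)) \<union> {i} \<times>
        pverts (T1_copy i))) (f (c, v))"
      by (simp only: image_Un)
    moreover have "(SIGMA i:insert i K \<union> {0, 1}. pverts (T1_copy i)) =
        (SIGMA i:K \<union> {0, 1}. pverts (T1_copy i)) \<union> {i} \<times> pverts (T1_copy i)" by auto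
    ultimately show ?case by (simp only:)
  qed
  moreover have "(?I - {0, 1}) \<union> {0, 1} = ?I" by auto
  ultimately have "T1_tree (f ` (SIGMA i:?I. pverts (T1_copy i))) (f (c, v))"
    by (metis finite_Diff finite_lessThan order_refl)
  then show ?thesis using graph_embedsD(2)[OF em] by (simp add: pverts_join_copies)
qed

lemma T2_tree_embedded:
  fixes c j :: nat
  assumes em: "graph_embeds E V (join_copies {..<j + 1} (\<lambda>_. path_graph 3) c v a) f"
    and c: "c < j + 1" and v: "v \<in> leaves (path_graph 3)"
    and a: "\<And>i. i \<in> {..<j + 1} - {c} \<Longrightarrow> a i \<in> leaves (path_graph 3)"
  shows "T2_tree V (f (c, v))"
proof -
  let ?I = "{..<j + 1}"
  let ?G = "\<lambda>_::nat. path_graph 3"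
  have irr: "(j, j) \<notin> parcs (?G c)" for j by (simp add: path_graph_simps)
  have lv: "x \<in> pverts (path_graph 3)" if "x \<in> leaves (path_graph 3)" for x
    using that by (simp add: leaves_def)
  have end_leaf: "P3_end (f ` ({i} \<times> pverts (?G i))) (f (i, x))"
    if "i \<in> ?I" "x \<in> leaves (path_graph 3)" for i x
    using P3_embedded_copy[OF em that(1) refl irr] that(2) unfolding leaves_path_graph_3 by auto
  have "T2_tree (f ` (SIGMA i:K \<union> {c}. pverts (?G i))) (f (c, v))"
    if "finite K" "K \<subseteq> ?I - {c}" for K
    using that
  proof (induction K)
    case empty
    then show ?case using T2_tree.base[OF end_leaf[of c v]] c v by simp
  next
    case (insert i K)
    then have i: "i \<in> ?I" "i \<in> ?I - (K \<union> {c})" "K \<subseteq> ?I - {c}" "i \<in> ?I - {c}" by auto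
    have j: "joined (f ` (SIGMA i:K \<union> {c}. pverts (?G i))) (f (c, v))
        (f ` ({i} \<times> pverts (?G i))) (f (i, a i))"
      by (rule joined_embedded_copy[OF em]) (use i c lv[OF v] lv[OF a[OF i(4)]] in auto)
    from T2_tree.step[OF insert.IH[OF i(3)] end_leaf[OF i(1) a[OF i(4)]] j]
    have "T2_tree (f ` ((SIGMA i:K \<union> {c}. pverts (?G i)) \<union> {i} \<times> pverts (?G i))) (f (c, v))"
      by (simp only: image_Un)
    moreover have "(SIGMA i:insert i K \<union> {c}. pverts (?G i)) =
        (SIGMA i:K \<union> {c}. pverts (?G i)) \<union> {i} \<times> pverts (?G i)" by auto
    ultimately show ?case by (simp only:)
  qed
  moreover have "(?I - {c}) \<union> {c} = ?I" using c by auto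
  ultimately have "T2_tree (f ` (SIGMA i:?I. pverts (?G i))) (f (c, v))"
    by (metis finite_Diff finite_lessThan order_refl)
  then show ?thesis using graph_embedsD(2)[OF em] by (simp add: pverts_join_copies)
qed

section \<open>Trees of the inductive families as joined copies\<close>

lemma embeds_single_copy:
  fixes G :: "nat \<Rightarrow> 'c pair_pre_digraph"
  assumes "graph_embeds E V (G 0) g"
  shows "graph_embeds E V (join_copies {..<1} G 0 v a) (\<lambda>(i, x). g x)"
proof -
  note g = graph_embedsD[OF assms]
  have "bij_betw (\<lambda>(i, x). g x) ({0::nat} \<times> pverts (G 0)) V"
    unfolding bij_betw_def using g(1,2) by (auto simp: inj_on_def)
  moreover have "(SIGMA i:{..<1}. pverts (G i)) = {0::nat} \<times> pverts (G 0)" by auto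
  ultimately show ?thesis
    unfolding graph_embeds_def pverts_join_copies using g(3)
    by (auto simp: parcs_join_copies)
qed

text \<open>The counterpart of the \<open>step\<close> rules for copies: a part hung on the image of
  \<open>(c, v)\<close> becomes copy \<open>n\<close>.\<close>

lemma embeds_extend:
  assumes em: "graph_embeds E V (join_copies {..<n} G c v a) f" and "c < n" "v \<in> pverts (G c)"
    and g: "graph_embeds E W (G n) g" and b: "b \<in> pverts (G n)"
    and j: "joined V (f (c, v)) W (g b)"
  shows "graph_embeds E (V \<union> W) (join_copies {..<Suc n} G c v (a(n := b)))
     (\<lambda>(i, x). if i = n then g x else f (i, x))" (is "graph_embeds _ _ ?H' ?f")
proof -
  note F = graph_embedsD[OF em, unfolded pverts_join_copies] and g' = graph_embedsD[OF g]
  let ?S = "SIGMA i:{..<n}. pverts (G i)"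
  have S: "(SIGMA i:{..<Suc n}. pverts (G i)) = ?S \<union> {n} \<times> pverts (G n)"
    by (auto simp: less_Suc_eq)
  have "bij_betw ?f ?S V \<longleftrightarrow> bij_betw f ?S V" by (rule bij_betw_cong) auto
  then have b1: "bij_betw ?f ?S V" using F(1,2) by (simp add: bij_betw_def)
  have "?f ` ({n} \<times> pverts (G n)) = g ` pverts (G n)" by force
  then have b2: "bij_betw ?f ({n} \<times> pverts (G n)) W"
    unfolding bij_betw_def using g'(1,2) by (auto simp: inj_on_def)
  have bij: "bij_betw ?f (pverts ?H') (V \<union> W)"
    unfolding pverts_join_copies S by (rule bij_betw_combine[OF b1 b2 joined_in(3)[OF j]])
  have cross: "(f (i, x), g y) \<in> E \<longleftrightarrow> i = c \<and> x = v \<and> y = b"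
    "(g y, f (i, x)) \<in> E \<longleftrightarrow> i = c \<and> x = v \<and> y = b"
    if ix: "i < n" "x \<in> pverts (G i)" "y \<in> pverts (G n)" for i x y
  proof -
    have "f (i, x) \<in> V" "g y \<in> W" using F(2) g'(2) ix by auto
    then have "(f (i, x), g y) \<in> E \<longleftrightarrow> f (i, x) = f (c, v) \<and> g y = g b"
      using j by (simp add: joined_def)
    also have "\<dots> \<longleftrightarrow> i = c \<and> x = v \<and> y = b"
      using F(4)[of "(i, x)" "(c, v)"] g'(4)[of y b] ix assms(2,3) b by auto
    finally show "(f (i, x), g y) \<in> E \<longleftrightarrow> i = c \<and> x = v \<and> y = b" .
    then show "(g y, f (i, x)) \<in> E \<longleftrightarrow> i = c \<and> x = v \<and> y = b" using E_commute by blast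
  qed
  have "(p, p') \<in> parcs ?H' \<longleftrightarrow> (?f p, ?f p') \<in> E"
    if p: "p \<in> pverts ?H'" "p' \<in> pverts ?H'" for p p'
  proof -
    obtain i x i' x' where ix: "p = (i, x)" "p' = (i', x')" "i < Suc n" "i' < Suc n"
      "x \<in> pverts (G i)" "x' \<in> pverts (G i')"
      using p unfolding pverts_join_copies by auto
    have cn: "c \<noteq> n" using assms(2) by simp
    consider "i < n" "i' < n" | "i < n" "i' = n" | "i = n" "i' < n" | "i = n" "i' = n"
      using ix by linarith
    then show ?thesis
    proof cases
      case 1
      then show ?thesis using F(3)[of "(i, x)" "(i', x')"] ix
        unfolding ix(1,2) parcs_join_copies by auto
    next
      case 2
      then show ?thesis using cross(1)[of i x x'] ix cn
        unfolding ix(1,2) parcs_join_copies by auto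
    next
      case 3
      then show ?thesis using cross(2)[of i' x' x] ix cn
        unfolding ix(1,2) parcs_join_copies by auto
    next
      case 4
      then show ?thesis using g'(3)[of x x'] ix cn
        unfolding ix(1,2) parcs_join_copies by auto
    qed
  qed
  then show ?thesis using bij unfolding graph_embeds_def by blast
qed

lemma path3_embeds:
  assumes "path3 x y z"
  shows "graph_embeds E {x, y, z} (path_graph 3) ((!) [x, y, z])"
proof -
  note d = path3D[OF assms]
  have "bij_betw ((!) [x, y, z]) {0, 1, 2} {x, y, z}"
    using d by (auto simp: bij_betw_def inj_on_def)
  then show ?thesis
    unfolding graph_embeds_def path_graph_simps(1) lessThan_2_3 path_graph_simps(2)
    using d irrefl_E by auto
qed

lemma P2_embeds:
  assumes "(x, y) \<in> E"
  shows "graph_embeds E {x, y} (path_graph 2) ((!) [x, y])"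
proof -
  have d: "x \<noteq> y" "(y, x) \<in> E" using assms E_neq sym_E by auto
  then have "bij_betw ((!) [x, y]) {0, 1} {x, y}" by (auto simp: bij_betw_def inj_on_def)
  then show ?thesis
    unfolding graph_embeds_def path_graph_simps(1) lessThan_2_3 path_graph_simps(2)
    using d assms irrefl_E by auto
qed

lemma T1_tree_imp_embedded:
  assumes "T1_tree V r"
  shows "\<exists>k c v a f. graph_embeds E V (join_copies {..<k + 2} T1_copy c v a) f \<and> c < 2 \<and>
    v \<in> pverts (T1_copy c) \<and> (\<forall>i\<in>{..<k + 2} - {c}. a i \<in> pverts (T1_copy i)) \<and> f (c, v) = r"
  using assms
proof (induction rule: T1_tree.induct)
  case (base V r s)
  \<comment> \<open>The \<open>P4\<close> is regrouped as in the family: \<open>{r, s}\<close>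
    becomes copy 0 with \<open>r\<close> as its vertex 0, and \<open>W\<close> becomes copy 1,
    attached by its vertex 0, which is \<open>q\<close>.\<close>
  obtain W q where W: "joined {r} r W q" "P2_at W q" "V = {r} \<union> W" using P3_endE[OF base(1)] .
  obtain t where t: "(q, t) \<in> E" "W = {q, t}" using W(2) by (auto simp: P2_at_def)
  have e: "(r, s) \<in> E" using base(2) W(3) by (simp add: joined_def)
  have g0: "T1_copy 0 = path_graph 2" "T1_copy 1 = path_graph 2" by (simp_all add: T1_copy_def)
  have em: "graph_embeds E {r, s} (join_copies {..<1} T1_copy 0 0 (\<lambda>_. 0)) (\<lambda>(i, x). [r, s] ! x)"
    by (rule embeds_single_copy) (use P2_embeds[OF e] g0 in simp)
  have j: "joined {r, s} r W q"
    using W(1,3) joined_sym[OF base(2)] by (auto simp: joined_def)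
  have "graph_embeds E ({r, s} \<union> W) (join_copies {..<Suc 1} T1_copy 0 0 ((\<lambda>_. 0)(1 := 0)))
      (\<lambda>(i, x). if i = 1 then ([q, t] ! x) else ((\<lambda>(i, x). [r, s] ! x) (i, x)))"
    by (rule embeds_extend[OF em]) (use P2_embeds[OF t(1)] t j g0 in \<open>auto simp: path_graph_simps\<close>)
  moreover have "{r, s} \<union> W = V \<union> {s}" using W(3) by auto
  ultimately have "graph_embeds E (V \<union> {s}) (join_copies {..<0 + 2} T1_copy 0 0 ((\<lambda>_. 0)(1 := 0)))
      (\<lambda>(i, x). if i = 1 then ([q, t] ! x) else ((\<lambda>(i, x). [r, s] ! x) (i, x)))"
    by (simp add: numeral_2_eq_2)
  moreover have "\<forall>i\<in>{..<0 + 2} - {0}. ((\<lambda>_. 0)(1 := 0)) i \<in> pverts (T1_copy i)"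
    by (auto simp: T1_copy_def path_graph_simps)
  moreover have "0 \<in> pverts (T1_copy 0)" by (simp add: T1_copy_def path_graph_simps)
  ultimately show ?case by (intro exI conjI) (assumption | simp)+
next
  case (step V r W q)
  obtain k c v a f where IH: "graph_embeds E V (join_copies {..<k + 2} T1_copy c v a) f" "c < 2"
    "v \<in> pverts (T1_copy c)" "\<forall>i\<in>{..<k + 2} - {c}. a i \<in> pverts (T1_copy i)" "f (c, v) = r"
    using step.IH by blast
  obtain x y z where p: "path3 x y z" "W = {x, y, z}" using step.hyps(2)
      by (auto simp: P3_def P3_end_def)
  have gk: "T1_copy (k + 2) = path_graph 3" by (simp add: T1_copy_def)
  have em: "graph_embeds E W (T1_copy (k + 2)) ((!) [x, y, z])"
    using path3_embeds[OF p(1)] p(2) gk by simp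
  have "q \<in> ((!) [x, y, z]) ` pverts (T1_copy (k + 2))"
    using joined_in(2)[OF step.hyps(3)] graph_embedsD(2)[OF em] by simp
  then obtain b where b: "b \<in> pverts (T1_copy (k + 2))" "q = [x, y, z] ! b" by blast
  have "graph_embeds E (V \<union> W) (join_copies {..<Suc (k + 2)} T1_copy c v (a(k + 2 := b)))
     (\<lambda>(i, x'). if i = k + 2 then ([x, y, z] ! x') else f (i, x'))"
    by (rule embeds_extend[OF IH(1) _ IH(3) em b(1)]) (use IH(2,5) b(2) step.hyps(3) in auto)
  then have 1: "graph_embeds E (V \<union> W) (join_copies {..<Suc k + 2} T1_copy c v (a(k + 2 := b)))
     (\<lambda>(i, x'). if i = k + 2 then ([x, y, z] ! x') else f (i, x'))"
    by simp
  have 2: "\<forall>i\<in>{..<Suc k + 2} - {c}. (a(k + 2 := b)) i \<in> pverts (T1_copy i)"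
    using IH(4) b(1) by (auto simp: less_Suc_eq)
  have 3: "(\<lambda>(i, x'). if i = k + 2 then ([x, y, z] ! x') else f (i, x')) (c, v) = r"
    using IH(2,5) by simp
  show ?case using 1 IH(2,3) 2 3 by blast
qed

lemma T2_tree_imp_embedded:
  assumes "T2_tree V r"
  shows "\<exists>(j :: nat) c v a f. graph_embeds E V (join_copies {..<j +
      1} (\<lambda>_. path_graph 3) c v a) f \<and> c < j + 1 \<and>
    v \<in> leaves (path_graph 3) \<and> (\<forall>i\<in>{..<j + 1} - {c}. a i \<in> leaves (path_graph 3)) \<and> f (c, v) = r"
  using assms
proof (induction rule: T2_tree.induct)
  case (base V r)
  obtain y z where p: "path3 r y z" "V = {r, y, z}" using base by (auto simp: P3_end_def)
  have "graph_embeds E V (join_copies {..<1::nat} (\<lambda>_. path_graph 3) 0 0 (\<lambda>_. 0)) (\<lambda>(i, x). [r, y,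
      z] ! x)"
    by (rule embeds_single_copy) (use path3_embeds[OF p(1)] p(2) in simp)
  then have "graph_embeds E V (join_copies {..<0 +
      1::nat} (\<lambda>_. path_graph 3) 0 0 (\<lambda>_. 0)) (\<lambda>(i, x). [r, y, z] ! x)"
    by simp
  moreover have "\<forall>i\<in>{..<0 + 1::nat} - {0}. (\<lambda>_. 0) i \<in> leaves (path_graph 3)" by auto
  moreover have "0 \<in> leaves (path_graph 3)" by (simp add: leaves_path_graph_3)
  ultimately show ?case by (intro exI conjI) (assumption | simp)+
next
  case (step V r W q)
  obtain j c :: nat
      and v a f where IH: "graph_embeds E V (join_copies {..<j + 1} (\<lambda>_. path_graph 3) c v a) f"
    "c < j + 1" "v \<in> leaves (path_graph 3)"
    "\<forall>i\<in>{..<j + 1} - {c}. a i \<in> leaves (path_graph 3)" "f (c, v) = r"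
    using step.IH by blast
  obtain y z where p: "path3 q y z" "W = {q, y, z}" using step.hyps(2) by (auto simp: P3_end_def)
  have em: "graph_embeds E W (path_graph 3) ((!) [q, y, z])"
    using path3_embeds[OF p(1)] p(2) by simp
  have l: "0 \<in> leaves (path_graph 3)" "v \<in> pverts (path_graph 3)"
    using IH(3) by (auto simp: leaves_path_graph_3 path_graph_simps)
  have "graph_embeds E (V \<union> W) (join_copies {..<Suc (j + 1)} (\<lambda>_. path_graph 3) c v (a(j +
      1 := 0)))
     (\<lambda>(i, x'). if i = j + 1 then ([q, y, z] ! x') else f (i, x'))"
    by (rule embeds_extend[OF IH(1,2) l(2) em])
      (use IH(5) step.hyps(3) in \<open>auto simp: path_graph_simps\<close>)
  then have 1: "graph_embeds E (V \<union> W)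
      (join_copies {..<Suc j + 1} (\<lambda>_. path_graph 3) c v (a(j + 1 := 0)))
     (\<lambda>(i, x'). if i = j + 1 then ([q, y, z] ! x') else f (i, x'))"
    by simp
  have 2: "\<forall>i\<in>{..<Suc j + 1} - {c}. (a(j + 1 := 0)) i \<in> leaves (path_graph 3)"
    using IH(4) l(1) by (auto simp: less_Suc_eq)
  have 3: "(\<lambda>(i, x'). if i = j + 1 then ([q, y, z] ! x') else f (i, x')) (c, v) = r"
      "c < Suc j + 1"
    using IH(2,5) by simp_all
  show ?case using 1 IH(3) 2 3 by blast
qed

end

lemma family_T1_iff:
  assumes pg: "pair_graph T"
  shows "(\<exists>H\<in>family_T1. digraph_iso (with_proj T) (with_proj H)) \<longleftrightarrow>
    (\<exists>w. sgraph.T1_tree (parcs T) (pverts T) w)"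
proof -
  interpret E: sgraph "parcs T" by (rule sgraph_pair_graph[OF pg])
  show ?thesis
  proof
    assume "\<exists>H\<in>family_T1. digraph_iso (with_proj T) (with_proj H)"
    then obtain k c v a where H: "digraph_iso (with_proj T) (with_proj (join_copies {..<k +
        2} T1_copy c v a))"
      "c < 2" "v \<in> pverts (T1_copy c)" "\<forall>i\<in>{..<k + 2} - {c}. a i \<in> pverts (T1_copy i)"
      unfolding family_T1_def by blast
    obtain f where "graph_embeds (parcs T) (pverts T) (join_copies {..<k + 2} T1_copy c v a) f"
      using digraph_iso_imp_embeds[OF H(1)] by blast
    then show "\<exists>w. E.T1_tree (pverts T) w" using E.T1_tree_embedded H(2-4) by blast
  next
    assume "\<exists>w. E.T1_tree (pverts T) w"
    then obtain k c v a f where H: "graph_embeds (parcs T) (pverts T) (join_copies {..<k +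
        2} T1_copy c v a) f"
      "c < 2" "v \<in> pverts (T1_copy c)" "\<forall>i\<in>{..<k + 2} - {c}. a i \<in> pverts (T1_copy i)"
      using E.T1_tree_imp_embedded by metis
    let ?H = "join_copies {..<k + 2} T1_copy c v a"
    have "digraph_iso (with_proj T) (with_proj ?H)"
      by (rule embeds_imp_digraph_iso[OF pg H(1) parcs_join_copies_subset])
        (use H(2-4) path_graph_arcs_subset in \<open>auto simp: T1_copy_def\<close>)
    moreover have "?H \<in> family_T1" unfolding family_T1_def using H(2-4) by blast
    ultimately show "\<exists>H\<in>family_T1. digraph_iso (with_proj T) (with_proj H)" by blast
  qed
qed

lemma family_T2_iff:
  assumes pg: "pair_graph T"
  shows "(\<exists>H\<in>family_T2. digraph_iso (with_proj T) (with_proj H)) \<longleftrightarrow>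
    (\<exists>w. sgraph.T2_tree (parcs T) (pverts T) w)"
proof -
  interpret E: sgraph "parcs T" by (rule sgraph_pair_graph[OF pg])
  let ?J = "\<lambda>j :: nat. join_copies {..<j + 1} (\<lambda>_. path_graph 3)"
  show ?thesis
  proof
    assume "\<exists>H\<in>family_T2. digraph_iso (with_proj T) (with_proj H)"
    then obtain j c :: nat and v a where H: "digraph_iso (with_proj T) (with_proj (?J j c v a))"
      "c < j + 1" "v \<in> leaves (path_graph 3)" "\<forall>i\<in>{..<j + 1} - {c}. a i \<in> leaves (path_graph 3)"
      unfolding family_T2_def by blast
    obtain f where "graph_embeds (parcs T) (pverts T) (?J j c v a) f"
      using digraph_iso_imp_embeds[OF H(1)] by blast
    then show "\<exists>w. E.T2_tree (pverts T) w" using E.T2_tree_embedded H(2-4) by blast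
  next
    assume "\<exists>w. E.T2_tree (pverts T) w"
    then obtain j c :: nat and v a f where H: "graph_embeds (parcs T) (pverts T) (?J j c v a) f"
      "c < j + 1" "v \<in> leaves (path_graph 3)" "\<forall>i\<in>{..<j + 1} - {c}. a i \<in> leaves (path_graph 3)"
      using E.T2_tree_imp_embedded by metis
    have "digraph_iso (with_proj T) (with_proj (?J j c v a))"
      by (rule embeds_imp_digraph_iso[OF pg H(1) parcs_join_copies_subset])
        (use H(2-4) path_graph_arcs_subset in \<open>auto simp: leaves_def\<close>)
    moreover have "?J j c v a \<in> family_T2" unfolding family_T2_def using H(2-4) by blast
    ultimately show "\<exists>H\<in>family_T2. digraph_iso (with_proj T) (with_proj H)" by blast
  qed
qed

theorem theorem1:
  fixes T :: "'a pair_pre_digraph" and \<psi> \<Phi> :: nat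
  assumes "undirected_tree T"
  defines "\<psi> \<equiv> dissociation_number T"
    and "\<Phi> \<equiv> num_maximum_dissociation_sets T"
  shows "(\<psi> = 1 \<longrightarrow> \<Phi> = 1) \<and>
    (odd \<psi> \<and> 3 \<le> \<psi> \<longrightarrow>
       \<Phi> \<le> 3 ^ ((\<psi> - 1) div 2 - 1) + 1 \<and>
       (\<Phi> = 3 ^ ((\<psi> - 1) div 2 - 1) + 1 \<longleftrightarrow>
         (\<exists>H \<in> family_T1. digraph_iso (with_proj T) (with_proj H)))) \<and>
    (even \<psi> \<longrightarrow>
       \<Phi> \<le> 3 ^ (\<psi> div 2 - 1) + \<psi> div 2 + 1 \<and>
       (\<Phi> = 3 ^ (\<psi> div 2 - 1) + \<psi> div 2 + 1 \<longleftrightarrow>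
         (\<exists>H \<in> family_T2. digraph_iso (with_proj T) (with_proj H))))"
proof -
  have pg: "pair_graph T" using assms(1) by (simp add: undirected_tree_def)
  interpret E: sgraph "parcs T" by (rule sgraph_pair_graph[OF pg])
  let ?V = "pverts T"
  have tree: "E.utree ?V" by (rule undirected_tree_utree[OF assms(1)])
  have eq: "\<psi> = E.psi ?V" "\<Phi> = E.Phi ?V"
    unfolding assms(2,3) dissociation_number_eq[OF pg] num_maximum_dissociation_sets_eq[OF pg]
        by simp_all
  have opt: "\<Phi> \<le> count_bound \<psi>" "\<Phi> = count_bound \<psi> \<Longrightarrow> E.extremal ?V"
    using E.utree_optimal[OF tree] by (auto simp: E.optimal_def eq)
  have "\<Phi> = 1" if "\<psi> = 1"
    using opt(1) that E.Phi_pos[OF E.utree_finite[OF tree]] by (simp add: count_bound_def eq)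
  moreover have "\<Phi> \<le> count_bound \<psi> \<and>
      (\<Phi> = count_bound \<psi> \<longleftrightarrow> (\<exists>H \<in> family_T1. digraph_iso (with_proj T) (with_proj H)))"
    if "odd \<psi>" "3 \<le> \<psi>"
    unfolding family_T1_iff[OF pg] using opt that E.T1_tree_attains
    by (auto simp: E.extremal_def eq)
  moreover have "\<Phi> \<le> count_bound \<psi> \<and>
      (\<Phi> = count_bound \<psi> \<longleftrightarrow> (\<exists>H \<in> family_T2. digraph_iso (with_proj T) (with_proj H)))"
    if "even \<psi>"
    unfolding family_T2_iff[OF pg] using opt that E.T2_tree_attains
    by (auto simp: E.extremal_def eq)
  ultimately show ?thesis by (auto simp: count_bound_def)
qed

end
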